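(* Let $E$ be a $\bar v$-trimmable graph with distinguished loop $\bar e$ at $\bar v$. Let $E'$ be the subgraph of $E$ obtained by removing the loop $\bar e$, and let $E''$ be the subgraph of $E'$ obtained by removing the vertex $\bar v$ and all edges ending in $\bar v$. Then the square of *-homomorphisms $$C^*(E'')^{U(1)}\xleftarrow{\ \widetilde{\pi_1}\ }C^*(E)^{U(1)}\xrightarrow{\ \widetilde f\ }C^*(E'),\qquad C^*(E'')^{U(1)}\xrightarrow{\ \iota\ }C^*(E'')\xleftarrow{\ \pi_2\ }C^*(E')$$ is a pullback diagram of C*-algebras. That is, $\iota\circ\widetilde{\pi_1}=\pi_2\circ\widetilde f$, and $x\mapsto(\widetilde{\pi_1}(x),\widetilde f(x))$ is a *-isomorphism of $C^*(E)^{U(1)}$ onto $\{(a,b)\in C^*(E'')^{U(1)}\oplus C^*(E'):\iota(a)=\pi_2(b)\}$. The fixed-point algebras are taken with respect to the gauge actions.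
   Context: Graph conventions: a directed graph $E$ has vertex set $E_0$, edge set $E_1$, and source and range maps $s,r\colon E_1\to E_0$. A sink is a vertex $v$ with $s^{-1}(v)=\emptyset$. For a finite graph $E$, $C^*(E)$ is the universal C*-algebra generated by mutually orthogonal projections $P_v$ ($v\in E_0$) and partial isometries $S_e$ ($e\in E_1$) subject to $S_e^*S_e=P_{r(e)}$ for all $e\in E_1$, and $\sum_{e:\,s(e)=v}S_eS_e^*=P_v$ for every $v\in E_0$ that is not a sink. The generators of the algebras of different subgraphs are denoted by the same symbols. The gauge action of $U(1)$ is $\alpha_\lambda(P_v)=P_v$, $\alpha_\lambda(S_e)=\lambda S_e$; $C^*(E)^{U(1)}$ is its fixed-point subalgebra. Trimmable graph: let $E$ be a finite graph with a distinguished vertex $\bar v$ emitting a loop $\bar e$. $E$ is $\bar v$-trimmable iff (T1) $s^{-1}(\bar v)=\{\bar e\}$ and $r^{-1}(\bar v)\setminus\{\bar e\}\ne\emptyset$; (T2) for every $v\in s(r^{-1}(\bar v)\setminus\{\bar e\})$ one has $s^{-1}(v)\setminus r^{-1}(\bar v)\neq\emptyset$. Maps: $\pi_1\colon C^*(E)\to C^*(E'')$ and $\pi_2\colon C^*(E')\to C^*(E'')$ are the quotient maps by the closed ideals generated by $P_{\bar v}$ (sending $P_{\bar v}$ and all $S_e$ with $r(e)=\bar v$ to $0$, and all other generators to the generators of the same name). $f\colon C^*(E)\to C^*(E')\otimes C(S^1)$ is given by $f(P_v)=P_v\otimes 1$, $f(S_{\bar e})=P_{\bar v}\otimes u$, $f(S_e)=S_e\otimes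 u$ for $e\in E'_1$, where $u$ is the standard unitary generator of $C(S^1)$. $f$ is equivariant for the gauge action on $C^*(E)$ and the standard $U(1)$-action $u\mapsto\lambda u$ on the factor $C(S^1)$, whose fixed-point algebra is $C^*(E')\otimes 1\cong C^*(E')$. $\widetilde{\pi_1}$ and $\widetilde f$ denote the restrictions-corestrictions of $\pi_1$ and $f$ to fixed-point subalgebras, and $\iota$ is the subalgebra inclusion. *)

theory Defs
  imports
    "HOL-Analysis.Analysis"
    "HOL-Library.Poly_Mapping"
    "Graph_Theory.Digraph"
begin

section \<open>C*-algebras\<close>

record 'a cstar_alg =
  car :: "'a set"
  czero :: 'a
  cadd :: "'a \<Rightarrow> 'a \<Rightarrow> 'a"
  cscale :: "complex \<Rightarrow> 'a \<Rightarrow> 'a"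
  cmul :: "'a \<Rightarrow> 'a \<Rightarrow> 'a"
  cstar :: "'a \<Rightarrow> 'a"
  cnorm :: "'a \<Rightarrow> real"

definition csub :: "('a, 'm) cstar_alg_scheme \<Rightarrow> 'a \<Rightarrow> 'a \<Rightarrow> 'a" where
  "csub A x y = cadd A x (cscale A (-1) y)"

text \<open>Complex C*-algebras, not necessarily unital.\<close>

locale cstar_algebra =
  fixes A :: "('a, 'm) cstar_alg_scheme" (structure)
  assumes zero_closed: "czero A \<in> car A"
    and add_closed: "x \<in> car A \<Longrightarrow> y \<in> car A \<Longrightarrow> cadd A x y \<in> car A"
    and scale_closed: "x \<in> car A \<Longrightarrow> cscale A c x \<in> car A"
    and mul_closed: "x \<in> car A \<Longrightarrow> y \<in> car A \<Longrightarrow> cmul A x y \<in> car A"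
    and star_closed: "x \<in> car A \<Longrightarrow> cstar A x \<in> car A"
    and add_assoc: "x \<in> car A \<Longrightarrow> y \<in> car A \<Longrightarrow> z \<in> car A \<Longrightarrow>
      cadd A (cadd A x y) z = cadd A x (cadd A y z)"
    and add_commute: "x \<in> car A \<Longrightarrow> y \<in> car A \<Longrightarrow> cadd A x y = cadd A y x"
    and add_zero: "x \<in> car A \<Longrightarrow> cadd A (czero A) x = x"
    and sub_self: "x \<in> car A \<Longrightarrow> csub A x x = czero A"
    and scale_add_right: "x \<in> car A \<Longrightarrow> y \<in> car A \<Longrightarrow>
      cscale A c (cadd A x y) = cadd A (cscale A c x) (cscale A c y)"
    and scale_add_left: "x \<in> car A \<Longrightarrow> cscale A (c + d) x = cadd A (cscale A c x) (cscale A d x)"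
    and scale_scale: "x \<in> car A \<Longrightarrow> cscale A c (cscale A d x) = cscale A (c * d) x"
    and scale_one: "x \<in> car A \<Longrightarrow> cscale A 1 x = x"
    and mul_assoc: "x \<in> car A \<Longrightarrow> y \<in> car A \<Longrightarrow> z \<in> car A \<Longrightarrow>
      cmul A (cmul A x y) z = cmul A x (cmul A y z)"
    and distrib_right: "x \<in> car A \<Longrightarrow> y \<in> car A \<Longrightarrow> z \<in> car A \<Longrightarrow>
      cmul A (cadd A x y) z = cadd A (cmul A x z) (cmul A y z)"
    and distrib_left: "x \<in> car A \<Longrightarrow> y \<in> car A \<Longrightarrow> z \<in> car A \<Longrightarrow>
      cmul A x (cadd A y z) = cadd A (cmul A x y) (cmul A x z)"
    and scale_mul_left: "x \<in> car A \<Longrightarrow> y \<in> car A \<Longrightarrow>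
      cmul A (cscale A c x) y = cscale A c (cmul A x y)"
    and scale_mul_right: "x \<in> car A \<Longrightarrow> y \<in> car A \<Longrightarrow>
      cmul A x (cscale A c y) = cscale A c (cmul A x y)"
    and star_star: "x \<in> car A \<Longrightarrow> cstar A (cstar A x) = x"
    and star_add: "x \<in> car A \<Longrightarrow> y \<in> car A \<Longrightarrow>
      cstar A (cadd A x y) = cadd A (cstar A x) (cstar A y)"
    and star_scale: "x \<in> car A \<Longrightarrow> cstar A (cscale A c x) = cscale A (cnj c) (cstar A x)"
    and star_mul: "x \<in> car A \<Longrightarrow> y \<in> car A \<Longrightarrow>
      cstar A (cmul A x y) = cmul A (cstar A y) (cstar A x)"
    and norm_nonneg: "x \<in> car A \<Longrightarrow> 0 \<le> cnorm A x"
    and norm_eq_zero: "x \<in> car A \<Longrightarrow> cnorm A x = 0 \<longleftrightarrow> x = czero A"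
    and norm_triangle: "x \<in> car A \<Longrightarrow> y \<in> car A \<Longrightarrow> cnorm A (cadd A x y) \<le> cnorm A x + cnorm A y"
    and norm_scale: "x \<in> car A \<Longrightarrow> cnorm A (cscale A c x) = cmod c * cnorm A x"
    and norm_mul: "x \<in> car A \<Longrightarrow> y \<in> car A \<Longrightarrow> cnorm A (cmul A x y) \<le> cnorm A x * cnorm A y"
    and cstar_identity: "x \<in> car A \<Longrightarrow> cnorm A (cmul A (cstar A x) x) = (cnorm A x)\<^sup>2"
    and complete: "(\<And>n. X n \<in> car A) \<Longrightarrow>
      (\<And>e. 0 < e \<Longrightarrow> \<exists>N. \<forall>m\<ge>N. \<forall>n\<ge>N. cnorm A (csub A (X m) (X n)) < e) \<Longrightarrow>
      \<exists>x\<in>car A. (\<lambda>n. cnorm A (csub A (X n) x)) \<longlonglongrightarrow> 0"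

definition star_hom ::
  "('a, 'm) cstar_alg_scheme \<Rightarrow> ('b, 'n) cstar_alg_scheme \<Rightarrow> ('a \<Rightarrow> 'b) \<Rightarrow> bool" where
  "star_hom A B \<phi> \<longleftrightarrow>
     (\<forall>x\<in>car A. \<phi> x \<in> car B) \<and>
     (\<forall>x\<in>car A. \<forall>y\<in>car A. \<phi> (cadd A x y) = cadd B (\<phi> x) (\<phi> y)) \<and>
     (\<forall>c. \<forall>x\<in>car A. \<phi> (cscale A c x) = cscale B c (\<phi> x)) \<and>
     (\<forall>x\<in>car A. \<forall>y\<in>car A. \<phi> (cmul A x y) = cmul B (\<phi> x) (\<phi> y)) \<and>
     (\<forall>x\<in>car A. \<phi> (cstar A x) = cstar B (\<phi> x))"

definition star_iso ::
  "('a, 'm) cstar_alg_scheme \<Rightarrow> ('b, 'n) cstar_alg_scheme \<Rightarrow> ('a \<Rightarrow> 'b) \<Rightarrow> bool" where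
  "star_iso A B \<phi> \<longleftrightarrow> star_hom A B \<phi> \<and> bij_betw \<phi> (car A) (car B)"

definition fibre_product ::
  "'b cstar_alg \<Rightarrow> 'c cstar_alg \<Rightarrow> ('b \<Rightarrow> 'd) \<Rightarrow> ('c \<Rightarrow> 'd) \<Rightarrow> ('b \<times> 'c) cstar_alg" where
  "fibre_product B C i j =
     \<lparr> car = {(b, c). b \<in> car B \<and> c \<in> car C \<and> i b = j c},
       czero = (czero B, czero C),
       cadd = (\<lambda>(b, c) (b', c'). (cadd B b b', cadd C c c')),
       cscale = (\<lambda>t (b, c). (cscale B t b, cscale C t c)),
       cmul = (\<lambda>(b, c) (b', c'). (cmul B b b', cmul C c c')),
       cstar = (\<lambda>(b, c). (cstar B b, cstar C c)),
       cnorm = (\<lambda>(b, c). max (cnorm B b) (cnorm C c)) \<rparr>"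

text \<open>
  The square B \<open>\<leftarrow>\<close> A \<open>\<rightarrow>\<close> C with maps \<open>p\<close>, \<open>q\<close> over B \<open>\<rightarrow>\<close> D \<open>\<leftarrow>\<close> C with maps \<open>i\<close>, \<open>j\<close>.
\<close>

definition cstar_pullback ::
  "'a cstar_alg \<Rightarrow> 'b cstar_alg \<Rightarrow> 'c cstar_alg \<Rightarrow> 'd cstar_alg \<Rightarrow>
   ('a \<Rightarrow> 'b) \<Rightarrow> ('a \<Rightarrow> 'c) \<Rightarrow> ('b \<Rightarrow> 'd) \<Rightarrow> ('c \<Rightarrow> 'd) \<Rightarrow> bool" where
  "cstar_pullback A B C D p q i j \<longleftrightarrow>
     cstar_algebra A \<and> cstar_algebra B \<and> cstar_algebra C \<and> cstar_algebra D \<and>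
     star_hom A B p \<and> star_hom A C q \<and> star_hom B D i \<and> star_hom C D j \<and>
     (\<forall>x\<in>car A. i (p x) = j (q x)) \<and>
     star_iso A (fibre_product B C i j) (\<lambda>x. (p x, q x))"


section \<open>The free *-algebra on a set of generators\<close>

text \<open>The letter \<open>(g, False)\<close> is the generator \<open>g\<close>, and \<open>(g, True)\<close> is its adjoint.\<close>

datatype 'g star_word = Word (letters: "('g \<times> bool) list")

instantiation star_word :: (type) monoid_add
begin

definition zero_star_word :: "'a star_word" where
  "0 = Word []"

definition plus_star_word :: "'a star_word \<Rightarrow> 'a star_word \<Rightarrow> 'a star_word" where
  "u + v = Word (letters u @ letters v)"

instance
  by standard (simp_all add: zero_star_word_def plus_star_word_def)

end

text \<open>With concatenation as addition of words, the ring multiplication on finitely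
  supported functions is the product of noncommutative *-polynomials.\<close>

type_synonym 'g star_poly = "'g star_word \<Rightarrow>\<^sub>0 complex"

definition word_star :: "'g star_word \<Rightarrow> 'g star_word" where
  "word_star w = Word (rev (map (\<lambda>(g, b). (g, \<not> b)) (letters w)))"

definition poly_star :: "'g star_poly \<Rightarrow> 'g star_poly" where
  "poly_star p = Poly_Mapping.map cnj (Poly_Mapping.map_key word_star p)"

lemma word_star_word_star [simp]: "word_star (word_star w) = w"
  by (cases w) (auto simp: word_star_def rev_map comp_def case_prod_beta)

lemma inj_word_star: "inj word_star"
  by (metis injI word_star_word_star)

lemma lookup_poly_star:
  "Poly_Mapping.lookup (poly_star p) w = cnj (Poly_Mapping.lookup p (word_star w))"
  by (simp add: poly_star_def Poly_Mapping.map.rep_eq Poly_Mapping.map_key.rep_eq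
      inj_word_star when_def)

definition poly_scale :: "complex \<Rightarrow> 'g star_poly \<Rightarrow> 'g star_poly" where
  "poly_scale c p = Poly_Mapping.map ((*) c) p"

definition poly_gen :: "'g \<Rightarrow> 'g star_poly" where
  "poly_gen g = Poly_Mapping.single (Word [(g, False)]) 1"

text \<open>The empty word is excluded: this is the non-unital free *-algebra on \<open>G\<close>.\<close>

definition free_star_algebra :: "'g set \<Rightarrow> 'g star_poly set" where
  "free_star_algebra G =
     {p. \<forall>w\<in>Poly_Mapping.keys p. letters w \<noteq> [] \<and> fst ` set (letters w) \<subseteq> G}"


section \<open>The universal C*-algebra of generators and relations\<close>

text \<open>
  The universal C*-algebra generated by \<open>G\<close> subject to the relations \<open>r = 0\<close> for \<open>r \<in> R\<close> is
  the Hausdorff completion of the free *-algebra on \<open>G\<close> with respect to the largest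
  C*-seminorm that vanishes on \<open>R\<close>.  Every *-homomorphism \<open>\<phi>\<close> of the free *-algebra into a
  C*-algebra that satisfies the relations yields such a seminorm \<open>\<parallel>\<phi>(-)\<parallel>\<close>, and conversely.
  The supremum below is finite for the relations of a graph, since there
  every generator has seminorm at most 1.
\<close>

definition cstar_seminorm :: "'g set \<Rightarrow> ('g star_poly \<Rightarrow> real) \<Rightarrow> bool" where
  "cstar_seminorm G q \<longleftrightarrow>
     (\<forall>x\<in>free_star_algebra G. \<forall>y\<in>free_star_algebra G. q (x + y) \<le> q x + q y) \<and>
     (\<forall>c. \<forall>x\<in>free_star_algebra G. q (poly_scale c x) = cmod c * q x) \<and>
     (\<forall>x\<in>free_star_algebra G. \<forall>y\<in>free_star_algebra G. q (x * y) \<le> q x * q y) \<and>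
     (\<forall>x\<in>free_star_algebra G. q (poly_star x * x) = (q x)\<^sup>2)"

definition univ_norm :: "'g set \<Rightarrow> 'g star_poly set \<Rightarrow> 'g star_poly \<Rightarrow> real" where
  "univ_norm G R x = (SUP q \<in> {q. cstar_seminorm G q \<and> (\<forall>r\<in>R. q r = 0)}. q x)"

definition univ_Cauchy :: "'g set \<Rightarrow> 'g star_poly set \<Rightarrow> (nat \<Rightarrow> 'g star_poly) \<Rightarrow> bool" where
  "univ_Cauchy G R x \<longleftrightarrow> (\<forall>n. x n \<in> free_star_algebra G) \<and>
     (\<forall>e>0. \<exists>N. \<forall>m\<ge>N. \<forall>n\<ge>N. univ_norm G R (x m - x n) < e)"

definition univ_class ::
  "'g set \<Rightarrow> 'g star_poly set \<Rightarrow> (nat \<Rightarrow> 'g star_poly) \<Rightarrow> (nat \<Rightarrow> 'g star_poly) set" where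
  "univ_class G R x = {y. univ_Cauchy G R y \<and> (\<lambda>n. univ_norm G R (y n - x n)) \<longlonglongrightarrow> 0}"

text \<open>
  In the operations, the union runs over all representatives; the united classes coincide
  because the operations on Cauchy sequences respect the equivalence.
\<close>

definition univ_cstar ::
  "'g set \<Rightarrow> 'g star_poly set \<Rightarrow> (nat \<Rightarrow> 'g star_poly) set cstar_alg" where
  "univ_cstar G R =
     \<lparr> car = {univ_class G R x | x. univ_Cauchy G R x},
       czero = univ_class G R (\<lambda>n. 0),
       cadd = (\<lambda>X Y. \<Union>x\<in>X. \<Union>y\<in>Y. univ_class G R (\<lambda>n. x n + y n)),
       cscale = (\<lambda>c X. \<Union>x\<in>X. univ_class G R (\<lambda>n. poly_scale c (x n))),
       cmul = (\<lambda>X Y. \<Union>x\<in>X. \<Union>y\<in>Y. univ_class G R (\<lambda>n. x n * y n)),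
       cstar = (\<lambda>X. \<Union>x\<in>X. univ_class G R (\<lambda>n. poly_star (x n))),
       cnorm = (\<lambda>X. THE a. \<forall>x\<in>X. (\<lambda>n. univ_norm G R (x n)) \<longlonglongrightarrow> a) \<rparr>"

definition univ_gen :: "'g set \<Rightarrow> 'g star_poly set \<Rightarrow> 'g \<Rightarrow> (nat \<Rightarrow> 'g star_poly) set" where
  "univ_gen G R g = univ_class G R (\<lambda>n. poly_gen g)"

text \<open>
  The *-homomorphism from the universal C*-algebra to \<open>B\<close> with prescribed values \<open>t\<close> on the
  generators.  *-homomorphisms between C*-algebras are automatically contractive, so the norm
  clause excludes nothing; together with extensionality outside the carrier it makes
  uniqueness immediate by density.
\<close>

definition univ_hom ::
  "'g set \<Rightarrow> 'g star_poly set \<Rightarrow> 'b cstar_alg \<Rightarrow> ('g \<Rightarrow> 'b) \<Rightarrow> (nat \<Rightarrow> 'g star_poly) set \<Rightarrow> 'b" where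
  "univ_hom G R B t = (THE \<phi>.
     \<phi> \<in> extensional (car (univ_cstar G R)) \<and>
     star_hom (univ_cstar G R) B \<phi> \<and>
     (\<forall>x\<in>car (univ_cstar G R). cnorm B (\<phi> x) \<le> cnorm (univ_cstar G R) x) \<and>
     (\<forall>g\<in>G. \<phi> (univ_gen G R g) = t g))"


section \<open>Graph C*-algebras\<close>

datatype ('v, 'e) graph_gen = Vtx 'v | Edg 'e

definition graph_gens :: "('v, 'e) pre_digraph \<Rightarrow> ('v, 'e) graph_gen set" where
  "graph_gens E = Vtx ` verts E \<union> Edg ` arcs E"

abbreviation pP :: "'v \<Rightarrow> ('v, 'e) graph_gen star_poly" where
  "pP v \<equiv> poly_gen (Vtx v)"

abbreviation pS :: "'e \<Rightarrow> ('v, 'e) graph_gen star_poly" where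
  "pS e \<equiv> poly_gen (Edg e)"

text \<open>
  Here \<open>tail\<close> is the source map and \<open>head\<close> the range map, and \<open>v\<close> is a sink
  iff \<open>out_arcs E v = {}\<close>.
\<close>

definition graph_rels :: "('v, 'e) pre_digraph \<Rightarrow> ('v, 'e) graph_gen star_poly set" where
  "graph_rels E =
     {poly_star (pP v) - pP v | v. v \<in> verts E} \<union>
     {pP v * pP v - pP v | v. v \<in> verts E} \<union>
     {pP v * pP w | v w. v \<in> verts E \<and> w \<in> verts E \<and> v \<noteq> w} \<union>
     {pS e * poly_star (pS e) * pS e - pS e | e. e \<in> arcs E} \<union>
     {poly_star (pS e) * pS e - pP (head E e) | e. e \<in> arcs E} \<union>
     {(\<Sum>e\<in>out_arcs E v. pS e * poly_star (pS e)) - pP v | v. v \<in> verts E \<and> out_arcs E v \<noteq> {}}"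

type_synonym ('v, 'e) graph_elt = "(nat \<Rightarrow> ('v, 'e) graph_gen star_poly) set"

definition graph_cstar :: "('v, 'e) pre_digraph \<Rightarrow> ('v, 'e) graph_elt cstar_alg" where
  "graph_cstar E = univ_cstar (graph_gens E) (graph_rels E)"

definition gP :: "('v, 'e) pre_digraph \<Rightarrow> 'v \<Rightarrow> ('v, 'e) graph_elt" where
  "gP E v = univ_gen (graph_gens E) (graph_rels E) (Vtx v)"

definition gS :: "('v, 'e) pre_digraph \<Rightarrow> 'e \<Rightarrow> ('v, 'e) graph_elt" where
  "gS E e = univ_gen (graph_gens E) (graph_rels E) (Edg e)"

text \<open>The *-homomorphism sending each \<open>P\<^sub>v\<close> to \<open>p v\<close> and each \<open>S\<^sub>e\<close> to \<open>s e\<close>.\<close>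

definition graph_hom ::
  "('v, 'e) pre_digraph \<Rightarrow> 'b cstar_alg \<Rightarrow> ('v \<Rightarrow> 'b) \<Rightarrow> ('e \<Rightarrow> 'b) \<Rightarrow> ('v, 'e) graph_elt \<Rightarrow> 'b" where
  "graph_hom E B p s = univ_hom (graph_gens E) (graph_rels E) B (case_graph_gen p s)"

definition gauge :: "('v, 'e) pre_digraph \<Rightarrow> complex \<Rightarrow> ('v, 'e) graph_elt \<Rightarrow> ('v, 'e) graph_elt" where
  "gauge E z = graph_hom E (graph_cstar E) (gP E) (\<lambda>e. cscale (graph_cstar E) z (gS E e))"

definition gauge_fixed :: "('v, 'e) pre_digraph \<Rightarrow> ('v, 'e) graph_elt cstar_alg" where
  "gauge_fixed E = (graph_cstar E)
     \<lparr> car := {x \<in> car (graph_cstar E). \<forall>z\<in>sphere 0 1. gauge E z x = x} \<rparr>"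


section \<open>The tensor product with C(S1)\<close>

text \<open>
  The C*-tensor product of \<open>A\<close> with C(S1), realised as an algebra of functions from the unit
  circle to \<open>A\<close>: the elementary tensor of \<open>a\<close> and \<open>g\<close> is the function \<open>z \<mapsto> g z a\<close>, the
  algebraic tensor product is the span of these, and the tensor product is its completion in
  the (unique) C*-norm, which is the supremum norm.
\<close>

definition elem_tensor ::
  "'a cstar_alg \<Rightarrow> 'a \<Rightarrow> (complex \<Rightarrow> complex) \<Rightarrow> complex \<Rightarrow> 'a" where
  "elem_tensor A a g = (\<lambda>z\<in>sphere 0 1. cscale A (g z) a)"

inductive_set alg_tensor_circle :: "'a cstar_alg \<Rightarrow> (complex \<Rightarrow> 'a) set" for A where
  elem: "a \<in> car A \<Longrightarrow> continuous_on (sphere 0 1) g \<Longrightarrow> elem_tensor A a g \<in> alg_tensor_circle A"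
| add: "F \<in> alg_tensor_circle A \<Longrightarrow> H \<in> alg_tensor_circle A \<Longrightarrow>
    (\<lambda>z\<in>sphere 0 1. cadd A (F z) (H z)) \<in> alg_tensor_circle A"

definition tensor_circle :: "'a cstar_alg \<Rightarrow> (complex \<Rightarrow> 'a) cstar_alg" where
  "tensor_circle A =
     \<lparr> car = {F \<in> sphere 0 1 \<rightarrow>\<^sub>E car A. \<forall>e>0. \<exists>H\<in>alg_tensor_circle A.
                \<forall>z\<in>sphere 0 1. cnorm A (csub A (F z) (H z)) < e},
       czero = (\<lambda>z\<in>sphere 0 1. czero A),
       cadd = (\<lambda>F H. \<lambda>z\<in>sphere 0 1. cadd A (F z) (H z)),
       cscale = (\<lambda>c F. \<lambda>z\<in>sphere 0 1. cscale A c (F z)),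
       cmul = (\<lambda>F H. \<lambda>z\<in>sphere 0 1. cmul A (F z) (H z)),
       cstar = (\<lambda>F. \<lambda>z\<in>sphere 0 1. cstar A (F z)),
       cnorm = (\<lambda>F. SUP z\<in>sphere 0 1. cnorm A (F z)) \<rparr>"


section \<open>Trimmable graphs and the maps of the square\<close>

definition trimmable :: "('v, 'e) pre_digraph \<Rightarrow> 'v \<Rightarrow> 'e \<Rightarrow> bool" where
  "trimmable E vb eb \<longleftrightarrow>
     fin_digraph E \<and> vb \<in> verts E \<and> eb \<in> arcs E \<and> tail E eb = vb \<and> head E eb = vb \<and>
     out_arcs E vb = {eb} \<and> in_arcs E vb - {eb} \<noteq> {} \<and>
     (\<forall>v \<in> tail E ` (in_arcs E vb - {eb}). out_arcs E v - in_arcs E vb \<noteq> {})"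

text \<open>
  For \<open>G\<close> obtained from \<open>E\<close> by removing the loop, \<open>del_vert\<close> removes \<open>vb\<close> and all edges
  starting or ending there; no edge of \<open>G\<close> starts at \<open>vb\<close> when \<open>E\<close> is trimmable.
\<close>

abbreviation trim1 :: "('v, 'e) pre_digraph \<Rightarrow> 'e \<Rightarrow> ('v, 'e) pre_digraph" where
  "trim1 E eb \<equiv> pre_digraph.del_arc E eb"

abbreviation trim2 :: "('v, 'e) pre_digraph \<Rightarrow> 'v \<Rightarrow> 'e \<Rightarrow> ('v, 'e) pre_digraph" where
  "trim2 E vb eb \<equiv> pre_digraph.del_vert (trim1 E eb) vb"

text \<open>
  For \<open>F\<close> either \<open>E\<close> or \<open>trim1 E eb\<close>, and \<open>K = trim2 E vb eb\<close>, this is the quotient map of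
  the C*-algebra of \<open>F\<close> by the closed ideal generated by the projection of \<open>vb\<close>.
\<close>

definition quot_map ::
  "('v, 'e) pre_digraph \<Rightarrow> ('v, 'e) pre_digraph \<Rightarrow> 'v \<Rightarrow> ('v, 'e) graph_elt \<Rightarrow> ('v, 'e) graph_elt" where
  "quot_map F K vb = graph_hom F (graph_cstar K)
     (\<lambda>v. if v = vb then czero (graph_cstar K) else gP K v)
     (\<lambda>e. if head F e = vb then czero (graph_cstar K) else gS K e)"

definition pi1 :: "('v, 'e) pre_digraph \<Rightarrow> 'v \<Rightarrow> 'e \<Rightarrow> ('v, 'e) graph_elt \<Rightarrow> ('v, 'e) graph_elt" where
  "pi1 E vb eb = quot_map E (trim2 E vb eb) vb"

definition pi2 :: "('v, 'e) pre_digraph \<Rightarrow> 'v \<Rightarrow> 'e \<Rightarrow> ('v, 'e) graph_elt \<Rightarrow> ('v, 'e) graph_elt" where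
  "pi2 E vb eb = quot_map (trim1 E eb) (trim2 E vb eb) vb"

text \<open>The standard unitary generator of C(S1) is the inclusion of the circle, \<open>\<lambda>z. z\<close>.\<close>

definition f_map ::
  "('v, 'e) pre_digraph \<Rightarrow> 'v \<Rightarrow> 'e \<Rightarrow> ('v, 'e) graph_elt \<Rightarrow> complex \<Rightarrow> ('v, 'e) graph_elt" where
  "f_map E vb eb = (let E' = trim1 E eb; A' = graph_cstar E' in
     graph_hom E (tensor_circle A')
       (\<lambda>v. elem_tensor A' (gP E' v) (\<lambda>z. 1))
       (\<lambda>e. elem_tensor A' (if e = eb then gP E' vb else gS E' e) (\<lambda>z. z)))"

definition pi1_fixed ::
  "('v, 'e) pre_digraph \<Rightarrow> 'v \<Rightarrow> 'e \<Rightarrow> ('v, 'e) graph_elt \<Rightarrow> ('v, 'e) graph_elt" where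
  "pi1_fixed E vb eb = restrict (pi1 E vb eb) (car (gauge_fixed E))"

text \<open>The corestriction of \<open>f_map\<close> under the identification \<open>b \<mapsto> b \<otimes> 1\<close>.\<close>

definition f_fixed ::
  "('v, 'e) pre_digraph \<Rightarrow> 'v \<Rightarrow> 'e \<Rightarrow> ('v, 'e) graph_elt \<Rightarrow> ('v, 'e) graph_elt" where
  "f_fixed E vb eb = (let A' = graph_cstar (trim1 E eb) in
     (\<lambda>x\<in>car (gauge_fixed E). THE b. b \<in> car A' \<and> elem_tensor A' b (\<lambda>z. 1) = f_map E vb eb x))"

end

theory Submission
  imports Defs
begin

text \<open>
  Let \<open>g\<close> be the composite of \<open>f\<close> with evaluation at \<open>1\<close>, so that \<open>g\<close> sends the loop \<open>S\<close> at the
  distinguished vertex to \<open>P\<close> and fixes the other generators.  On gauge-invariant elements \<open>f\<close>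
  is \<open>g \<otimes> 1\<close>, and \<open>\<pi>\<^sub>1 = \<pi>\<^sub>2 \<circ> g\<close>.  So the claim is that \<open>g\<close> maps the fixed-point algebra
  isometrically onto the elements of C*(E') whose image in C*(E'') is gauge invariant.

  Isometry: the fixed-point algebra is the closure of the increasing union of the finite-dimensional
  algebras spanned by the \<open>S\<^sub>a S\<^sub>b\<^sup>*\<close> with \<open>a\<close>, \<open>b\<close> paths of length \<open>n\<close>, or shorter paths ending
  in a sink.  A C*-seminorm there is determined by its values on the vertex projections.

  Surjectivity: averaging over roots of unity shows that an element of C*(E') with gauge-invariant
  image is, modulo the ideal generated by \<open>P\<close>, a limit of polynomials of degree 0, which lift
  verbatim.  As the distinguished vertex is a sink of E', that ideal is the closed span of the
  \<open>S\<^sub>a S\<^sub>b\<^sup>*\<close> with \<open>a\<close>, \<open>b\<close> paths ending there, and these lift after the shorter path is prolonged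
  by the loop.

  All computations take place on *-polynomials modulo C*-seminorms.
\<close>

section \<open>Noncommutative *-polynomials\<close>

text \<open>Inequalities between universal norms need no representations: \<open>univ_norm\<close>
  is the largest C*-seminorm that kills the relations, so exhibiting any such seminorm bounds it
  from below, and this maximality is the universal property. In exchange, positivity, spectra and
  functional calculus are not at hand, and two substitutes carry the proof. A constant in a
  comparison of norms is removed by repeated squaring of self-adjoint elements, which the
  C*-identity turns into squaring of norms. And the relations do not state that different edges have
  orthogonal ranges; that projections summing to a projection are orthogonal is drawn from the unit
  ball of a corner instead of from the order. For the same reason the quotient by the ideal of the
  sink is given by an explicit norm, shown to be a C*-seminorm that kills the relations of E''.
  Condition (T1) makes the distinguished vertex a sink of E'. Condition (T2) enters where pi_2 is
  constructed: a vertex with an edge into the distinguished one keeps an edge in E'', so its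
  Cuntz-Krieger relation survives.\<close>

lemma lookup_poly_scale: "Poly_Mapping.lookup (poly_scale c p) w = c * Poly_Mapping.lookup p w"
  by (simp add: poly_scale_def Poly_Mapping.map.rep_eq when_def)

lemma poly_scale_conv_mult: "poly_scale c p = Poly_Mapping.single 0 c * p"
  by (simp add: poly_scale_def mult_map_scale_conv_mult)

lemma poly_scale_add_right: "poly_scale c (p + q) = poly_scale c p + poly_scale c q"
  by (simp add: poly_scale_conv_mult distrib_left)

lemma poly_scale_diff_right: "poly_scale c (p - q) = poly_scale c p - poly_scale c q"
  by (simp add: poly_scale_conv_mult right_diff_distrib)

lemma poly_scale_add_left: "poly_scale (c + d) p = poly_scale c p + poly_scale d p"
  by (simp add: poly_scale_conv_mult single_add distrib_right)

lemma poly_scale_scale [simp]: "poly_scale c (poly_scale d p) = poly_scale (c * d) p"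
  by (rule poly_mapping_eqI) (simp add: lookup_poly_scale)

lemma poly_scale_one [simp]: "poly_scale 1 p = p"
  by (rule poly_mapping_eqI) (simp add: lookup_poly_scale)

lemma poly_scale_zero_left [simp]: "poly_scale 0 p = 0"
  by (rule poly_mapping_eqI) (simp add: lookup_poly_scale)

lemma poly_scale_zero_right [simp]: "poly_scale c 0 = 0"
  by (rule poly_mapping_eqI) (simp add: lookup_poly_scale)

lemma poly_scale_minus_one: "poly_scale (-1) p = - p"
  by (rule poly_mapping_eqI) (simp add: lookup_poly_scale)

lemma poly_scale_single [simp]: "poly_scale c (Poly_Mapping.single w d) = Poly_Mapping.single w (c * d)"
  by (rule poly_mapping_eqI) (simp add: lookup_poly_scale lookup_single when_def)

lemma poly_scale_mult_left: "poly_scale c p * q = poly_scale c (p * q)"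
  by (simp add: poly_scale_conv_mult mult.assoc)

lemma star_poly_sum_single: "p = (\<Sum>w\<in>Poly_Mapping.keys p. Poly_Mapping.single w (Poly_Mapping.lookup p w))"
  by (rule poly_mapping_eqI)
    (simp add: lookup_sum lookup_single when_def sum.delta in_keys_iff)

lemma star_poly_induct [case_names single add]:
  fixes p :: "'g star_poly"
  assumes "\<And>w c. P (Poly_Mapping.single w c)"
    and "\<And>x y. P x \<Longrightarrow> P y \<Longrightarrow> P (x + y)"
  shows "P p"
proof -
  have z: "P 0" using assms(1)[of 0 0] by simp
  have "finite F \<Longrightarrow> P (\<Sum>w\<in>F. Poly_Mapping.single w (Poly_Mapping.lookup p w))" for F
    by (induction F rule: finite_induct) (auto intro: assms z)
  then show ?thesis using star_poly_sum_single[of p] by (metis finite_keys)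
qed

text \<open>Scaling is multiplication by a constant from the left; as the ring is noncommutative,
  that constants are central has to be checked on words.\<close>

lemma poly_scale_mult_right: "p * poly_scale c q = poly_scale c (p * (q :: 'g star_poly))"
proof (induction p rule: star_poly_induct)
  case (single w d)
  show ?case
    by (induction q rule: star_poly_induct)
      (simp_all add: mult_single poly_scale_add_right distrib_left mult.left_commute)
qed (simp add: poly_scale_add_right distrib_right)

lemma poly_star_single [simp]:
  "poly_star (Poly_Mapping.single w c) = Poly_Mapping.single (word_star w) (cnj c)"
  by (rule poly_mapping_eqI)
    (auto simp: lookup_poly_star lookup_single when_def)

lemma poly_star_zero [simp]: "poly_star 0 = 0"
  by (rule poly_mapping_eqI) (simp add: lookup_poly_star)

lemma poly_star_add [simp]: "poly_star (p + q) = poly_star p + poly_star q"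
  by (rule poly_mapping_eqI) (simp add: lookup_poly_star lookup_add)

lemma poly_star_diff [simp]: "poly_star (p - q) = poly_star p - poly_star q"
  by (rule poly_mapping_eqI) (simp add: lookup_poly_star lookup_minus)

lemma poly_star_uminus [simp]: "poly_star (- p) = - poly_star p"
  by (rule poly_mapping_eqI) (simp add: lookup_poly_star)

lemma poly_star_scale [simp]: "poly_star (poly_scale c p) = poly_scale (cnj c) (poly_star p)"
  by (rule poly_mapping_eqI) (simp add: lookup_poly_star lookup_poly_scale)

lemma poly_star_star [simp]: "poly_star (poly_star p) = p"
  by (rule poly_mapping_eqI) (simp add: lookup_poly_star)

lemma poly_star_sum: "poly_star (sum f A) = (\<Sum>a\<in>A. poly_star (f a))"
  by (induction A rule: infinite_finite_induct) simp_all

lemma word_star_plus: "word_star (u + v) = word_star v + word_star u"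
  by (simp add: word_star_def plus_star_word_def)

lemma word_star_zero [simp]: "word_star 0 = 0"
  by (simp add: word_star_def zero_star_word_def)

lemma poly_star_mult [simp]: "poly_star (p * q) = poly_star q * poly_star (p :: 'g star_poly)"
proof (induction p rule: star_poly_induct)
  case (single w d)
  show ?case
    by (induction q rule: star_poly_induct)
      (simp_all add: mult_single distrib_left distrib_right word_star_plus mult.commute)
qed (simp add: distrib_left distrib_right)

lemma poly_star_one [simp]: "poly_star 1 = (1 :: 'g star_poly)"
  using poly_star_single[of 0 1] by (simp add: single_one)

subsection \<open>Substitution\<close>

definition letter_val :: "('g \<Rightarrow> 'h star_poly) \<Rightarrow> 'g \<times> bool \<Rightarrow> 'h star_poly" where
  "letter_val t l = (if snd l then poly_star (t (fst l)) else t (fst l))"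

definition word_val :: "('g \<Rightarrow> 'h star_poly) \<Rightarrow> 'g star_word \<Rightarrow> 'h star_poly" where
  "word_val t w = prod_list (map (letter_val t) (letters w))"

text \<open>The unital *-homomorphism of free *-algebras that extends \<open>t\<close>; the empty
  word goes to 1.\<close>

definition subst :: "('g \<Rightarrow> 'h star_poly) \<Rightarrow> 'g star_poly \<Rightarrow> 'h star_poly" where
  "subst t p = (\<Sum>w\<in>Poly_Mapping.keys p. poly_scale (Poly_Mapping.lookup p w) (word_val t w))"

lemma word_val_plus: "word_val t (u + v) = word_val t u * word_val t v"
  by (simp add: word_val_def plus_star_word_def)

lemma word_val_zero [simp]: "word_val t 0 = 1"
  by (simp add: word_val_def zero_star_word_def)

lemma poly_star_prod_list: "poly_star (prod_list xs) = prod_list (rev (map poly_star xs))"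
  by (induction xs) simp_all

lemma word_val_star: "word_val t (word_star w) = poly_star (word_val t w)"
  by (simp add: word_val_def word_star_def poly_star_prod_list rev_map[symmetric] comp_def
      case_prod_beta letter_val_def)
    (rule arg_cong[of _ _ prod_list], simp)

lemma subst_superset:
  assumes "finite F" "Poly_Mapping.keys p \<subseteq> F"
  shows "subst t p = (\<Sum>w\<in>F. poly_scale (Poly_Mapping.lookup p w) (word_val t w))"
  unfolding subst_def using assms
  by (intro sum.mono_neutral_left) (auto simp: in_keys_iff)

lemma subst_add [simp]: "subst t (p + q) = subst t p + subst t q"
proof -
  let ?F = "Poly_Mapping.keys p \<union> Poly_Mapping.keys q"
  have "subst t (p + q) = (\<Sum>w\<in>?F. poly_scale (Poly_Mapping.lookup (p + q) w) (word_val t w))"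
    by (rule subst_superset) (use keys_add[of p q] in auto)
  also have "\<dots> = subst t p + subst t q"
    by (simp add: subst_superset[of ?F p] subst_superset[of ?F q] lookup_add
        poly_scale_add_left sum.distrib)
  finally show ?thesis .
qed

lemma subst_single [simp]: "subst t (Poly_Mapping.single w c) = poly_scale c (word_val t w)"
  by (subst subst_superset[of "{w}"]) auto

lemma subst_zero [simp]: "subst t 0 = 0"
  by (simp add: subst_def)

lemma subst_scale [simp]: "subst t (poly_scale c p) = poly_scale c (subst t p)"
  by (induction p rule: star_poly_induct) (simp_all add: poly_scale_add_right)

lemma subst_uminus [simp]: "subst t (- p) = - subst t p"
  using subst_scale[of t "-1" p] by (simp add: poly_scale_minus_one)

lemma subst_diff [simp]: "subst t (p - q) = subst t p - subst t q"
  using subst_add[of t p "- q"] by simp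

lemma subst_sum: "subst t (sum f A) = (\<Sum>a\<in>A. subst t (f a))"
  by (induction A rule: infinite_finite_induct) simp_all

lemma subst_mult [simp]: "subst t (p * q) = subst t p * subst t q"
proof (induction p rule: star_poly_induct)
  case (single w d)
  show ?case
    by (induction q rule: star_poly_induct)
      (simp_all add: mult_single distrib_left word_val_plus poly_scale_mult_left
        poly_scale_mult_right mult.commute)
qed (simp add: distrib_right)

lemma subst_star [simp]: "subst t (poly_star p) = poly_star (subst t p)"
  by (induction p rule: star_poly_induct) (simp_all add: word_val_star)

lemma subst_one [simp]: "subst t 1 = 1"
  using subst_single[of t 0 1] by (simp add: single_one)

lemma subst_gen [simp]: "subst t (poly_gen g) = t g"
  by (simp add: poly_gen_def word_val_def letter_val_def)

lemma word_val_gen: "word_val poly_gen w = Poly_Mapping.single w 1"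
proof -
  have "prod_list (map (letter_val poly_gen) l) = Poly_Mapping.single (Word l) 1" for l :: "('g \<times> bool) list"
  proof (induction l)
    case Nil
    then show ?case by (simp add: zero_star_word_def[symmetric] single_one)
  next
    case (Cons a l)
    have "letter_val poly_gen a = Poly_Mapping.single (Word [a]) 1"
      by (cases a) (simp add: letter_val_def poly_gen_def word_star_def)
    with Cons show ?case by (simp add: mult_single plus_star_word_def)
  qed
  then show ?thesis by (cases w) (simp add: word_val_def)
qed

lemma subst_id [simp]: "subst poly_gen p = p"
  by (induction p rule: star_poly_induct) (simp_all add: word_val_gen)

lemma subst_subst: "subst t (subst s p) = subst (\<lambda>g. subst t (s g)) p"
proof (induction p rule: star_poly_induct)
  case (single w c)
  have "subst t (prod_list (map (letter_val s) l)) = prod_list (map (letter_val (\<lambda>g. subst t (s g))) l)"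
    for l by (induction l) (simp_all add: letter_val_def)
  then show ?case by (simp add: word_val_def)
qed simp

subsection \<open>The free *-algebra on a set of generators\<close>

lemma free_zero [intro, simp]: "0 \<in> free_star_algebra G"
  by (simp add: free_star_algebra_def)

lemma free_add [intro]: "x \<in> free_star_algebra G \<Longrightarrow> y \<in> free_star_algebra G \<Longrightarrow> x + y \<in> free_star_algebra G"
  unfolding free_star_algebra_def using keys_add[of x y] by blast

lemma free_scale [intro]: "x \<in> free_star_algebra G \<Longrightarrow> poly_scale c x \<in> free_star_algebra G"
  unfolding free_star_algebra_def by (auto simp: in_keys_iff lookup_poly_scale)

lemma free_uminus [intro]: "x \<in> free_star_algebra G \<Longrightarrow> - x \<in> free_star_algebra G"
  using free_scale[of x G "-1"] by (simp add: poly_scale_minus_one)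

lemma free_diff [intro]: "x \<in> free_star_algebra G \<Longrightarrow> y \<in> free_star_algebra G \<Longrightarrow> x - y \<in> free_star_algebra G"
  using free_add[of x G "-y"] by auto

lemma free_sum [intro]: "(\<And>a. a \<in> A \<Longrightarrow> f a \<in> free_star_algebra G) \<Longrightarrow> sum f A \<in> free_star_algebra G"
  by (induction A rule: infinite_finite_induct) auto

lemma free_mult [intro]:
  assumes "x \<in> free_star_algebra G" "y \<in> free_star_algebra G"
  shows "x * y \<in> free_star_algebra G"
  unfolding free_star_algebra_def
proof (clarsimp, intro conjI)
  fix w assume "w \<in> Poly_Mapping.keys (x * y)"
  then obtain a b where ab: "w = a + b" "a \<in> Poly_Mapping.keys x" "b \<in> Poly_Mapping.keys y"
    using keys_mult[of x y] by blast
  have "letters a \<noteq> []" "fst ` set (letters a) \<subseteq> G" "letters b \<noteq> []" "fst ` set (letters b) \<subseteq> G"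
    using ab assms unfolding free_star_algebra_def by blast+
  then show "letters w \<noteq> []" "fst ` set (letters w) \<subseteq> G"
    unfolding ab(1) plus_star_word_def by auto
qed

lemma letters_word_star: "fst ` set (letters (word_star w)) = fst ` set (letters w)"
  by (auto simp: word_star_def image_iff Bex_def split: prod.splits)

lemma free_star [intro]: "x \<in> free_star_algebra G \<Longrightarrow> poly_star x \<in> free_star_algebra G"
  unfolding free_star_algebra_def
  apply (clarsimp simp: in_keys_iff lookup_poly_star)
  subgoal for w
    apply (drule bspec[of _ _ "word_star w"])
    apply (simp add: in_keys_iff)
    by (metis letters_word_star list.map_disc_iff rev_is_Nil_conv star_word.sel word_star_def)
  done

lemma free_gen [intro]: "g \<in> G \<Longrightarrow> poly_gen g \<in> free_star_algebra G"
  by (simp add: free_star_algebra_def poly_gen_def)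

lemma word_val_free:
  assumes "\<And>g. g \<in> G \<Longrightarrow> t g \<in> free_star_algebra H" "letters w \<noteq> []" "fst ` set (letters w) \<subseteq> G"
  shows "word_val t w \<in> free_star_algebra H"
proof -
  have "l \<noteq> [] \<Longrightarrow> fst ` set l \<subseteq> G \<Longrightarrow> prod_list (map (letter_val t) l) \<in> free_star_algebra H" for l
  proof (induction l)
    case (Cons a l)
    have "letter_val t a \<in> free_star_algebra H" using Cons assms(1) by (auto simp: letter_val_def)
    then show ?case using Cons by (cases l) auto
  qed simp
  then show ?thesis using assms by (simp add: word_val_def)
qed

lemma subst_free:
  assumes "\<And>g. g \<in> G \<Longrightarrow> t g \<in> free_star_algebra H" "x \<in> free_star_algebra G"
  shows "subst t x \<in> free_star_algebra H"
  unfolding subst_def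
proof (intro free_sum free_scale)
  fix w assume "w \<in> Poly_Mapping.keys x"
  then show "word_val t w \<in> free_star_algebra H"
    using assms(2) by (intro word_val_free[of G, OF assms(1)]) (auto simp: free_star_algebra_def)
qed

lemma word_val_cong: "(\<And>g. g \<in> fst ` set (letters w) \<Longrightarrow> t g = s g) \<Longrightarrow> word_val t w = word_val s w"
  unfolding word_val_def by (intro arg_cong[of _ _ prod_list] map_cong) (auto simp: letter_val_def)

lemma subst_cong:
  assumes "x \<in> free_star_algebra G" "\<And>g. g \<in> G \<Longrightarrow> t g = s g"
  shows "subst t x = subst s x"
  unfolding subst_def using assms
  by (intro sum.cong refl arg_cong[of _ _ "poly_scale _"] word_val_cong)
    (auto simp: free_star_algebra_def)

text \<open>The steps carry membership in the free algebra because the axioms of a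
  \<open>cstar_seminorm\<close> hold only there.\<close>

lemma free_induct [consumes 1, case_names zero gen star add scale mult]:
  assumes "x \<in> free_star_algebra G"
    and "P 0" "\<And>g. g \<in> G \<Longrightarrow> P (poly_gen g)"
    and st: "\<And>x. x \<in> free_star_algebra G \<Longrightarrow> P x \<Longrightarrow> P (poly_star x)"
    and ad: "\<And>x y. x \<in> free_star_algebra G \<Longrightarrow> y \<in> free_star_algebra G \<Longrightarrow> P x \<Longrightarrow> P y \<Longrightarrow> P (x + y)"
    and sc: "\<And>c x. x \<in> free_star_algebra G \<Longrightarrow> P x \<Longrightarrow> P (poly_scale c x)"
    and mu: "\<And>x y. x \<in> free_star_algebra G \<Longrightarrow> y \<in> free_star_algebra G \<Longrightarrow> P x \<Longrightarrow> P y \<Longrightarrow> P (x * y)"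
  shows "P x"
proof -
  have lv: "P (letter_val poly_gen a) \<and> letter_val poly_gen a \<in> free_star_algebra G" if "fst a \<in> G" for a
    using assms(3)[OF that] st[of "poly_gen (fst a)"] that by (auto simp: letter_val_def)
  have "l \<noteq> [] \<Longrightarrow> fst ` set l \<subseteq> G \<Longrightarrow> P (prod_list (map (letter_val poly_gen) l)) \<and>
      prod_list (map (letter_val poly_gen) l) \<in> free_star_algebra G" for l
  proof (induction l)
    case (Cons a l)
    then show ?case using lv[of a] mu by (cases l) auto
  qed simp
  then have w: "P (word_val poly_gen w) \<and> word_val poly_gen w \<in> free_star_algebra G"
    if "w \<in> Poly_Mapping.keys x" for w
    using assms(1) that by (auto simp: word_val_def free_star_algebra_def)
  have "finite F \<Longrightarrow> F \<subseteq> Poly_Mapping.keys x \<Longrightarrow> P (\<Sum>w\<in>F. poly_scale (Poly_Mapping.lookup x w) (word_val poly_gen w))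
     \<and> (\<Sum>w\<in>F. poly_scale (Poly_Mapping.lookup x w) (word_val poly_gen w)) \<in> free_star_algebra G" for F
  proof (induction F rule: finite_induct)
    case empty then show ?case using assms(2) by simp
  next
    case (insert w F)
    then show ?case using w[of w] by (auto intro: ad sc)
  qed
  then have "P (subst poly_gen x)" unfolding subst_def by simp
  then show ?thesis by simp
qed

section \<open>C*-seminorms on *-polynomials\<close>

text \<open>Unlike \<open>cstar_seminorm\<close>, this is a seminorm on the whole unital algebra: no
  membership conditions arise, and elements such as \<open>1 - e\<close> have a seminorm.\<close>

locale cseminorm =
  fixes q :: "'g star_poly \<Rightarrow> real"
  assumes q_add: "q (x + y) \<le> q x + q y"
    and q_scale: "q (poly_scale c x) = cmod c * q x"
    and q_mult: "q (x * y) \<le> q x * q y"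
    and q_cstar: "q (poly_star x * x) = (q x)\<^sup>2"
begin

lemma q_zero [simp]: "q 0 = 0"
  using q_scale[of 0 0] by simp

lemma q_uminus [simp]: "q (- x) = q x"
  using q_scale[of "-1" x] by (simp add: poly_scale_minus_one)

lemma q_nonneg [simp]: "0 \<le> q x"
  using q_add[of x "-x"] by simp

lemma q_diff_commute: "q (x - y) = q (y - x)"
  using q_uminus[of "x - y"] by simp

lemma q_diff_triangle: "q (x - z) \<le> q (x - y) + q (y - z)"
  using q_add[of "x - y" "y - z"] by simp

lemma q_diff: "q (x - y) \<le> q x + q y"
  using q_add[of x "- y"] by simp

lemma q_le_diff: "q x \<le> q (x - y) + q y"
  using q_add[of "x - y" y] by simp

lemma q_star_le: "q x \<le> q (poly_star x)"
proof (cases "q x = 0")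
  case False
  have "q x * q x \<le> q (poly_star x) * q x"
    using q_mult[of "poly_star x" x] q_cstar[of x] by (simp add: power2_eq_square)
  then show ?thesis using False q_nonneg[of x] by (simp add: less_eq_real_def)
qed simp

lemma q_star [simp]: "q (poly_star x) = q x"
  using q_star_le[of x] q_star_le[of "poly_star x"] by simp

lemma q_sum: "q (sum f A) \<le> (\<Sum>a\<in>A. q (f a))"
  by (induction A rule: infinite_finite_induct) (auto intro: order_trans[OF q_add])

lemma q_mult_le1: "q x \<le> 1 \<Longrightarrow> q y \<le> 1 \<Longrightarrow> q (x * y) \<le> 1"
  using q_mult[of x y] mult_le_one[of "q x" "q y"] by simp

text \<open>Calculating modulo this relation stands for calculating in the C*-algebra that
  \<open>q\<close> defines.\<close>

definition eqv :: "'g star_poly \<Rightarrow> 'g star_poly \<Rightarrow> bool" (infix \<open>\<doteq>\<close> 50) where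
  "x \<doteq> y \<longleftrightarrow> q (x - y) = 0"

lemma eqv_refl [intro, simp]: "x \<doteq> x"
  by (simp add: eqv_def)

lemma eqv_sym: "x \<doteq> y \<Longrightarrow> y \<doteq> x"
  by (simp add: eqv_def q_diff_commute)

lemma eqv_trans [trans]: "x \<doteq> y \<Longrightarrow> y \<doteq> z \<Longrightarrow> x \<doteq> z"
  unfolding eqv_def using q_diff_triangle[of x z y] q_nonneg[of "x - z"] by simp

lemma eqv_q: "x \<doteq> y \<Longrightarrow> q x = q y"
  unfolding eqv_def using q_le_diff[of x y] q_le_diff[of y x] by (simp add: q_diff_commute)

lemma eqv_add: "x \<doteq> x' \<Longrightarrow> y \<doteq> y' \<Longrightarrow> x + y \<doteq> x' + y'"
  unfolding eqv_def using q_add[of "x - x'" "y - y'"] q_nonneg[of "x + y - (x' + y')"]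
  by (simp add: algebra_simps)

lemma eqv_uminus: "x \<doteq> x' \<Longrightarrow> - x \<doteq> - x'"
  unfolding eqv_def using q_diff_commute[of x x'] by (simp add: algebra_simps)

lemma eqv_diff: "x \<doteq> x' \<Longrightarrow> y \<doteq> y' \<Longrightarrow> x - y \<doteq> x' - y'"
  using eqv_add[of x x' "-y" "-y'"] eqv_uminus[of y y'] by simp

lemma eqv_scale: "x \<doteq> x' \<Longrightarrow> poly_scale c x \<doteq> poly_scale c x'"
  unfolding eqv_def by (simp add: poly_scale_diff_right[symmetric] q_scale)

lemma eqv_star: "x \<doteq> x' \<Longrightarrow> poly_star x \<doteq> poly_star x'"
  unfolding eqv_def using q_star[of "x - x'"] by simp

lemma eqv_mult_left: "x \<doteq> x' \<Longrightarrow> x * y \<doteq> x' * y"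
  unfolding eqv_def using q_mult[of "x - x'" y] q_nonneg[of "x * y - x' * y"]
  by (simp add: algebra_simps)

lemma eqv_mult_right: "y \<doteq> y' \<Longrightarrow> x * y \<doteq> x * y'"
  unfolding eqv_def using q_mult[of x "y - y'"] q_nonneg[of "x * y - x * y'"]
  by (simp add: algebra_simps)

lemma eqv_mult: "x \<doteq> x' \<Longrightarrow> y \<doteq> y' \<Longrightarrow> x * y \<doteq> x' * y'"
  using eqv_trans eqv_mult_left eqv_mult_right by blast

lemma eqv_sum: "(\<And>a. a \<in> A \<Longrightarrow> f a \<doteq> g a) \<Longrightarrow> sum f A \<doteq> sum g A"
  by (induction A rule: infinite_finite_induct) (auto intro: eqv_add)

lemma eqv_sum_zero: "(\<And>a. a \<in> A \<Longrightarrow> f a \<doteq> 0) \<Longrightarrow> sum f A \<doteq> 0"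
  using eqv_sum[of A f "\<lambda>_. 0"] by simp

lemma eqv_zero_iff: "x \<doteq> 0 \<longleftrightarrow> q x = 0"
  by (simp add: eqv_def)

lemma eqv_diff_iff: "x - y \<doteq> 0 \<longleftrightarrow> x \<doteq> y"
  by (simp add: eqv_def)

lemma eqv_mult_zero: "x \<doteq> 0 \<Longrightarrow> x * y \<doteq> 0" "y \<doteq> 0 \<Longrightarrow> x * y \<doteq> 0"
  using eqv_mult_left[of x 0 y] eqv_mult_right[of y 0 x] by simp_all

lemma cseminorm_subst: "cseminorm (\<lambda>x. q (subst t x))"
  by standard (simp_all add: q_add q_scale q_mult q_cstar)

lemma cstar_seminorm_restrict: "cstar_seminorm G q"
  by (simp add: cstar_seminorm_def q_add q_scale q_mult q_cstar)

end

subsection \<open>Extension of C*-seminorms to the unital algebra\<close>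

text \<open>The left regular representation on the unit ball, with generators outside \<open>G\<close> sent to 0,
  extends a C*-seminorm to all *-polynomials.\<close>

definition kill :: "'g set \<Rightarrow> 'g star_poly \<Rightarrow> 'g star_poly" where
  "kill G = subst (\<lambda>g. if g \<in> G then poly_gen g else 0)"

definition total_seminorm :: "'g set \<Rightarrow> ('g star_poly \<Rightarrow> real) \<Rightarrow> 'g star_poly \<Rightarrow> real" where
  "total_seminorm G q x = (SUP y\<in>{y \<in> free_star_algebra G. q y \<le> 1}. q (kill G x * y))"

lemma kill_free: "x \<in> free_star_algebra G \<Longrightarrow> kill G x = x"
  unfolding kill_def by (subst subst_cong[of x G _ poly_gen]) auto

text \<open>This is why left multiplication by \<open>kill G x\<close> maps the non-unital free
  algebra to itself and is bounded there, although \<open>x\<close> may contain the empty word and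
  foreign generators.\<close>

lemma kill_unital: "\<exists>c. \<exists>x0\<in>free_star_algebra G. kill G x = poly_scale c 1 + x0"
proof (induction x rule: star_poly_induct)
  case (single w c)
  show ?case
  proof (cases "letters w = []")
    case True
    then have "kill G (Poly_Mapping.single w c) = poly_scale c 1 + 0"
      by (simp add: kill_def word_val_def)
    then show ?thesis by blast
  next
    case False
    have "word_val (\<lambda>g. if g \<in> G then poly_gen g else 0) w \<in> free_star_algebra G"
      by (rule word_val_free[of UNIV]) (use False in auto)
    then have "kill G (Poly_Mapping.single w c) \<in> free_star_algebra G"
      by (simp add: kill_def free_scale)
    then show ?thesis by (intro exI[of _ 0]) auto
  qed
next
  case (add x y)
  then obtain c x0 d y0 where "x0 \<in> free_star_algebra G" "kill G x = poly_scale c 1 + x0"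
    "y0 \<in> free_star_algebra G" "kill G y = poly_scale d 1 + y0" by blast
  then have "kill G (x + y) = poly_scale (c + d) 1 + (x0 + y0)" "x0 + y0 \<in> free_star_algebra G"
    by (auto simp: kill_def poly_scale_add_left)
  then show ?case by blast
qed

context
  fixes G :: "'g set" and q :: "'g star_poly \<Rightarrow> real"
  assumes sn: "cstar_seminorm G q"
begin

private abbreviation "F \<equiv> free_star_algebra G"

lemma sn_add: "x \<in> F \<Longrightarrow> y \<in> F \<Longrightarrow> q (x + y) \<le> q x + q y"
  and sn_scale: "x \<in> F \<Longrightarrow> q (poly_scale c x) = cmod c * q x"
  and sn_mult: "x \<in> F \<Longrightarrow> y \<in> F \<Longrightarrow> q (x * y) \<le> q x * q y"
  and sn_cstar: "x \<in> F \<Longrightarrow> q (poly_star x * x) = (q x)\<^sup>2"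
  using sn by (simp_all add: cstar_seminorm_def)

lemma sn_zero: "q 0 = 0"
  using sn_scale[of 0 0] by simp

lemma sn_uminus: "x \<in> F \<Longrightarrow> q (- x) = q x"
  using sn_scale[of x "-1"] by (simp add: poly_scale_minus_one)

lemma sn_nonneg: "x \<in> F \<Longrightarrow> 0 \<le> q x"
  using sn_add[of x "-x"] by (simp add: sn_uminus sn_zero free_uminus)

lemma sn_star_le: "x \<in> F \<Longrightarrow> q x \<le> q (poly_star x)"
proof (cases "q x = 0")
  case False
  assume x: "x \<in> F"
  have "q x * q x \<le> q (poly_star x) * q x"
    using sn_mult[of "poly_star x" x] sn_cstar[of x] x by (simp add: power2_eq_square free_star)
  then show ?thesis using False sn_nonneg[OF x] by (simp add: less_eq_real_def)
qed (simp add: sn_nonneg free_star)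

lemma sn_star: "x \<in> F \<Longrightarrow> q (poly_star x) = q x"
  using sn_star_le[of x] sn_star_le[of "poly_star x"] by (simp add: free_star)

lemma kill_mult_free: assumes y: "y \<in> F" shows "kill G x * y \<in> F"
proof -
  obtain c x0 where x: "x0 \<in> F" "kill G x = poly_scale c 1 + x0" using kill_unital by blast
  have "poly_scale c y + x0 * y \<in> F" by (intro free_add free_scale free_mult x y)
  then show ?thesis by (simp add: x(2) distrib_right poly_scale_mult_left)
qed

lemma total_bound: "\<exists>C\<ge>0. \<forall>y\<in>F. q (kill G x * y) \<le> C * q y"
proof -
  obtain c x0 where x: "x0 \<in> F" "kill G x = poly_scale c 1 + x0" using kill_unital by blast
  have "q (kill G x * y) \<le> (cmod c + q x0) * q y" if y: "y \<in> F" for y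
  proof -
    have "q (kill G x * y) = q (poly_scale c y + x0 * y)"
      by (simp add: x distrib_right poly_scale_mult_left)
    also have "\<dots> \<le> q (poly_scale c y) + q (x0 * y)" using x y by (intro sn_add) auto
    also have "\<dots> \<le> cmod c * q y + q x0 * q y" using x y by (intro add_mono) (auto simp: sn_scale sn_mult)
    finally show ?thesis by (simp add: distrib_right)
  qed
  moreover have "0 \<le> cmod c + q x0" using sn_nonneg x by auto
  ultimately show ?thesis by blast
qed

lemma total_bdd: "bdd_above ((\<lambda>y. q (kill G x * y)) ` {y \<in> F. q y \<le> 1})"
proof -
  obtain C where C: "C \<ge> 0" "\<And>y. y \<in> F \<Longrightarrow> q (kill G x * y) \<le> C * q y" using total_bound by blast
  have "q (kill G x * y) \<le> C" if "y \<in> F" "q y \<le> 1" for y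
    using C(2)[OF that(1)] mult_left_mono[OF that(2) C(1)] by simp
  then show ?thesis by (auto intro!: bdd_aboveI2)
qed

lemma total_upper1: "y \<in> F \<Longrightarrow> q y \<le> 1 \<Longrightarrow> q (kill G x * y) \<le> total_seminorm G q x"
  unfolding total_seminorm_def by (rule cSUP_upper[OF _ total_bdd]) auto

lemma total_least:
  assumes "\<And>y. y \<in> F \<Longrightarrow> q y \<le> 1 \<Longrightarrow> q (kill G x * y) \<le> C"
  shows "total_seminorm G q x \<le> C"
  unfolding total_seminorm_def
proof (rule cSUP_least)
  show "{y \<in> F. q y \<le> 1} \<noteq> {}" using sn_zero by (auto intro!: exI[of _ 0])
qed (use assms in auto)

lemma total_nonneg: "0 \<le> total_seminorm G q x"
  using total_upper1[of 0 x] by (simp add: sn_zero)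

lemma total_upper: assumes y: "y \<in> F" shows "q (kill G x * y) \<le> total_seminorm G q x * q y"
proof (cases "q y = 0")
  case True
  \<comment> \<open>An element of seminorm 0 cannot be scaled to norm 1; the crude bound shows that
    its product has seminorm 0 as well.\<close>
  obtain C where "q (kill G x * y) \<le> C * q y" using total_bound y by blast
  then show ?thesis using True by simp
next
  case False
  then have p: "q y > 0" using sn_nonneg[OF y] by simp
  let ?y = "poly_scale (of_real (inverse (q y))) y"
  have "q ?y = 1" using p y by (simp add: sn_scale norm_inverse)
  then have "q (kill G x * ?y) \<le> total_seminorm G q x"
    using total_upper1[of ?y x] y by (auto simp: free_scale)
  moreover have "q (kill G x * ?y) = inverse (q y) * q (kill G x * y)"
    using p by (simp add: poly_scale_mult_right sn_scale kill_mult_free y norm_inverse)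
  ultimately have "inverse (q y) * q (kill G x * y) \<le> total_seminorm G q x" by simp
  then show ?thesis using p by (simp add: field_simps)
qed

lemma total_add: "total_seminorm G q (x + y) \<le> total_seminorm G q x + total_seminorm G q y"
proof (rule total_least)
  fix z assume z: "z \<in> F" "q z \<le> 1"
  have "q (kill G (x + y) * z) \<le> q (kill G x * z) + q (kill G y * z)"
    using sn_add[OF kill_mult_free kill_mult_free, OF z(1) z(1)] by (simp add: kill_def distrib_right)
  also have "\<dots> \<le> total_seminorm G q x + total_seminorm G q y"
    by (intro add_mono total_upper1 z)
  finally show "q (kill G (x + y) * z) \<le> total_seminorm G q x + total_seminorm G q y" .
qed

lemma total_mult: "total_seminorm G q (x * y) \<le> total_seminorm G q x * total_seminorm G q y"
proof (rule total_least)
  fix z assume z: "z \<in> F" "q z \<le> 1"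
  have "q (kill G (x * y) * z) = q (kill G x * (kill G y * z))" by (simp add: kill_def mult.assoc)
  also have "\<dots> \<le> total_seminorm G q x * q (kill G y * z)"
    by (rule total_upper[OF kill_mult_free[OF z(1)]])
  also have "\<dots> \<le> total_seminorm G q x * total_seminorm G q y"
    by (intro mult_left_mono total_upper1 z total_nonneg)
  finally show "q (kill G (x * y) * z) \<le> total_seminorm G q x * total_seminorm G q y" .
qed

lemma total_scale_le: "total_seminorm G q (poly_scale c x) \<le> cmod c * total_seminorm G q x"
proof (rule total_least)
  fix z assume z: "z \<in> F" "q z \<le> 1"
  have "q (kill G (poly_scale c x) * z) = cmod c * q (kill G x * z)"
    by (simp add: kill_def[of G] poly_scale_mult_left) (simp add: kill_def[symmetric] sn_scale kill_mult_free z)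
  then show "q (kill G (poly_scale c x) * z) \<le> cmod c * total_seminorm G q x"
    by (simp add: mult_left_mono total_upper1 z)
qed

lemma total_scale: "total_seminorm G q (poly_scale c x) = cmod c * total_seminorm G q x"
proof (cases "c = 0")
  case True
  then show ?thesis using total_scale_le[of 0 x] total_nonneg[of 0] by simp
next
  case False
  have "total_seminorm G q x \<le> inverse (cmod c) * total_seminorm G q (poly_scale c x)"
    using total_scale_le[of "inverse c" "poly_scale c x"] False by (simp add: norm_inverse)
  then show ?thesis using total_scale_le[of c x] False by (simp add: field_simps)
qed

text \<open>For \<open>z\<close> in the unit ball, the square of the norm of \<open>x z\<close> is
  the norm of the product of the adjoint of \<open>z\<close> with
  \<open>poly_star x * x * z\<close>. The other half of the C*-identity follows from
  submultiplicativity and invariance under the adjoint.\<close>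

lemma total_cstar_ge: "(total_seminorm G q x)\<^sup>2 \<le> total_seminorm G q (poly_star x * x)"
proof -
  have "total_seminorm G q x \<le> sqrt (total_seminorm G q (poly_star x * x))"
  proof (rule total_least)
    fix z assume z: "z \<in> F" "q z \<le> 1"
    have "(q (kill G x * z))\<^sup>2 = q (poly_star z * (kill G (poly_star x * x) * z))"
      by (subst sn_cstar[symmetric, OF kill_mult_free[OF z(1)]]) (simp add: kill_def mult.assoc)
    also have "\<dots> \<le> q (poly_star z) * q (kill G (poly_star x * x) * z)"
      by (intro sn_mult free_star z kill_mult_free)
    also have "\<dots> \<le> 1 * total_seminorm G q (poly_star x * x)"
      by (intro mult_mono total_upper1 z sn_nonneg kill_mult_free) (auto simp: sn_star z)
    finally show "q (kill G x * z) \<le> sqrt (total_seminorm G q (poly_star x * x))"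
      by (simp add: real_le_rsqrt)
  qed
  then have "(total_seminorm G q x)\<^sup>2 \<le> (sqrt (total_seminorm G q (poly_star x * x)))\<^sup>2"
    by (intro power_mono total_nonneg)
  then show ?thesis by (simp add: total_nonneg)
qed

lemma total_star_le: "total_seminorm G q x \<le> total_seminorm G q (poly_star x)"
proof (cases "total_seminorm G q x = 0")
  case False
  have "total_seminorm G q x * total_seminorm G q x \<le> total_seminorm G q (poly_star x) * total_seminorm G q x"
    using total_mult[of "poly_star x" x] total_cstar_ge[of x] by (simp add: power2_eq_square)
  then show ?thesis using False total_nonneg[of x] by (simp add: less_eq_real_def)
qed (simp add: total_nonneg)

lemma cseminorm_total: "cseminorm (total_seminorm G q)"
proof (standard, goal_cases)
  case (4 x)
  have "total_seminorm G q (poly_star x) \<le> total_seminorm G q x"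
    using total_star_le[of "poly_star x"] by simp
  then have "total_seminorm G q (poly_star x * x) \<le> (total_seminorm G q x)\<^sup>2"
    using total_mult[of "poly_star x" x] mult_right_mono[OF _ total_nonneg[of x]]
    by (fastforce simp: power2_eq_square)
  then show ?case using total_cstar_ge[of x] by simp
qed (simp_all add: total_add total_scale total_mult)

lemma total_eq: assumes x: "x \<in> F" shows "total_seminorm G q x = q x"
proof (rule antisym)
  show "total_seminorm G q x \<le> q x"
  proof (rule total_least)
    fix y assume y: "y \<in> F" "q y \<le> 1"
    have "q (kill G x * y) \<le> q x * q y" using x y by (simp add: kill_free sn_mult)
    also have "\<dots> \<le> q x" using y sn_nonneg[OF x] by (simp add: mult_left_le)
    finally show "q (kill G x * y) \<le> q x" .
  qed
  \<comment> \<open>The ball has no unit to test on; testing on the adjoint of \<open>x\<close>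
    gives \<open>q x\<close> squared by the C*-identity.\<close>
  show "q x \<le> total_seminorm G q x"
  proof (cases "q x = 0")
    case False
    have "q x * q x \<le> total_seminorm G q x * q x"
      using total_upper[OF free_star[OF x], of x] sn_cstar[of "poly_star x"] x
      by (simp add: kill_free sn_star free_star power2_eq_square)
    then show ?thesis using False sn_nonneg[OF x] by (simp add: less_eq_real_def)
  qed (simp add: total_nonneg)
qed

end

section \<open>The universal C*-seminorm\<close>

text \<open>The bound on the generators makes the supremum in \<open>univ_norm\<close> finite, so
  that it is a true least upper bound and not an unspecified value.\<close>

locale bounded_presentation =
  fixes G :: "'g set" and R :: "'g star_poly set"
  assumes R_free: "R \<subseteq> free_star_algebra G"
    and gen_bound: "\<And>q g. cstar_seminorm G q \<Longrightarrow> \<forall>r\<in>R. q r = 0 \<Longrightarrow> g \<in> G \<Longrightarrow> q (poly_gen g) \<le> 1"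
begin

abbreviation "F \<equiv> free_star_algebra G"

abbreviation "admissible \<equiv> {q. cstar_seminorm G q \<and> (\<forall>r\<in>R. q r = 0)}"

lemma admissible_bound: assumes "x \<in> F" shows "\<exists>B. \<forall>q\<in>admissible. q x \<le> B"
  using assms
proof (induction rule: free_induct)
  case zero
  then show ?case by (intro exI[of _ 0]) (auto simp: sn_zero)
next
  case (gen g)
  then show ?case using gen_bound by (intro exI[of _ 1]) auto
next
  case (star x)
  then show ?case using sn_star[OF _ star(1)] by (metis (no_types, lifting) mem_Collect_eq)
next
  case (add x y)
  then obtain B C where "\<forall>q\<in>admissible. q x \<le> B" "\<forall>q\<in>admissible. q y \<le> C" by blast
  then have "\<forall>q\<in>admissible. q (x + y) \<le> B + C"
    by (blast intro: order_trans[OF sn_add[OF _ add(1,2)] add_mono])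
  then show ?case by blast
next
  case (scale c x)
  then obtain B where "\<forall>q\<in>admissible. q x \<le> B" by blast
  then have "\<forall>q\<in>admissible. q (poly_scale c x) \<le> cmod c * B"
    by (auto simp: sn_scale[OF _ scale(1)] mult_left_mono)
  then show ?case by blast
next
  case (mult x y)
  then obtain B C where BC: "\<forall>q\<in>admissible. q x \<le> B" "\<forall>q\<in>admissible. q y \<le> C" by blast
  have "q (x * y) \<le> B * C" if q: "q \<in> admissible" for q
  proof -
    have sn: "cstar_seminorm G q" and le: "q x \<le> B" "q y \<le> C" using q BC by blast+
    note pos = sn_nonneg[OF sn mult(1)] sn_nonneg[OF sn mult(2)]
    have "q (x * y) \<le> q x * q y" by (rule sn_mult[OF sn mult(1,2)])
    also have "\<dots> \<le> B * C"
      using le pos by (intro mult_mono) auto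
    finally show ?thesis .
  qed
  then show ?case by blast
qed

lemma univ_bdd: "x \<in> F \<Longrightarrow> bdd_above ((\<lambda>q. q x) ` admissible)"
  using admissible_bound[of x] by (auto intro: bdd_aboveI2)

lemma zero_admissible: "(\<lambda>_. 0) \<in> admissible"
  by (simp add: cstar_seminorm_def)

lemma admissible_le_univ: "cstar_seminorm G q \<Longrightarrow> \<forall>r\<in>R. q r = 0 \<Longrightarrow> x \<in> F \<Longrightarrow> q x \<le> univ_norm G R x"
  unfolding univ_norm_def by (rule cSUP_upper[OF _ univ_bdd]) auto

lemma univ_norm_least: "(\<And>q. cstar_seminorm G q \<Longrightarrow> \<forall>r\<in>R. q r = 0 \<Longrightarrow> q x \<le> C) \<Longrightarrow> univ_norm G R x \<le> C"
  unfolding univ_norm_def using zero_admissible by (intro cSUP_least) auto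

lemma univ_norm_nonneg: "x \<in> F \<Longrightarrow> 0 \<le> univ_norm G R x"
  using admissible_le_univ[of "\<lambda>_. 0" x] zero_admissible by simp

lemma cstar_seminorm_univ: "cstar_seminorm G (univ_norm G R)"
  unfolding cstar_seminorm_def
proof (intro conjI ballI allI)
  fix x y assume xy: "x \<in> F" "y \<in> F"
  show "univ_norm G R (x + y) \<le> univ_norm G R x + univ_norm G R y"
  proof (rule univ_norm_least)
    fix q assume q: "cstar_seminorm G q" "\<forall>r\<in>R. q r = 0"
    show "q (x + y) \<le> univ_norm G R x + univ_norm G R y"
      by (rule order_trans[OF sn_add[OF q(1) xy] add_mono[OF admissible_le_univ[OF q xy(1)] admissible_le_univ[OF q xy(2)]]])
  qed
  show "univ_norm G R (x * y) \<le> univ_norm G R x * univ_norm G R y"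
  proof (rule univ_norm_least)
    fix q assume q: "cstar_seminorm G q" "\<forall>r\<in>R. q r = 0"
    show "q (x * y) \<le> univ_norm G R x * univ_norm G R y"
      by (rule order_trans[OF sn_mult[OF q(1) xy] mult_mono[OF admissible_le_univ[OF q xy(1)]
        admissible_le_univ[OF q xy(2)] univ_norm_nonneg[OF xy(1)] sn_nonneg[OF q(1) xy(2)]]])
  qed
next
  fix c x assume x: "x \<in> F"
  have le: "univ_norm G R (poly_scale c x) \<le> cmod c * univ_norm G R x" if "x \<in> F" for c x
  proof (rule univ_norm_least)
    fix q assume q: "cstar_seminorm G q" "\<forall>r\<in>R. q r = 0"
    show "q (poly_scale c x) \<le> cmod c * univ_norm G R x"
      unfolding sn_scale[OF q(1) that] by (rule mult_left_mono[OF admissible_le_univ[OF q that] norm_ge_zero])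
  qed
  show "univ_norm G R (poly_scale c x) = cmod c * univ_norm G R x"
  proof (cases "c = 0")
    case True
    then show ?thesis using le[OF x, of 0] univ_norm_nonneg[OF free_zero] by simp
  next
    case False
    have "univ_norm G R x \<le> inverse (cmod c) * univ_norm G R (poly_scale c x)"
      using le[of "poly_scale c x" "inverse c"] x False by (simp add: norm_inverse free_scale)
    then show ?thesis using le[of x c] x False by (simp add: field_simps)
  qed
next
  fix x assume x: "x \<in> F"
  have sx: "poly_star x * x \<in> F" using x by auto
  show "univ_norm G R (poly_star x * x) = (univ_norm G R x)\<^sup>2"
  proof (rule antisym)
    show "univ_norm G R (poly_star x * x) \<le> (univ_norm G R x)\<^sup>2"
    proof (rule univ_norm_least)
      fix q assume q: "cstar_seminorm G q" "\<forall>r\<in>R. q r = 0"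
      show "q (poly_star x * x) \<le> (univ_norm G R x)\<^sup>2"
        unfolding sn_cstar[OF q(1) x]
        by (rule power_mono[OF admissible_le_univ[OF q x] sn_nonneg[OF q(1) x]])
    qed
    have "univ_norm G R x \<le> sqrt (univ_norm G R (poly_star x * x))"
    proof (rule univ_norm_least)
      fix q assume q: "cstar_seminorm G q" "\<forall>r\<in>R. q r = 0"
      have "(q x)\<^sup>2 \<le> univ_norm G R (poly_star x * x)"
        using admissible_le_univ[OF q sx] sn_cstar[OF q(1) x] by simp
      then show "q x \<le> sqrt (univ_norm G R (poly_star x * x))" by (rule real_le_rsqrt)
    qed
    then have "(univ_norm G R x)\<^sup>2 \<le> (sqrt (univ_norm G R (poly_star x * x)))\<^sup>2"
      by (intro power_mono univ_norm_nonneg x)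
    then show "(univ_norm G R x)\<^sup>2 \<le> univ_norm G R (poly_star x * x)"
      by (simp add: univ_norm_nonneg sx)
  qed
qed

text \<open>The universal norm, extended to the unital algebra. The two agree on \<open>F\<close>,
  and from here on all estimates are made with \<open>uq\<close>, for which no membership conditions
  arise.\<close>

definition uq :: "'g star_poly \<Rightarrow> real" where
  "uq = total_seminorm G (univ_norm G R)"

sublocale cseminorm uq
  unfolding uq_def by (rule cseminorm_total[OF cstar_seminorm_univ])

lemma univ_norm_eq_uq: "x \<in> F \<Longrightarrow> univ_norm G R x = uq x"
  by (simp add: uq_def total_eq[OF cstar_seminorm_univ])

lemma uq_rel: "r \<in> R \<Longrightarrow> uq r = 0"
proof -
  assume r: "r \<in> R"
  then have "r \<in> F" using R_free by blast
  moreover have "univ_norm G R r \<le> 0" by (rule univ_norm_least) (simp add: r)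
  ultimately show "uq r = 0" using univ_norm_nonneg[of r] univ_norm_eq_uq[of r] by (metis antisym)
qed

text \<open>The universal property in the form in which it is used: every upper bound by a universal
  norm comes from a seminorm that kills the relations.\<close>

lemma uq_max:
  assumes "cseminorm p" "\<And>r. r \<in> R \<Longrightarrow> p r = 0" "x \<in> F"
  shows "p x \<le> uq x"
proof -
  have "p x \<le> univ_norm G R x"
    by (rule admissible_le_univ[OF cseminorm.cstar_seminorm_restrict[OF assms(1)] _ assms(3)])
      (simp add: assms(2))
  then show ?thesis by (simp only: univ_norm_eq_uq[OF assms(3)])
qed

lemma subst_uq_le:
  assumes "cseminorm p" "\<And>r. r \<in> R \<Longrightarrow> p (subst t r) = 0" "x \<in> F"
  shows "p (subst t x) \<le> uq x"
  by (rule uq_max[OF cseminorm.cseminorm_subst[OF assms(1), of t] assms(2,3)])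

end

section \<open>Elementary facts on C*-algebras\<close>

context cstar_algebra
begin

lemma sub_closed: "x \<in> car A \<Longrightarrow> y \<in> car A \<Longrightarrow> csub A x y \<in> car A"
  by (simp add: csub_def add_closed scale_closed)

lemma sub_add_cancel: "x \<in> car A \<Longrightarrow> y \<in> car A \<Longrightarrow> cadd A (csub A x y) y = x"
proof -
  assume x: "x \<in> car A" and y: "y \<in> car A"
  have "cadd A (csub A x y) y = cadd A x (csub A y y)"
    using x y by (simp add: csub_def add_assoc scale_closed add_commute[of "cscale A (-1) y" y])
  then show ?thesis using x y by (simp add: sub_self zero_closed add_commute[of x] add_zero)
qed

lemma sub_triangle_eq:
  assumes "x \<in> car A" "y \<in> car A" "z \<in> car A"
  shows "csub A x z = cadd A (csub A x y) (csub A y z)"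
proof -
  have "cadd A (csub A x y) (csub A y z) = cadd A (cadd A (csub A x y) y) (cscale A (-1) z)"
    using assms by (simp add: csub_def[of A y z] add_assoc sub_closed scale_closed)
  then show ?thesis using assms by (simp add: sub_add_cancel) (simp add: csub_def)
qed

lemma norm_sub_triangle:
  assumes "x \<in> car A" "y \<in> car A" "z \<in> car A"
  shows "cnorm A (csub A x z) \<le> cnorm A (csub A x y) + cnorm A (csub A y z)"
  unfolding sub_triangle_eq[OF assms] by (intro norm_triangle sub_closed assms)

lemma eq_if_norm_sub_zero:
  assumes "x \<in> car A" "y \<in> car A" "cnorm A (csub A x y) = 0"
  shows "x = y"
  using assms sub_add_cancel[of x y] add_zero[of y] by (simp add: norm_eq_zero sub_closed)

lemma norm_sub_commute:
  assumes "x \<in> car A" "y \<in> car A"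
  shows "cnorm A (csub A x y) = cnorm A (csub A y x)"
proof -
  have "cscale A (-1) (csub A y x) = csub A x y"
    using assms by (simp add: csub_def scale_add_right scale_closed scale_scale scale_one add_commute)
  then show ?thesis using norm_scale[of "csub A y x" "-1"] assms by (simp add: sub_closed)
qed

lemma norm_zero: "cnorm A (czero A) = 0"
  by (simp add: norm_eq_zero zero_closed)

end

lemma star_homD:
  assumes "star_hom A B \<phi>"
  shows "x \<in> car A \<Longrightarrow> \<phi> x \<in> car B"
    and "x \<in> car A \<Longrightarrow> y \<in> car A \<Longrightarrow> \<phi> (cadd A x y) = cadd B (\<phi> x) (\<phi> y)"
    and "x \<in> car A \<Longrightarrow> \<phi> (cscale A c x) = cscale B c (\<phi> x)"
    and "x \<in> car A \<Longrightarrow> y \<in> car A \<Longrightarrow> \<phi> (cmul A x y) = cmul B (\<phi> x) (\<phi> y)"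
    and "x \<in> car A \<Longrightarrow> \<phi> (cstar A x) = cstar B (\<phi> x)"
  using assms by (simp_all add: star_hom_def)

lemma star_hom_sub:
  assumes "star_hom A B \<phi>" "cstar_algebra A" "x \<in> car A" "y \<in> car A"
  shows "\<phi> (csub A x y) = csub B (\<phi> x) (\<phi> y)"
  using assms by (simp add: csub_def star_homD[OF assms(1)] cstar_algebra.scale_closed)

lemma star_hom_zero:
  assumes "star_hom A B \<phi>" "cstar_algebra A" "cstar_algebra B"
  shows "\<phi> (czero A) = czero B"
  using cstar_algebra.sub_self[OF assms(2), of "czero A"] cstar_algebra.zero_closed[OF assms(2)]
    cstar_algebra.sub_self[OF assms(3), of "\<phi> (czero A)"] star_hom_sub[OF assms(1,2), of "czero A" "czero A"]
    star_homD(1)[OF assms(1), of "czero A"] by simp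

text \<open>The algebraic axioms are inherited. Only completeness needs an argument: contractive
  maps are continuous, so a limit of fixed elements is fixed.\<close>

lemma cstar_algebra_fixed:
  assumes A: "cstar_algebra A"
    and h: "\<And>z. z \<in> Z \<Longrightarrow> star_hom A A (\<phi> z)"
    and c: "\<And>z x. z \<in> Z \<Longrightarrow> x \<in> car A \<Longrightarrow> cnorm A (\<phi> z x) \<le> cnorm A x"
  shows "cstar_algebra (A\<lparr>car := {x \<in> car A. \<forall>z\<in>Z. \<phi> z x = x}\<rparr>)"
proof -
  interpret cstar_algebra A by fact
  let ?B = "A\<lparr>car := {x \<in> car A. \<forall>z\<in>Z. \<phi> z x = x}\<rparr>"
  have sub: "csub ?B = csub A" by (intro ext) (simp add: csub_def)
  show ?thesis
  proof (standard, goal_cases)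
    case 1
    then show ?case using star_hom_zero[OF h A A] zero_closed by auto
  next
    \<comment> \<open>The goals are numbered in the order of the axioms of
      \<open>cstar_algebra\<close>; this one is completeness.\<close>
    case (29 X)
    have X: "\<And>n. X n \<in> car A" "\<And>n z. z \<in> Z \<Longrightarrow> \<phi> z (X n) = X n" using 29(1) by auto
    obtain x where x: "x \<in> car A" "(\<lambda>n. cnorm A (csub A (X n) x)) \<longlonglongrightarrow> 0"
      using complete[of X] 29(2) X(1) by (auto simp: sub)
    have "\<phi> z x = x" if z: "z \<in> Z" for z
    proof (rule eq_if_norm_sub_zero)
      show px: "\<phi> z x \<in> car A" using star_homD(1)[OF h[OF z] x(1)] .
      have le: "cnorm A (csub A (\<phi> z x) x) \<le> 2 * cnorm A (csub A (X n) x)" for n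
      proof -
        have "cnorm A (csub A (\<phi> z x) (X n)) = cnorm A (\<phi> z (csub A x (X n)))"
          using star_hom_sub[OF h[OF z] A x(1) X(1)[of n]] X(2)[OF z] by simp
        also have "\<dots> \<le> cnorm A (csub A (X n) x)"
          using c[OF z sub_closed[OF x(1) X(1)[of n]]] norm_sub_commute[OF x(1) X(1)[of n]] by simp
        finally show ?thesis using norm_sub_triangle[OF px X(1)[of n] x(1)] by simp
      qed
      have "(\<lambda>n. 2 * cnorm A (csub A (X n) x)) \<longlonglongrightarrow> 2 * 0" by (rule tendsto_mult_left[OF x(2)])
      then have "cnorm A (csub A (\<phi> z x) x) \<le> 2 * 0"
        by (rule LIMSEQ_le_const) (use le in blast)
      then show "cnorm A (csub A (\<phi> z x) x) = 0"
        using norm_nonneg[OF sub_closed[OF px x(1)]] by simp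
    qed (rule x(1))
    then show ?case using x by (auto simp: sub)
  next
    case (6 x y z) then show ?case using add_assoc by simp
  next
    case (7 x y) then show ?case using add_commute by simp
  next
    case (14 x y z) then show ?case using mul_assoc by simp
  next
    case (24 x) then show ?case using norm_eq_zero by simp
  qed (simp_all add: sub star_homD[OF h] add_closed scale_closed mul_closed star_closed
      add_zero sub_self scale_add_right scale_add_left scale_scale scale_one distrib_right
      distrib_left scale_mul_left scale_mul_right star_star star_add star_scale star_mul norm_nonneg
      norm_triangle norm_scale norm_mul cstar_identity)
qed

section \<open>The universal C*-algebra\<close>

context bounded_presentation
begin

abbreviation "Cau \<equiv> univ_Cauchy G R"
abbreviation "cl \<equiv> univ_class G R"
abbreviation "UA \<equiv> univ_cstar G R"

lemma Cau_iff: "Cau x \<longleftrightarrow> (\<forall>n. x n \<in> F) \<and> (\<forall>e>0. \<exists>N. \<forall>m\<ge>N. \<forall>n\<ge>N. uq (x m - x n) < e)"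
  by (auto simp: univ_Cauchy_def univ_norm_eq_uq free_diff)

lemma Cau_free: "Cau x \<Longrightarrow> x n \<in> F"
  by (simp add: univ_Cauchy_def)

lemma CauD: "Cau x \<Longrightarrow> e > 0 \<Longrightarrow> \<exists>N. \<forall>m\<ge>N. \<forall>n\<ge>N. uq (x m - x n) < e"
  by (simp add: Cau_iff)

lemma Cau_const [intro, simp]: "p \<in> F \<Longrightarrow> Cau (\<lambda>n. p)"
  by (simp add: Cau_iff)

lemma Cau_add: assumes "Cau x" "Cau y" shows "Cau (\<lambda>n. x n + y n)"
  unfolding Cau_iff
proof (intro conjI allI impI)
  fix e :: real assume "e > 0"
  then obtain M N where MN: "\<forall>m\<ge>M. \<forall>n\<ge>M. uq (x m - x n) < e / 2" "\<forall>m\<ge>N. \<forall>n\<ge>N. uq (y m - y n) < e / 2"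
    using CauD[OF assms(1), of "e/2"] CauD[OF assms(2), of "e/2"] by auto
  have "uq (x m + y m - (x n + y n)) < e" if "m \<ge> max M N" "n \<ge> max M N" for m n
  proof -
    have "uq (x m - x n + (y m - y n)) \<le> uq (x m - x n) + uq (y m - y n)" by (rule q_add)
    also have "\<dots> < e / 2 + e / 2" using MN that by (intro add_strict_mono) auto
    finally show ?thesis by (simp add: algebra_simps)
  qed
  then show "\<exists>N. \<forall>m\<ge>N. \<forall>n\<ge>N. uq (x m + y m - (x n + y n)) < e" by blast
qed (use assms in \<open>simp add: Cau_free free_add free_mult free_scale\<close>)

lemma Cau_star: assumes "Cau x" shows "Cau (\<lambda>n. poly_star (x n))"
  unfolding Cau_iff using assms
  by (auto simp: Cau_iff poly_star_diff[symmetric] simp del: poly_star_diff)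

lemma Cau_bound: assumes "Cau x" shows "\<exists>B>0. \<forall>n. uq (x n) \<le> B"
proof -
  obtain N where N: "\<forall>m\<ge>N. \<forall>n\<ge>N. uq (x m - x n) < 1" using CauD[OF assms, of 1] by auto
  have "uq (x n) \<le> 1 + (\<Sum>k\<le>N. uq (x k))" for n
  proof (cases "n \<le> N")
    case True
    then have "uq (x n) \<le> (\<Sum>k\<le>N. uq (x k))" by (intro member_le_sum) auto
    then show ?thesis by simp
  next
    case False
    then have "uq (x n - x N) < 1" using N by auto
    moreover have "uq (x N) \<le> (\<Sum>k\<le>N. uq (x k))" by (intro member_le_sum) auto
    ultimately show ?thesis using q_le_diff[of "x n" "x N"] by simp
  qed
  moreover have "1 + (\<Sum>k\<le>N. uq (x k)) > 0" using sum_nonneg[of "{..N}" "\<lambda>k. uq (x k)"] by simp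
  ultimately show ?thesis by blast
qed

lemma uq_mult_diff: "uq (a * b - c * d) \<le> uq (a - c) * uq b + uq c * uq (b - d)"
proof -
  have "a * b - c * d = (a - c) * b + c * (b - d)" by (simp add: algebra_simps)
  then show ?thesis using q_add[of "(a - c) * b" "c * (b - d)"] q_mult[of "a - c" b] q_mult[of c "b - d"]
    by simp
qed

lemma Cau_mult: assumes "Cau x" "Cau y" shows "Cau (\<lambda>n. x n * y n)"
  unfolding Cau_iff
proof (intro conjI allI impI)
  fix e :: real assume e: "e > 0"
  obtain B C where B: "B > 0" "\<And>n. uq (x n) \<le> B" and C: "C > 0" "\<And>n. uq (y n) \<le> C"
    using Cau_bound[OF assms(1)] Cau_bound[OF assms(2)] by blast
  obtain M N where MN: "\<forall>m\<ge>M. \<forall>n\<ge>M. uq (x m - x n) < e / (2 * C)" "\<forall>m\<ge>N. \<forall>n\<ge>N. uq (y m - y n) < e / (2 * B)"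
    using CauD[OF assms(1), of "e/(2*C)"] CauD[OF assms(2), of "e/(2*B)"] e B C by auto
  have "uq (x m * y m - x n * y n) < e" if "m \<ge> max M N" "n \<ge> max M N" for m n
  proof -
    have mn: "uq (x m - x n) < e / (2 * C)" "uq (y m - y n) < e / (2 * B)" using MN that by auto
    have "uq (x m * y m - x n * y n) \<le> uq (x m - x n) * uq (y m) + uq (x n) * uq (y m - y n)"
      by (rule uq_mult_diff)
    also have "\<dots> \<le> uq (x m - x n) * C + B * uq (y m - y n)"
      by (intro add_mono mult_mono B C) (use B C in auto)
    also have "\<dots> < e / (2 * C) * C + B * (e / (2 * B))"
      using mn B C by (intro add_strict_mono mult_strict_right_mono mult_strict_left_mono) auto
    finally show ?thesis using B C by simp
  qed
  then show "\<exists>N. \<forall>m\<ge>N. \<forall>n\<ge>N. uq (x m * y m - x n * y n) < e" by blast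
qed (use assms in \<open>simp add: Cau_free free_add free_mult free_scale\<close>)

lemma Cau_scale: assumes "Cau x" shows "Cau (\<lambda>n. poly_scale c (x n))"
  unfolding Cau_iff
proof (intro conjI allI impI)
  fix e :: real assume e: "e > 0"
  obtain N where "\<forall>m\<ge>N. \<forall>n\<ge>N. uq (x m - x n) < e / (cmod c + 1)"
    using CauD[OF assms, of "e / (cmod c + 1)"] e by (auto simp: add_nonneg_pos)
  moreover have "cmod c * u < e" if "u < e / (cmod c + 1)" "u \<ge> 0" for u
  proof -
    have "(cmod c + 1) * u < e" using that by (simp add: pos_less_divide_eq add_nonneg_pos mult.commute)
    then show ?thesis using that by (simp add: algebra_simps)
  qed
  ultimately have "\<forall>m\<ge>N. \<forall>n\<ge>N. cmod c * uq (x m - x n) < e" using q_nonneg by blast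
  then show "\<exists>N. \<forall>m\<ge>N. \<forall>n\<ge>N. uq (poly_scale c (x m) - poly_scale c (x n)) < e"
    by (auto simp: poly_scale_diff_right[symmetric] q_scale)
qed (use assms in \<open>simp add: Cau_free free_add free_mult free_scale\<close>)

lemmas Cau_intros = Cau_add Cau_star Cau_mult Cau_scale Cau_const

definition null :: "(nat \<Rightarrow> 'g star_poly) \<Rightarrow> bool" where
  "null x \<longleftrightarrow> (\<lambda>n. uq (x n)) \<longlonglongrightarrow> 0"

lemma null_add: "null x \<Longrightarrow> null y \<Longrightarrow> null (\<lambda>n. x n + y n)"
  unfolding null_def
  by (rule tendsto_sandwich[of "\<lambda>_. 0" _ _ "\<lambda>n. uq (x n) + uq (y n)"])
    (auto intro!: q_add tendsto_add_zero always_eventually)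

lemma null_commute: "null (\<lambda>n. x n - y n) \<longleftrightarrow> null (\<lambda>n. y n - x n)"
  unfolding null_def by (simp add: q_diff_commute)

lemma null_trans: "null (\<lambda>n. x n - y n) \<Longrightarrow> null (\<lambda>n. y n - z n) \<Longrightarrow> null (\<lambda>n. x n - z n)"
  using null_add[of "\<lambda>n. x n - y n" "\<lambda>n. y n - z n"] by simp

lemma mem_cl_iff: assumes x: "Cau x" shows "y \<in> cl x \<longleftrightarrow> Cau y \<and> null (\<lambda>n. y n - x n)"
proof -
  have "univ_norm G R (y n - x n) = uq (y n - x n)" if "Cau y" for n
    by (rule univ_norm_eq_uq[OF free_diff[OF Cau_free[OF that] Cau_free[OF x]]])
  then show ?thesis by (auto simp: univ_class_def null_def)
qed

lemma mem_cl_self: "Cau x \<Longrightarrow> x \<in> cl x"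
  by (simp add: mem_cl_iff null_def)

lemma cl_eqI: assumes "Cau x" "Cau y" "null (\<lambda>n. x n - y n)" shows "cl x = cl y"
proof -
  have "null (\<lambda>n. z n - x n) \<longleftrightarrow> null (\<lambda>n. z n - y n)" for z
    using null_trans[of z x y] null_trans[of z y x] assms(3) null_commute[of x y] by blast
  then have "z \<in> cl x \<longleftrightarrow> z \<in> cl y" for z by (simp add: mem_cl_iff assms(1,2))
  then show ?thesis by blast
qed

lemma cl_eq_iff: "Cau x \<Longrightarrow> Cau y \<Longrightarrow> cl x = cl y \<longleftrightarrow> null (\<lambda>n. x n - y n)"
  using cl_eqI mem_cl_self[of x] mem_cl_iff[of y x] by auto

lemma car_cl: "Cau x \<Longrightarrow> cl x \<in> car UA"
  by (auto simp: univ_cstar_def)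

lemma carE: assumes "X \<in> car UA" obtains x where "Cau x" "X = cl x"
  using assms by (auto simp: univ_cstar_def)

lemma null_mult_diff:
  assumes "Cau x" "Cau y" "null (\<lambda>n. x' n - x n)" "null (\<lambda>n. y' n - y n)" "Cau y'"
  shows "null (\<lambda>n. x' n * y' n - x n * y n)"
proof -
  obtain B C where B: "B > 0" "\<And>n. uq (x n) \<le> B" and C: "C > 0" "\<And>n. uq (y' n) \<le> C"
    using Cau_bound[OF assms(1)] Cau_bound[OF assms(5)] by blast
  have le: "uq (x' n * y' n - x n * y n) \<le> uq (x' n - x n) * C + B * uq (y' n - y n)" for n
    by (rule order_trans[OF uq_mult_diff add_mono[OF mult_left_mono[OF C(2) q_nonneg] mult_right_mono[OF B(2) q_nonneg]]])
  have "(\<lambda>n. uq (x' n - x n) * C + B * uq (y' n - y n)) \<longlonglongrightarrow> 0 * C + B * 0"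
    using assms(3,4) unfolding null_def
    by (intro tendsto_add[OF tendsto_mult_right tendsto_mult_left])
  then have lim: "(\<lambda>n. uq (x' n - x n) * C + B * uq (y' n - y n)) \<longlonglongrightarrow> 0" by simp
  show ?thesis unfolding null_def
    by (rule tendsto_sandwich[OF _ _ tendsto_const lim]) (simp_all add: le)
qed

lemma czero_cl: "czero UA = cl (\<lambda>n. 0)"
  by (simp add: univ_cstar_def)

text \<open>All classes in the union coincide, and the union is not empty because each class
  contains its representative. So the operation can be computed on any pair of representatives; the
  same holds for the other operations.\<close>

lemma cadd_cl: assumes "Cau x" "Cau y" shows "cadd UA (cl x) (cl y) = cl (\<lambda>n. x n + y n)"
proof -
  have *: "cl (\<lambda>n. x' n + y' n) = cl (\<lambda>n. x n + y n)" if "x' \<in> cl x" "y' \<in> cl y" for x' y'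
  proof (rule cl_eqI)
    have "null (\<lambda>n. (x' n - x n) + (y' n - y n))" using that assms by (intro null_add) (auto simp: mem_cl_iff)
    then show "null (\<lambda>n. x' n + y' n - (x n + y n))" by (simp add: algebra_simps)
  qed (use that assms in \<open>simp_all add: mem_cl_iff Cau_add\<close>)
  have "cadd UA (cl x) (cl y) = (\<Union>x'\<in>cl x. \<Union>y'\<in>cl y. cl (\<lambda>n. x n + y n))"
    by (simp add: univ_cstar_def *)
  then show ?thesis using mem_cl_self assms by auto
qed

lemma cmul_cl: assumes "Cau x" "Cau y" shows "cmul UA (cl x) (cl y) = cl (\<lambda>n. x n * y n)"
proof -
  have *: "cl (\<lambda>n. x' n * y' n) = cl (\<lambda>n. x n * y n)" if "x' \<in> cl x" "y' \<in> cl y" for x' y'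
    by (rule cl_eqI)
      (use that assms in \<open>simp_all add: mem_cl_iff Cau_mult null_mult_diff\<close>)
  have "cmul UA (cl x) (cl y) = (\<Union>x'\<in>cl x. \<Union>y'\<in>cl y. cl (\<lambda>n. x n * y n))"
    by (simp add: univ_cstar_def *)
  then show ?thesis using mem_cl_self assms by auto
qed

lemma null_scale: "null x \<Longrightarrow> null (\<lambda>n. poly_scale c (x n))"
  unfolding null_def using tendsto_mult_right_zero[of "\<lambda>n. uq (x n)" _ "cmod c"] by (simp add: q_scale)

lemma cscale_cl: assumes "Cau x" shows "cscale UA c (cl x) = cl (\<lambda>n. poly_scale c (x n))"
proof -
  have *: "cl (\<lambda>n. poly_scale c (x' n)) = cl (\<lambda>n. poly_scale c (x n))" if "x' \<in> cl x" for x'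
    by (rule cl_eqI)
      (use that assms in \<open>simp_all add: mem_cl_iff poly_scale_diff_right[symmetric] Cau_scale null_scale\<close>)
  have "cscale UA c (cl x) = (\<Union>x'\<in>cl x. cl (\<lambda>n. poly_scale c (x n)))"
    by (simp add: univ_cstar_def *)
  then show ?thesis using mem_cl_self assms by auto
qed

lemma cstar_cl: assumes "Cau x" shows "cstar UA (cl x) = cl (\<lambda>n. poly_star (x n))"
proof -
  have *: "cl (\<lambda>n. poly_star (x' n)) = cl (\<lambda>n. poly_star (x n))" if "x' \<in> cl x" for x'
    by (rule cl_eqI) (use that assms in \<open>simp_all add: mem_cl_iff null_def Cau_star poly_star_diff[symmetric]
        del: poly_star_diff\<close>)
  have "cstar UA (cl x) = (\<Union>x'\<in>cl x. cl (\<lambda>n. poly_star (x n)))"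
    by (simp add: univ_cstar_def *)
  then show ?thesis using mem_cl_self assms by auto
qed

lemma uq_reverse_triangle: "\<bar>uq x - uq y\<bar> \<le> uq (x - y)"
  using q_le_diff[of x y] q_le_diff[of y x] q_diff_commute[of x y] by simp

lemma cnorm_cl: assumes x: "Cau x" shows "(\<lambda>n. uq (x n)) \<longlonglongrightarrow> cnorm UA (cl x)"
proof -
  have "Cauchy (\<lambda>n. uq (x n))"
    unfolding Cauchy_def dist_real_def
    by (meson CauD[OF x] le_less_trans[OF uq_reverse_triangle])
  then obtain a where a: "(\<lambda>n. uq (x n)) \<longlonglongrightarrow> a" by (auto simp: Cauchy_convergent_iff convergent_def)
  have all: "(\<lambda>n. univ_norm G R (y n)) \<longlonglongrightarrow> a" if "y \<in> cl x" for y
  proof -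
    have y: "Cau y" "null (\<lambda>n. y n - x n)" using that x by (simp_all add: mem_cl_iff)
    have "(\<lambda>n. uq (y n) - uq (x n)) \<longlonglongrightarrow> 0"
      by (rule Lim_null_comparison[of _ "\<lambda>n. uq (y n - x n)"])
        (use y(2) uq_reverse_triangle in \<open>auto simp: null_def\<close>)
    from tendsto_add[OF this a] have "(\<lambda>n. uq (y n)) \<longlonglongrightarrow> a" by simp
    then show ?thesis using y by (simp add: univ_norm_eq_uq Cau_free)
  qed
  have "cnorm UA (cl x) = a"
    unfolding univ_cstar_def cstar_alg.simps
  proof (rule the_equality)
    fix b assume "\<forall>y\<in>cl x. (\<lambda>n. univ_norm G R (y n)) \<longlonglongrightarrow> b"
    then show "b = a" using all[OF mem_cl_self[OF x]] mem_cl_self[OF x] LIMSEQ_unique by blast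
  qed (use all in blast)
  then show ?thesis using a by simp
qed

lemma cnorm_cl_eqI: "Cau x \<Longrightarrow> (\<lambda>n. uq (x n)) \<longlonglongrightarrow> a \<Longrightarrow> cnorm UA (cl x) = a"
  using cnorm_cl LIMSEQ_unique by blast

lemma cnorm_const: "p \<in> F \<Longrightarrow> cnorm UA (cl (\<lambda>n. p)) = uq p"
  by (rule cnorm_cl_eqI) auto

lemma csub_cl: assumes "Cau x" "Cau y" shows "csub UA (cl x) (cl y) = cl (\<lambda>n. x n - y n)"
  using cadd_cl[OF assms(1) Cau_scale[OF assms(2), of "-1"]]
  by (simp add: csub_def cscale_cl[OF assms(2)] poly_scale_minus_one)

lemma Cau_diff: "Cau x \<Longrightarrow> Cau y \<Longrightarrow> Cau (\<lambda>n. x n - y n)"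
  using Cau_add[of x "\<lambda>n. poly_scale (-1) (y n)"] Cau_scale[of y "-1"] by (simp add: poly_scale_minus_one)

lemma cnorm_eq_zero_cl: "Cau x \<Longrightarrow> cnorm UA (cl x) = 0 \<longleftrightarrow> cl x = czero UA"
  using cnorm_cl[of x] LIMSEQ_unique[of "\<lambda>n. uq (x n)" "cnorm UA (cl x)" 0]
  by (auto simp: czero_cl cl_eq_iff null_def)

text \<open>A diagonal argument: each \<open>X n\<close> is replaced by the class of a single
  polynomial \<open>y n\<close> at distance at most \<open>1 / (n + 1)\<close>. The sequence
  \<open>y\<close> is then Cauchy for the universal norm, and its class is the limit.\<close>

lemma UA_complete:
  assumes X: "\<And>n. X n \<in> car UA"
    and C: "\<And>e. 0 < e \<Longrightarrow> \<exists>N. \<forall>m\<ge>N. \<forall>n\<ge>N. cnorm UA (csub UA (X m) (X n)) < e"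
  shows "\<exists>x\<in>car UA. (\<lambda>n. cnorm UA (csub UA (X n) x)) \<longlonglongrightarrow> 0"
proof -
  have "\<forall>n. \<exists>x. Cau x \<and> X n = cl x" using carE[OF X] by blast
  then obtain x where "\<forall>n. Cau (x n) \<and> X n = cl (x n)" by (rule exE[OF choice])
  then have x: "\<And>n. Cau (x n)" "\<And>n. X n = cl (x n)" by auto
  have "\<exists>k. \<forall>j\<ge>k. uq (x n k - x n j) < inverse (real (Suc n))" for n
  proof -
    obtain N where "\<forall>m\<ge>N. \<forall>j\<ge>N. uq (x n m - x n j) < inverse (real (Suc n))"
      using CauD[OF x(1)[of n], of "inverse (real (Suc n))"] by auto
    then show ?thesis by (intro exI[of _ N]) simp
  qed
  then obtain k where "\<forall>n. \<forall>j\<ge>k n. uq (x n (k n) - x n j) < inverse (real (Suc n))"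
    using choice[of "\<lambda>n k. \<forall>j\<ge>k. uq (x n k - x n j) < inverse (real (Suc n))"] by blast
  then have k: "\<And>n j. j \<ge> k n \<Longrightarrow> uq (x n (k n) - x n j) < inverse (real (Suc n))" by auto
  define y where "y n = x n (k n)" for n
  have yF: "y n \<in> F" for n by (simp add: y_def Cau_free x)
  have near: "cnorm UA (csub UA (X n) (cl (\<lambda>_. y n))) \<le> inverse (real (Suc n))" for n
  proof -
    have "(\<lambda>j. uq (x n j - y n)) \<longlonglongrightarrow> cnorm UA (csub UA (X n) (cl (\<lambda>_. y n)))"
      by (simp add: x csub_cl yF cnorm_cl Cau_diff)
    moreover have "\<forall>\<^sub>F j in sequentially. uq (x n j - y n) \<le> inverse (real (Suc n))"
      unfolding eventually_sequentially
    proof (intro exI[of _ "k n"] allI impI)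
      fix j assume "k n \<le> j"
      then show "uq (x n j - y n) \<le> inverse (real (Suc n))"
        using k[of n j] q_diff_commute[of "x n j" "y n"] by (simp add: y_def)
    qed
    ultimately show ?thesis by (rule tendsto_upperbound) simp
  qed
  have yy: "uq (y m - y n) \<le> inverse (real (Suc m)) + cnorm UA (csub UA (X m) (X n)) + inverse (real (Suc n))" for m n
  proof -
    have lim: "(\<lambda>j. uq (x m j - x n j)) \<longlonglongrightarrow> cnorm UA (csub UA (X m) (X n))"
      by (simp add: x csub_cl cnorm_cl Cau_diff)
    have "uq (y m - y n) \<le> inverse (real (Suc m)) + uq (x m j - x n j) + inverse (real (Suc n))"
      if "j \<ge> max (k m) (k n)" for j
    proof -
      have "uq (y m - y n) \<le> uq (y m - x m j) + (uq (x m j - x n j) + uq (x n j - y n))"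
        using q_diff_triangle[of "y m" "y n" "x m j"] q_diff_triangle[of "x m j" "y n" "x n j"] by simp
      moreover have "uq (y m - x m j) < inverse (real (Suc m))" "uq (x n j - y n) < inverse (real (Suc n))"
        using k[of m j] k[of n j] that q_diff_commute[of "x n j" "y n"] by (auto simp: y_def)
      ultimately show ?thesis by simp
    qed
    then have "\<forall>\<^sub>F j in sequentially. uq (y m - y n) \<le> inverse (real (Suc m)) + uq (x m j - x n j) + inverse (real (Suc n))"
      unfolding eventually_sequentially by blast
    moreover have "(\<lambda>j. inverse (real (Suc m)) + uq (x m j - x n j) + inverse (real (Suc n))) \<longlonglongrightarrow>
       inverse (real (Suc m)) + cnorm UA (csub UA (X m) (X n)) + inverse (real (Suc n))"
      by (intro tendsto_add[OF tendsto_add[OF tendsto_const lim] tendsto_const])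
    ultimately show ?thesis by (intro tendsto_lowerbound[where F=sequentially]) auto
  qed
  have Cy: "Cau y"
    unfolding Cau_iff
  proof (intro conjI allI impI)
    fix e :: real assume e: "e > 0"
    obtain M where M: "\<forall>m\<ge>M. \<forall>n\<ge>M. cnorm UA (csub UA (X m) (X n)) < e / 3" using C[of "e/3"] e by auto
    obtain N where N: "\<And>n. n \<ge> N \<Longrightarrow> inverse (real (Suc n)) < e / 3"
      using LIMSEQ_D[OF LIMSEQ_inverse_real_of_nat, of "e/3"] e by auto
    show "\<exists>N. \<forall>m\<ge>N. \<forall>n\<ge>N. uq (y m - y n) < e"
    proof (intro exI[of _ "max M N"] allI impI)
      fix m n assume "max M N \<le> m" "max M N \<le> n"
      then have "cnorm UA (csub UA (X m) (X n)) < e / 3" "inverse (real (Suc m)) < e / 3" "inverse (real (Suc n)) < e / 3"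
        using M N by auto
      then show "uq (y m - y n) < e" using yy[of m n] by linarith
    qed
  qed (rule yF)
  have "(\<lambda>n. cnorm UA (csub UA (X n) (cl y))) \<longlonglongrightarrow> 0"
  proof (rule LIMSEQ_I)
    fix r :: real assume r: "r > 0"
    obtain M where M: "\<forall>m\<ge>M. \<forall>n\<ge>M. uq (y m - y n) < r / 3" using CauD[OF Cy, of "r/3"] r by auto
    obtain N where N: "\<And>n. n \<ge> N \<Longrightarrow> inverse (real (Suc n)) < r / 3"
      using LIMSEQ_D[OF LIMSEQ_inverse_real_of_nat, of "r/3"] r by auto
    show "\<exists>no. \<forall>n\<ge>no. norm (cnorm UA (csub UA (X n) (cl y)) - 0) < r"
    proof (intro exI[of _ "max M N"] allI impI)
      fix n assume n: "max M N \<le> n"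
      have lim: "(\<lambda>j. uq (x n j - y j)) \<longlonglongrightarrow> cnorm UA (csub UA (X n) (cl y))"
        by (simp add: x csub_cl cnorm_cl Cau_diff Cy)
      have "uq (x n j - y j) \<le> r / 3 + r / 3" if "j \<ge> max M (k n)" for j
      proof -
        have "uq (y n - x n j) < r / 3" using k[of n j] N[of n] n that by (simp add: y_def)
        moreover have "uq (y n - y j) < r / 3" using M n that by simp
        ultimately show ?thesis
          using q_diff_triangle[of "x n j" "y j" "y n"] q_diff_commute[of "x n j" "y n"] by linarith
      qed
      then have "\<forall>\<^sub>F j in sequentially. uq (x n j - y j) \<le> r / 3 + r / 3"
        unfolding eventually_sequentially by blast
      then have "cnorm UA (csub UA (X n) (cl y)) \<le> r / 3 + r / 3"
        by (intro tendsto_upperbound[OF lim]) auto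
      moreover have "0 \<le> cnorm UA (csub UA (X n) (cl y))"
        by (rule tendsto_lowerbound[OF lim]) auto
      ultimately show "norm (cnorm UA (csub UA (X n) (cl y)) - 0) < r" using r by simp
    qed
  qed
  then show ?thesis using car_cl[OF Cy] by blast
qed

lemmas cl_ops = czero_cl cadd_cl cmul_cl cscale_cl cstar_cl csub_cl

lemma cstar_algebra_UA: "cstar_algebra UA"
proof (standard, goal_cases)
  case 1 then show ?case by (simp add: czero_cl car_cl)
next
  case (2 x y) then show ?case by (elim carE) (simp add: cl_ops Cau_intros car_cl)
next
  case (3 x c) then show ?case by (elim carE) (simp add: cl_ops Cau_intros car_cl)
next
  case (4 x y) then show ?case by (elim carE) (simp add: cl_ops Cau_intros car_cl)
next
  case (5 x) then show ?case by (elim carE) (simp add: cl_ops Cau_intros car_cl)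
next
  case (6 x y z) then show ?case by (elim carE) (simp add: cl_ops Cau_intros add.assoc)
next
  case (7 x y) then show ?case by (elim carE) (simp add: cl_ops Cau_intros add.commute)
next
  case (8 x) then show ?case by (elim carE) (simp add: cl_ops Cau_intros)
next
  case (9 x) then show ?case by (elim carE) (simp add: cl_ops Cau_intros)
next
  case (10 x y c) then show ?case by (elim carE) (simp add: cl_ops Cau_intros poly_scale_add_right)
next
  case (11 x c d) then show ?case by (elim carE) (simp add: cl_ops Cau_intros poly_scale_add_left)
next
  case (12 x c d) then show ?case by (elim carE) (simp add: cl_ops Cau_intros)
next
  case (13 x) then show ?case by (elim carE) (simp add: cl_ops Cau_intros)
next
  case (14 x y z) then show ?case by (elim carE) (simp add: cl_ops Cau_intros mult.assoc)
next
  case (15 x y z) then show ?case by (elim carE) (simp add: cl_ops Cau_intros distrib_right)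
next
  case (16 x y z) then show ?case by (elim carE) (simp add: cl_ops Cau_intros distrib_left)
next
  case (17 x y c) then show ?case by (elim carE) (simp add: cl_ops Cau_intros poly_scale_mult_left)
next
  case (18 x y c) then show ?case by (elim carE) (simp add: cl_ops Cau_intros poly_scale_mult_right)
next
  case (19 x) then show ?case by (elim carE) (simp add: cl_ops Cau_intros)
next
  case (20 x y) then show ?case by (elim carE) (simp add: cl_ops Cau_intros)
next
  case (21 x c) then show ?case by (elim carE) (simp add: cl_ops Cau_intros)
next
  case (22 x y) then show ?case by (elim carE) (simp add: cl_ops Cau_intros)
next
  case (23 x)
  then show ?case by (elim carE) (auto intro: tendsto_lowerbound[OF cnorm_cl])
next
  case (24 x)
  then show ?case by (elim carE) (simp add: cnorm_eq_zero_cl)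
next
  case (25 x y)
  then obtain a b where ab: "Cau a" "x = cl a" "Cau b" "y = cl b" by (elim carE)
  show ?case unfolding ab(2,4) cadd_cl[OF ab(1,3)]
    by (rule tendsto_le[OF _ tendsto_add[OF cnorm_cl[OF ab(1)] cnorm_cl[OF ab(3)]] cnorm_cl[OF Cau_add[OF ab(1,3)]]])
      (auto simp: q_add)
next
  case (26 x c)
  then obtain a where a: "Cau a" "x = cl a" by (elim carE)
  show ?case unfolding a(2) cscale_cl[OF a(1)]
    using tendsto_mult_left[OF cnorm_cl[OF a(1)], of "cmod c"]
    by (intro cnorm_cl_eqI) (simp_all add: q_scale Cau_scale a)
next
  case (27 x y)
  then obtain a b where ab: "Cau a" "x = cl a" "Cau b" "y = cl b" by (elim carE)
  show ?case unfolding ab(2,4) cmul_cl[OF ab(1,3)]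
    by (rule tendsto_le[OF _ tendsto_mult[OF cnorm_cl[OF ab(1)] cnorm_cl[OF ab(3)]] cnorm_cl[OF Cau_mult[OF ab(1,3)]]])
      (auto simp: q_mult)
next
  case (28 x)
  then obtain a where a: "Cau a" "x = cl a" by (elim carE)
  show ?case unfolding a(2) cstar_cl[OF a(1)] cmul_cl[OF Cau_star[OF a(1)] a(1)]
    using tendsto_power[OF cnorm_cl[OF a(1)], of 2]
    by (intro cnorm_cl_eqI) (simp_all add: q_cstar Cau_intros a)
next
  case (29 X) then show ?case by (rule UA_complete)
qed

lemma dense: assumes x: "Cau x" and e: "e > 0"
  shows "\<exists>n. cnorm UA (csub UA (cl x) (cl (\<lambda>_. x n))) < e"
proof -
  obtain N where N: "\<forall>m\<ge>N. \<forall>n\<ge>N. uq (x m - x n) < e / 2" using CauD[OF x, of "e/2"] e by auto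
  have "(\<lambda>j. uq (x j - x N)) \<longlonglongrightarrow> cnorm UA (csub UA (cl x) (cl (\<lambda>_. x N)))"
    by (simp add: csub_cl cnorm_cl Cau_diff x Cau_free)
  moreover have "\<forall>\<^sub>F j in sequentially. uq (x j - x N) \<le> e / 2"
    using N less_imp_le unfolding eventually_sequentially by blast
  ultimately have "cnorm UA (csub UA (cl x) (cl (\<lambda>_. x N))) \<le> e / 2" by (rule tendsto_upperbound) simp
  then show ?thesis using e by (intro exI[of _ N]) simp
qed

text \<open>The maps agree on classes of polynomials by induction, and these are dense;
  contractivity then carries the equality over to limits.\<close>

lemma hom_unique:
  assumes B: "cstar_algebra B" and h: "star_hom UA B \<phi>" "star_hom UA B \<psi>"
    and c: "\<And>x. x \<in> car UA \<Longrightarrow> cnorm B (\<phi> x) \<le> cnorm UA x" "\<And>x. x \<in> car UA \<Longrightarrow> cnorm B (\<psi> x) \<le> cnorm UA x"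
    and g: "\<And>g. g \<in> G \<Longrightarrow> \<phi> (univ_gen G R g) = \<psi> (univ_gen G R g)"
    and X: "X \<in> car UA"
  shows "\<phi> X = \<psi> X"
proof -
  interpret A: cstar_algebra UA by (rule cstar_algebra_UA)
  interpret B: cstar_algebra B by fact
  obtain x where x: "Cau x" "X = cl x" using X by (rule carE)
  have eq: "\<phi> (cl (\<lambda>_. p)) = \<psi> (cl (\<lambda>_. p))" if "p \<in> F" for p
    using that
  proof (induction rule: free_induct)
    case zero
    then show ?case using star_hom_zero[OF h(1) A.cstar_algebra_axioms B]
        star_hom_zero[OF h(2) A.cstar_algebra_axioms B] by (simp add: czero_cl)
  next
    case (gen k)
    then show ?case using g[of k] by (simp add: univ_gen_def)
  next
    case (star p)
    then show ?case using star_homD(5)[OF h(1), of "cl (\<lambda>_. p)"] star_homD(5)[OF h(2), of "cl (\<lambda>_. p)"]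
      by (simp add: cstar_cl car_cl)
  next
    case (add p r)
    then show ?case using star_homD(2)[OF h(1), of "cl (\<lambda>_. p)" "cl (\<lambda>_. r)"]
        star_homD(2)[OF h(2), of "cl (\<lambda>_. p)" "cl (\<lambda>_. r)"] by (simp add: cadd_cl car_cl)
  next
    case (scale a p)
    then show ?case using star_homD(3)[OF h(1), of "cl (\<lambda>_. p)" a] star_homD(3)[OF h(2), of "cl (\<lambda>_. p)" a]
      by (simp add: cscale_cl car_cl)
  next
    case (mult p r)
    then show ?case using star_homD(4)[OF h(1), of "cl (\<lambda>_. p)" "cl (\<lambda>_. r)"]
        star_homD(4)[OF h(2), of "cl (\<lambda>_. p)" "cl (\<lambda>_. r)"] by (simp add: cmul_cl car_cl)
  qed
  have pX: "\<phi> X \<in> car B" "\<psi> X \<in> car B" using h X by (auto dest: star_homD(1))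
  have "cnorm B (csub B (\<phi> X) (\<psi> X)) < e" if e: "e > 0" for e
  proof -
    obtain n where n: "cnorm UA (csub UA X (cl (\<lambda>_. x n))) < e / 2"
      using dense[OF x(1), of "e/2"] e x(2) by auto
    let ?Y = "cl (\<lambda>_. x n)"
    have Y: "?Y \<in> car UA" using x by (simp add: car_cl Cau_free)
    have p: "cnorm B (csub B (\<phi> X) (\<phi> ?Y)) < e / 2"
      using star_hom_sub[OF h(1) A.cstar_algebra_axioms X Y] c(1)[OF A.sub_closed[OF X Y]] n by simp
    have "cnorm B (csub B (\<psi> X) (\<psi> ?Y)) < e / 2"
      using star_hom_sub[OF h(2) A.cstar_algebra_axioms X Y] c(2)[OF A.sub_closed[OF X Y]] n by simp
    then have q: "cnorm B (csub B (\<phi> ?Y) (\<psi> X)) < e / 2"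
      using B.norm_sub_commute[OF pX(2) star_homD(1)[OF h(2) Y]] eq[OF Cau_free[OF x(1)]] by simp
    show ?thesis using B.norm_sub_triangle[OF pX(1) star_homD(1)[OF h(1) Y] pX(2)] p q by simp
  qed
  then have "cnorm B (csub B (\<phi> X) (\<psi> X)) = 0"
    using B.norm_nonneg[OF B.sub_closed[OF pX]] by (metis less_eq_real_def less_irrefl)
  then show ?thesis by (rule B.eq_if_norm_sub_zero[OF pX])
qed

end

subsection \<open>Homomorphisms given by substitution\<close>

locale presentation_hom = A: bounded_presentation G R + B: bounded_presentation H S
  for G :: "'g set" and R and H :: "'h set" and S +
  fixes t :: "'g \<Rightarrow> 'h star_poly"
  assumes t_free: "g \<in> G \<Longrightarrow> t g \<in> free_star_algebra H"
    and t_rel: "r \<in> R \<Longrightarrow> B.uq (subst t r) = 0"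
begin

lemma subst_closed: "x \<in> A.F \<Longrightarrow> subst t x \<in> B.F"
  by (rule subst_free[OF t_free])

lemma subst_le: "x \<in> A.F \<Longrightarrow> B.uq (subst t x) \<le> A.uq x"
  by (rule A.subst_uq_le[OF B.cseminorm_axioms t_rel])

text \<open>The chosen representative does not matter, by \<open>hom_cl\<close>. The restriction to
  the carrier provides the extensionality that \<open>univ_hom\<close> demands.\<close>

definition hom :: "(nat \<Rightarrow> 'g star_poly) set \<Rightarrow> (nat \<Rightarrow> 'h star_poly) set" where
  "hom = (\<lambda>X\<in>car A.UA. B.cl (\<lambda>n. subst t ((SOME x. x \<in> X) n)))"

lemma subst_Cau: assumes "A.Cau x" shows "B.Cau (\<lambda>n. subst t (x n))"
  unfolding B.Cau_iff
proof (intro conjI allI impI)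
  fix e :: real assume "e > 0"
  then obtain N where N: "\<forall>m\<ge>N. \<forall>n\<ge>N. A.uq (x m - x n) < e" using A.CauD[OF assms] by blast
  have "B.uq (subst t (x m) - subst t (x n)) \<le> A.uq (x m - x n)" for m n
    using subst_le[of "x m - x n"] assms by (simp add: free_diff A.Cau_free)
  then show "\<exists>N. \<forall>m\<ge>N. \<forall>n\<ge>N. B.uq (subst t (x m) - subst t (x n)) < e"
    using N by (meson le_less_trans)
qed (simp add: subst_closed A.Cau_free assms)

lemma subst_null:
  assumes "A.Cau x" "A.Cau y" "A.null (\<lambda>n. x n - y n)"
  shows "B.null (\<lambda>n. subst t (x n) - subst t (y n))"
proof -
  have le: "B.uq (subst t (x n) - subst t (y n)) \<le> A.uq (x n - y n)" for n
    using subst_le[of "x n - y n"] assms by (simp add: free_diff A.Cau_free)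
  show ?thesis unfolding B.null_def
    by (rule tendsto_sandwich[OF _ _ tendsto_const assms(3)[unfolded A.null_def]]) (simp_all add: le)
qed

lemma hom_cl: assumes x: "A.Cau x" shows "hom (A.cl x) = B.cl (\<lambda>n. subst t (x n))"
proof -
  let ?y = "SOME y. y \<in> A.cl x"
  have "?y \<in> A.cl x" using someI[of "\<lambda>y. y \<in> A.cl x", OF A.mem_cl_self[OF x]] .
  then have y: "A.Cau ?y" "A.null (\<lambda>n. ?y n - x n)" using A.mem_cl_iff[OF x] by auto
  have "B.cl (\<lambda>n. subst t (?y n)) = B.cl (\<lambda>n. subst t (x n))"
    by (intro B.cl_eqI subst_Cau subst_null x y)
  then show ?thesis by (simp add: hom_def A.car_cl x)
qed

lemma star_hom_hom: "star_hom A.UA B.UA hom"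
  unfolding star_hom_def
  by (auto elim!: A.carE simp: A.cl_ops B.cl_ops hom_cl A.Cau_intros B.Cau_intros subst_Cau B.car_cl)

lemma hom_contractive: "X \<in> car A.UA \<Longrightarrow> cnorm B.UA (hom X) \<le> cnorm A.UA X"
proof -
  assume "X \<in> car A.UA"
  then obtain x where x: "A.Cau x" "X = A.cl x" by (rule A.carE)
  show ?thesis unfolding x(2) hom_cl[OF x(1)]
    by (rule tendsto_le[OF _ A.cnorm_cl[OF x(1)] B.cnorm_cl[OF subst_Cau[OF x(1)]]])
      (auto simp: subst_le A.Cau_free x)
qed

lemma hom_extensional: "hom \<in> extensional (car A.UA)"
  by (simp add: hom_def)

lemma hom_gen: "g \<in> G \<Longrightarrow> hom (univ_gen G R g) = B.cl (\<lambda>n. t g)"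
  unfolding univ_gen_def by (simp add: hom_cl free_gen)

text \<open>This discharges the definite description in \<open>univ_hom\<close>: \<open>hom\<close>
  satisfies it, and density leaves no other candidate. Afterwards every map given on generators is
  applied by substitution into representatives.\<close>

lemma univ_hom_eq:
  assumes "\<And>g. g \<in> G \<Longrightarrow> s g = B.cl (\<lambda>n. t g)"
  shows "univ_hom G R B.UA s = hom"
  unfolding univ_hom_def
proof (rule the_equality, intro conjI ballI)
  show "hom \<in> extensional (car A.UA)" by (rule hom_extensional)
  show "star_hom A.UA B.UA hom" by (rule star_hom_hom)
  show "cnorm B.UA (hom x) \<le> cnorm A.UA x" if "x \<in> car A.UA" for x by (rule hom_contractive[OF that])
  show "hom (univ_gen G R g) = s g" if "g \<in> G" for g using that by (simp only: hom_gen assms)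
next
  fix \<phi> assume p: "\<phi> \<in> extensional (car A.UA) \<and> star_hom A.UA B.UA \<phi> \<and>
     (\<forall>x\<in>car A.UA. cnorm B.UA (\<phi> x) \<le> cnorm A.UA x) \<and> (\<forall>g\<in>G. \<phi> (univ_gen G R g) = s g)"
  have g: "\<phi> (univ_gen G R g) = hom (univ_gen G R g)" if "g \<in> G" for g
    using p that by (simp only: hom_gen assms)
  show "\<phi> = hom"
  proof (rule extensionalityI[of _ "car A.UA"])
    fix X assume X: "X \<in> car A.UA"
    show "\<phi> X = hom X"
      by (rule A.hom_unique[OF B.cstar_algebra_UA _ star_hom_hom _ hom_contractive g X]) (use p in blast)+
  qed (use p hom_extensional in blast)+
qed

end

section \<open>Projections that sum to a projection\<close>

text \<open>If \<open>b < a\<close>, the powers of \<open>a / b\<close> would exceed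
  \<open>M\<close>. Exponents \<open>2 ^ k\<close> are what repeated squaring of a self-adjoint
  element produces through the C*-identity.\<close>

lemma pow_bound_imp_le:
  fixes a b M :: real
  assumes b: "0 \<le> b" and le: "\<And>k::nat. a ^ (2 ^ k) \<le> M * b ^ (2 ^ k)"
  shows "a \<le> b"
proof (rule ccontr)
  assume "\<not> a \<le> b"
  then have ab: "b < a" by simp
  then have a: "0 < a" using b by simp
  show False
  proof (cases "b = 0")
    case True
    then have "a \<le> 0" using le[of 0] by simp
    then show False using a by simp
  next
    case False
    then have b0: "0 < b" using b by simp
    have "1 < a / b" using ab b0 by simp
    then obtain n where n: "M < (a / b) ^ n" using real_arch_pow by blast
    have "(a / b) ^ n \<le> (a / b) ^ (2 ^ n)"
      using \<open>1 < a / b\<close> less_exp[of n] by (intro power_increasing) auto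
    also have "\<dots> \<le> M" using le[of n] b0 by (simp add: power_divide pos_divide_le_eq)
    finally show False using n by simp
  qed
qed

context cseminorm
begin

lemma q_of_nat_mult: "q (of_nat n * x) = real n * q x"
proof -
  have "of_nat n * x = poly_scale (of_nat n) x" by (simp add: poly_scale_conv_mult)
  then show ?thesis by (simp add: q_scale)
qed

lemma q_numeral_mult: "q (numeral n * x) = numeral n * q x"
  using q_of_nat_mult[of "numeral n" x] by simp

lemma q_proj: assumes "poly_star e \<doteq> e" "e * e \<doteq> e" shows "q e \<le> 1"
proof -
  have "(q e)\<^sup>2 = q e"
    using q_cstar[of e] eqv_q[OF eqv_trans[OF eqv_mult_left[OF assms(1)] assms(2)]] by simp
  then show ?thesis by (auto simp: power2_eq_square)
qed

text \<open>Iterating this shows that a projection \<open>u\<close> is an extreme point of the unit ball of its corner,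
  which replaces spectral theory in what follows.  The constant \<open>3/2\<close> comes from
  \<open>4 (u + 3/2 c) = 3 (u + c)\<^sup>2 + (u - 3 c\<^sup>2)\<close> and
  \<open>4 (u - 3 c\<^sup>2) = (u + i c)\<^sup>4 + (u - i c)\<^sup>4 + 2 (u - c\<^sup>2) (u + c\<^sup>2)\<close>.\<close>

lemma corner_stretch:
  assumes sc: "poly_star c = c" and su: "poly_star u = u"
    and uu: "u * u \<doteq> u" and uc: "u * c \<doteq> c" and cu: "c * u \<doteq> c"
    and le: "q (u + c) \<le> 1" "q (u - c) \<le> 1"
  shows "q (u + poly_scale (3/2) c) \<le> 1"
proof -
  let ?k = "poly_scale \<i> c"
  have kk: "?k * ?k = - (c * c)"
    by (simp add: poly_scale_mult_left poly_scale_mult_right poly_scale_minus_one)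
  have uk: "u * ?k \<doteq> ?k" "?k * u \<doteq> ?k"
    using eqv_scale[OF uc, of \<i>] eqv_scale[OF cu, of \<i>] by (simp_all add: poly_scale_mult_left poly_scale_mult_right)
  have ucc: "u * (c * c) \<doteq> c * c" "(c * c) * u \<doteq> c * c"
    using eqv_mult_left[OF uc, of c] eqv_mult_right[OF cu, of c] by (simp_all add: mult.assoc)
  have sq: "q (x * x) \<le> 1" if "q x \<le> 1" for x using q_mult_le1[OF that that] .
  \<comment> \<open>The average of the squares of \<open>u + c\<close> and
    \<open>u - c\<close>.\<close>
  have cc1: "q (u + c * c) \<le> 1"
  proof -
    have "u * u + u * u + (c * c + c * c) \<doteq> u + u + (c * c + c * c)"
      by (intro eqv_add uu eqv_refl)
    then have h: "(u + c) * (u + c) + (u - c) * (u - c) \<doteq> 2 * (u + c * c)"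
      by (simp add: algebra_simps mult_2)
    have "2 * q (u + c * c) = q ((u + c) * (u + c) + (u - c) * (u - c))"
      using eqv_q[OF h] by (simp only: q_numeral_mult)
    also have "\<dots> \<le> 1 + 1" by (rule order_trans[OF q_add add_mono[OF sq sq]]) (rule le)+
    finally show ?thesis by simp
  qed
  have cc2: "q (u - c * c) \<le> 1"
  proof -
    have "u * u + (u * c - c * u) - c * c \<doteq> u + (c - c) - c * c"
      by (intro eqv_add eqv_diff uu uc cu eqv_refl)
    then have "(u - c) * (u + c) \<doteq> u - c * c" by (simp add: algebra_simps)
    then show ?thesis using eqv_q q_mult_le1[OF le(2,1)] by fastforce
  qed
  \<comment> \<open>As \<open>?k\<close> is skew-adjoint, the square of the norm of
    \<open>u + ?k\<close> is the norm of \<open>(u - ?k) * (u + ?k)\<close>, and this product is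
    \<open>u + c * c\<close> modulo \<open>q\<close>.\<close>
  have k1: "q (u + ?k) \<le> 1" "q (u - ?k) \<le> 1"
  proof -
    have "u * u + (u * ?k - ?k * u) - ?k * ?k \<doteq> u + (?k - ?k) - ?k * ?k"
      by (intro eqv_add eqv_diff uu uk eqv_refl)
    then have "(u - ?k) * (u + ?k) \<doteq> u - ?k * ?k" by (simp only: algebra_simps) simp
    then have 1: "q ((u - ?k) * (u + ?k)) \<le> 1" using cc1 by (simp add: kk eqv_q)
    have s: "poly_star ?k = - ?k" by (simp add: sc) (metis poly_scale_minus_one mult_minus1 poly_scale_scale)
    have "(q (u + ?k))\<^sup>2 \<le> 1"
      using 1 q_cstar[of "u + ?k"] by (simp only: poly_star_add su s) simp
    then show "q (u + ?k) \<le> 1" using power2_le_imp_le[of _ 1] by simp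
    moreover have "poly_star (u + ?k) = u - ?k" by (simp only: poly_star_add su s) simp
    ultimately show "q (u - ?k) \<le> 1" using q_star[of "u + ?k"] by simp
  qed
  \<comment> \<open>Each fourth power contributes at most 1 and the last summand at most 2, which
    matches the factor 4 on the other side of \<open>four\<close>.\<close>
  have fourth: "q (((u + ?k) * (u + ?k)) * ((u + ?k) * (u + ?k)) + ((u - ?k) * (u - ?k)) * ((u - ?k) * (u - ?k))
      + 2 * ((u - c * c) * (u + c * c))) \<le> 4"
  proof -
    have "q (2 * ((u - c * c) * (u + c * c))) \<le> 2"
      using q_mult_le1[OF cc2 cc1] by (simp add: q_numeral_mult)
    then show ?thesis
      using sq[OF sq[OF k1(1)]] sq[OF sq[OF k1(2)]]
      by (intro order_trans[OF q_add] order_trans[OF add_mono[OF q_add order_refl]]) simp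
  qed
  have sqk: "(u + ?k) * (u + ?k) \<doteq> u - c * c + 2 * ?k" "(u - ?k) * (u - ?k) \<doteq> u - c * c - 2 * ?k"
  proof -
    have "u * u + (u * ?k + ?k * u) + ?k * ?k \<doteq> u + (?k + ?k) + ?k * ?k"
      "u * u - (u * ?k + ?k * u) + ?k * ?k \<doteq> u - (?k + ?k) + ?k * ?k"
      by (intro eqv_add eqv_diff uu uk eqv_refl)+
    then show "(u + ?k) * (u + ?k) \<doteq> u - c * c + 2 * ?k" "(u - ?k) * (u - ?k) \<doteq> u - c * c - 2 * ?k"
      unfolding kk by (simp_all add: algebra_simps mult_2 kk)
  qed
  have ss: "(u - c * c) * (u - c * c) \<doteq> u - 2 * (c * c) + (c * c) * (c * c)"
  proof -
    have "u * u - (u * (c * c) + (c * c) * u) + (c * c) * (c * c) \<doteq> u - (c * c + c * c) + (c * c) * (c * c)"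
      by (intro eqv_add eqv_diff uu ucc eqv_refl)
    then show ?thesis by (simp add: algebra_simps mult_2)
  qed
  have sd: "(u - c * c) * (u + c * c) \<doteq> u - (c * c) * (c * c)"
  proof -
    have "u * u + (u * (c * c) - (c * c) * u) - (c * c) * (c * c) \<doteq> u + (c * c - c * c) - (c * c) * (c * c)"
      by (intro eqv_add eqv_diff uu ucc eqv_refl)
    then show ?thesis by (simp add: algebra_simps mult_2)
  qed
  have four: "((u + ?k) * (u + ?k)) * ((u + ?k) * (u + ?k)) + ((u - ?k) * (u - ?k)) * ((u - ?k) * (u - ?k))
      + 2 * ((u - c * c) * (u + c * c)) \<doteq> 4 * (u - 3 * (c * c))"
  proof -
    let ?s = "u - c * c"
    have "((u + ?k) * (u + ?k)) * ((u + ?k) * (u + ?k)) + ((u - ?k) * (u - ?k)) * ((u - ?k) * (u - ?k))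
      + 2 * (?s * (u + c * c)) \<doteq> (?s + 2 * ?k) * (?s + 2 * ?k) + (?s - 2 * ?k) * (?s - 2 * ?k)
      + 2 * (u - (c * c) * (c * c))"
      by (intro eqv_add eqv_mult sqk sd eqv_refl)
    also have "(?s + 2 * ?k) * (?s + 2 * ?k) + (?s - 2 * ?k) * (?s - 2 * ?k) = 2 * (?s * ?s) + 8 * (?k * ?k)"
    proof -
      have "(a + b) * (a + b) + (a - b) * (a - b) = 2 * (a * a) + 2 * (b * b)" for a b :: "'g star_poly"
        by (simp add: algebra_simps mult_2)
      moreover have "2 * ((2 * ?k) * (2 * ?k)) = 8 * (?k * ?k)"
      proof -
        have "8 * (?k * ?k) = 2 * (2 * (2 * (?k * ?k)))" by (simp only: mult.assoc[symmetric]) simp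
        then show ?thesis by (simp only: mult_2 distrib_left distrib_right add.assoc)
      qed
      ultimately show ?thesis by simp
    qed
    also have "2 * (?s * ?s) + 8 * (?k * ?k) + 2 * (u - (c * c) * (c * c))
      \<doteq> 2 * (u - 2 * (c * c) + (c * c) * (c * c)) + 8 * (?k * ?k) + 2 * (u - (c * c) * (c * c))"
      by (intro eqv_add eqv_mult_right ss eqv_refl)
    also have "\<dots> = 4 * (u - 3 * (c * c))"
    proof -
      \<comment> \<open>Numeral multiples are written out as sums, so that the identity becomes one
        of additive terms in a noncommutative ring.\<close>
      have n: "3 * x = x + x + x" "4 * x = (x + x) + (x + x)" "8 * x = ((x + x) + (x + x)) + ((x + x) + (x + x))"
        for x :: "'g star_poly"
      proof -
        show "3 * x = x + x + x" using distrib_right[of 2 1 x] by (simp add: mult_2)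
        show four: "4 * x = (x + x) + (x + x)" using distrib_right[of 2 2 x] by (simp add: mult_2)
        show "8 * x = ((x + x) + (x + x)) + ((x + x) + (x + x))"
          using distrib_right[of 4 4 x] four by simp
      qed
      show ?thesis unfolding kk n mult_2 by (simp add: algebra_simps)
    qed
    finally show ?thesis .
  qed
  have c3: "q (u - 3 * (c * c)) \<le> 1"
    using fourth unfolding eqv_q[OF four] q_numeral_mult by simp
  have "u * u + (u * c + c * u) + c * c \<doteq> u + (c + c) + c * c"
    by (intro eqv_add uu uc cu eqv_refl)
  then have "(u + c) * (u + c) \<doteq> u + 2 * c + c * c" by (simp add: algebra_simps mult_2)
  then have "3 * ((u + c) * (u + c)) + (u - 3 * (c * c)) \<doteq> 3 * (u + 2 * c + c * c) + (u - 3 * (c * c))"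
    by (intro eqv_add eqv_mult_right eqv_refl)
  also have "3 * (u + 2 * c + c * c) + (u - 3 * (c * c)) = 4 * (u + poly_scale (3/2) c)"
  proof -
    have "4 * poly_scale (3/2) c = poly_scale 4 (poly_scale (3/2) c)"
      by (simp only: poly_scale_conv_mult[of 4] single_numeral)
    also have "\<dots> = poly_scale 6 c" by simp
    also have "\<dots> = 6 * c" by (simp only: poly_scale_conv_mult[of 6] single_numeral)
    finally show ?thesis using distrib_right[of 3 1 u]
      by (simp add: distrib_left right_diff_distrib mult.assoc[symmetric])
  qed
  finally have "4 * q (u + poly_scale (3/2) c) = q (3 * ((u + c) * (u + c)) + (u - 3 * (c * c)))"
    by (simp only: eqv_q q_numeral_mult)
  also have "\<dots> \<le> 3 * 1 + 1"
    using sq[OF le(1)] c3 by (intro order_trans[OF q_add] add_mono) (simp_all add: q_numeral_mult)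
  finally show ?thesis by simp
qed

text \<open>Stretching again and again keeps \<open>u\<close> plus or minus \<open>(3/2)^n\<close>
  times \<open>c\<close> in the unit ball. Their difference bounds \<open>(3/2)^n * q c\<close> by 1
  for every \<open>n\<close>, so \<open>q c\<close> vanishes.\<close>

lemma corner_extreme:
  assumes sc: "poly_star c = c" and su: "poly_star u = u"
    and uu: "u * u \<doteq> u" and uc: "u * c \<doteq> c" and cu: "c * u \<doteq> c"
    and le: "q (u + c) \<le> 1" "q (u - c) \<le> 1"
  shows "c \<doteq> 0"
proof -
  have *: "q (u + poly_scale (of_real ((3/2)^n)) c) \<le> 1 \<and> q (u - poly_scale (of_real ((3/2)^n)) c) \<le> 1" for n
  proof (induction n)
    case 0
    then show ?case using le by simp
  next
    case (Suc n)
    let ?c = "poly_scale (of_real ((3/2)^n)) c"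
    have c: "poly_star ?c = ?c" "u * ?c \<doteq> ?c" "?c * u \<doteq> ?c"
      using eqv_scale[OF uc] eqv_scale[OF cu] by (simp_all add: sc poly_scale_mult_left poly_scale_mult_right)
    have c': "poly_star (- ?c) = - ?c" "u * - ?c \<doteq> - ?c" "- ?c * u \<doteq> - ?c"
      using c eqv_uminus by (simp_all add: sc)
    have "q (u + poly_scale (3/2) ?c) \<le> 1" "q (u + poly_scale (3/2) (- ?c)) \<le> 1"
      using corner_stretch[OF c(1) su uu c(2,3)] corner_stretch[OF c'(1) su uu c'(2,3)] Suc by simp_all
    moreover have "poly_scale (3/2) (- ?c) = - poly_scale (3/2) ?c"
      by (metis poly_scale_minus_one poly_scale_scale mult.commute)
    ultimately show ?case by simp
  qed
  have "(3/2)^n * q c \<le> 1" for n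
  proof -
    let ?c = "poly_scale (of_real ((3/2)^n)) c"
    have "2 * q ?c = q ((u + ?c) - (u - ?c))" by (simp add: q_numeral_mult[symmetric] mult_2)
    also have "\<dots> \<le> 2" using *[of n] q_diff[of "u + ?c" "u - ?c"] by simp
    finally have "q ?c \<le> 1" by simp
    moreover have "q ?c = (3/2)^n * q c"
      by (subst q_scale, subst norm_of_real) simp
    ultimately show ?thesis by simp
  qed
  then have all: "\<And>n. (3/2)^n * q c \<le> 1" .
  have "q c \<le> 0"
  proof (rule ccontr)
    assume "\<not> q c \<le> 0"
    then have p: "q c > 0" by simp
    obtain n where "1 / q c < (3/2) ^ n" using real_arch_pow[of "3/2" "1 / q c"] by auto
    then have "1 < (3/2)^n * q c" using p by (simp add: pos_divide_less_eq)
    then show False using all[of n] by simp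
  qed
  then show ?thesis using q_nonneg[of c] by (simp add: eqv_zero_iff)
qed

text \<open>Think of positive elements \<open>b k\<close> of the corner of \<open>u\<close> with sum
  0. For \<open>m\<close> the number of indices, \<open>u + b k / m\<close> is, modulo
  \<open>q\<close>, the average of \<open>u\<close> and the other \<open>u - b i\<close>, because
  the sum of all \<open>b i\<close> vanishes; and \<open>u - b k / m\<close> is the average of
  \<open>u - b k\<close> and \<open>m - 1\<close> copies of \<open>u\<close>. Both lie in the unit
  ball, so extremality of \<open>u\<close> applies.\<close>

lemma corner_sum_zero:
  assumes su: "poly_star u = u" and uu: "u * u \<doteq> u" and K: "finite K"
    and b: "\<And>k. k \<in> K \<Longrightarrow> poly_star (b k) = b k" "\<And>k. k \<in> K \<Longrightarrow> u * b k \<doteq> b k"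
      "\<And>k. k \<in> K \<Longrightarrow> b k * u \<doteq> b k" "\<And>k. k \<in> K \<Longrightarrow> q (u - b k) \<le> 1"
    and s: "sum b K \<doteq> 0" and k: "k \<in> K"
  shows "b k \<doteq> 0"
proof -
  define m where "m = card K"
  have m: "m > 0" using K k card_gt_0_iff by (auto simp: m_def)
  let ?c = "poly_scale (of_real (1 / real m)) (b k)"
  have qu: "q u \<le> 1" using q_proj[of u] su uu by simp
  have mc: "of_nat m * ?c = b k" using m
    by (subst poly_scale_conv_mult[of "of_nat m", simplified, symmetric]) simp
  have "real m * q (u + ?c) = q (of_nat m * u + b k)"
    by (simp only: q_of_nat_mult[symmetric] distrib_left mc)
  also have "of_nat m * u + b k = u + (\<Sum>i\<in>K-{k}. (u - b i)) + sum b K"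
    using K k m by (simp add: sum_subtractf sum.remove[of K k] m_def of_nat_diff algebra_simps Suc_leI)
  also have "q \<dots> \<le> (1 + (\<Sum>i\<in>K-{k}. 1)) + 0"
    by (intro order_trans[OF q_add] add_mono order_trans[OF q_sum sum_mono] qu b(4))
      (use s in \<open>auto simp: eqv_zero_iff\<close>)
  also have "\<dots> = real m" using K k m by (simp add: m_def of_nat_diff Suc_leI)
  finally have p: "q (u + ?c) \<le> 1" using m by simp
  have "real m * q (u - ?c) = q (of_nat m * u - b k)"
    by (simp only: q_of_nat_mult[symmetric] right_diff_distrib mc)
  also have "of_nat m * u - b k = (u - b k) + of_nat (m - 1) * u"
    using m by (simp add: of_nat_diff Suc_leI algebra_simps)
  also have "q \<dots> \<le> 1 + real (m - 1) * 1"
    by (intro order_trans[OF q_add] add_mono b(4) k) (simp add: q_of_nat_mult mult_left_le qu)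
  also have "\<dots> = real m" using m by (simp add: of_nat_diff Suc_leI)
  finally have n: "q (u - ?c) \<le> 1" using m by simp
  have "?c \<doteq> 0"
    using eqv_scale[OF b(2)[OF k]] eqv_scale[OF b(3)[OF k]]
    by (intro corner_extreme[OF _ su uu _ _ p n])
      (simp_all add: b(1)[OF k] poly_scale_mult_left poly_scale_mult_right)
  then have "of_nat m * ?c \<doteq> of_nat m * 0" by (rule eqv_mult_right)
  then show ?thesis unfolding mc by simp
qed

text \<open>In a C*-algebra one would compress the sum \<open>p\<close> by \<open>e j\<close>: the
  compressions of the other \<open>e k\<close> are positive with sum
  \<open>e j * p * e j - e j\<close>, which is not positive unless it is 0. Here membership of
  \<open>u - b k\<close> in the unit ball takes the place of positivity of \<open>b k\<close>. Once
  \<open>u * e i * u\<close> vanishes, the C*-identity gives the same for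
  \<open>e i * u\<close>.\<close>

lemma proj_sum_orthogonal:
  assumes I: "finite I" and se: "\<And>i. i \<in> I \<Longrightarrow> poly_star (e i) = e i"
    and ee: "\<And>i. i \<in> I \<Longrightarrow> e i * e i \<doteq> e i"
    and pp: "sum e I * sum e I \<doteq> sum e I"
    and ij: "i \<in> I" "j \<in> I" "i \<noteq> j"
  shows "e i * e j \<doteq> 0"
proof -
  define p where "p = sum e I"
  define u where "u = e j"
  \<comment> \<open>The entry at \<open>j\<close> absorbs the defect \<open>u - u * p * u\<close>,
    which is not yet known to be 0, so that the family sums to 0 modulo \<open>q\<close>.\<close>
  define b where "b k = (if k = j then u - u * p * u else u * e k * u)" for k
  have sp: "poly_star p = p" by (simp add: p_def poly_star_sum se)
  have su: "poly_star u = u" and uu: "u * u \<doteq> u" using se ee ij by (simp_all add: u_def)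
  have qp: "q p \<le> 1" "q u \<le> 1" using q_proj[of p] q_proj[of u] sp su uu pp by (simp_all add: p_def)
  have uxu: "u * (u * x * u) \<doteq> u * x * u" "(u * x * u) * u \<doteq> u * x * u" for x
    using eqv_mult_left[OF uu, of "x * u"] eqv_mult_right[OF uu, of "u * x"] by (simp_all add: mult.assoc)
  have "b i \<doteq> 0"
  proof (rule corner_sum_zero[OF su uu I])
    fix k assume k: "k \<in> I"
    show "poly_star (b k) = b k" using k by (simp add: b_def su sp se mult.assoc)
    show "u * b k \<doteq> b k" unfolding b_def using uxu(1) eqv_diff[OF uu uxu(1)[of p]]
      by (simp add: right_diff_distrib)
    show "b k * u \<doteq> b k" unfolding b_def using uxu(2) eqv_diff[OF uu uxu(2)[of p]]
      by (simp add: left_diff_distrib)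
    show "q (u - b k) \<le> 1"
    proof (cases "k = j")
      case True
      then show ?thesis by (simp add: b_def q_mult_le1 qp)
    next
      case False
      have "(1 - e k) * (1 - e k) \<doteq> 1 - e k"
        using eqv_add[OF eqv_refl[of "1 - e k - e k"] ee[OF k]] by (simp add: algebra_simps)
      then have "q (1 - e k) \<le> 1" using se[OF k] by (intro q_proj) simp_all
      then have "q (u * (1 - e k) * u) \<le> 1" by (intro q_mult_le1 qp)
      moreover have "u - b k \<doteq> u * (1 - e k) * u"
        using eqv_diff[OF eqv_sym[OF uu] eqv_refl[of "b k"]] False by (simp add: b_def algebra_simps)
      ultimately show ?thesis by (simp add: eqv_q)
    qed
  next
    have "sum b I = b j + (\<Sum>k\<in>I-{j}. u * e k * u)" using I ij by (simp add: sum.remove[of I j] b_def)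
    also have "(\<Sum>k\<in>I-{j}. u * e k * u) = u * p * u - u * u * u"
      using I ij by (simp add: p_def sum.remove[of I j] u_def distrib_left distrib_right sum_distrib_left sum_distrib_right)
    finally have "sum b I = u - u * u * u" by (simp add: b_def)
    moreover have "u * u * u \<doteq> u" using eqv_trans[OF eqv_mult_left[OF uu] uu] .
    ultimately show "sum b I \<doteq> 0" using eqv_sym by (simp add: eqv_diff_iff)
  qed (rule ij)
  then have "u * e i * u \<doteq> 0" using ij by (simp add: b_def)
  moreover have "poly_star (e i * u) * (e i * u) \<doteq> u * e i * u"
    using eqv_mult_right[OF eqv_mult_left[OF ee[OF ij(1)], of u], of u] by (simp add: su se ij mult.assoc)
  ultimately have "(q (e i * u))\<^sup>2 = 0"
    using q_cstar[of "e i * u"] eqv_trans eqv_zero_iff by metis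
  then show ?thesis by (simp add: eqv_zero_iff u_def)
qed

end

section \<open>Paths and graph relations\<close>

text \<open>A path is a list of edges with an explicit start vertex, so that empty paths at
  different vertices stay distinct.\<close>

fun path_from :: "('v, 'e) pre_digraph \<Rightarrow> 'v \<Rightarrow> 'e list \<Rightarrow> bool" where
  "path_from E v [] = True"
| "path_from E v (e # p) = (e \<in> arcs E \<and> tail E e = v \<and> path_from E (head E e) p)"

fun path_end :: "('v, 'e) pre_digraph \<Rightarrow> 'v \<Rightarrow> 'e list \<Rightarrow> 'v" where
  "path_end E v [] = v"
| "path_end E v (e # p) = path_end E (head E e) p"

text \<open>The vertex projection at the end serves the empty path; after a nonempty path it is
  absorbed modulo the relations.\<close>

fun path_elt :: "('v, 'e) pre_digraph \<Rightarrow> 'v \<Rightarrow> 'e list \<Rightarrow> ('v, 'e) graph_gen star_poly" where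
  "path_elt E v [] = pP v"
| "path_elt E v (e # p) = pS e * path_elt E (head E e) p"

text \<open>These index the summands of \<open>pP v\<close> after \<open>n\<close> expansions by the
  Cuntz-Krieger relation, which stop at sinks.\<close>

definition full_paths :: "('v, 'e) pre_digraph \<Rightarrow> nat \<Rightarrow> 'v \<Rightarrow> 'e list set" where
  "full_paths E n v = {p. path_from E v p \<and> length p \<le> n \<and>
     (length p = n \<or> out_arcs E (path_end E v p) = {})}"

text \<open>The degree is the weight under the gauge action, see \<open>lookup_gauge\<close>. On
  paths it is the change of length caused by a letter.\<close>

fun letter_deg :: "('v, 'e) graph_gen \<times> bool \<Rightarrow> int" where
  "letter_deg (Vtx v, b) = 0"
| "letter_deg (Edg e, b) = (if b then -1 else 1)"

definition word_deg :: "('v, 'e) graph_gen star_word \<Rightarrow> int" where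
  "word_deg w = (\<Sum>a\<leftarrow>letters w. letter_deg a)"

lemma letter_deg_ge: "- 1 \<le> letter_deg a"
  by (cases a rule: letter_deg.cases) auto

lemma sum_letter_deg_ge: "- int (length l) \<le> (\<Sum>a\<leftarrow>l. letter_deg a)"
proof (induction l)
  case (Cons a l)
  then show ?case using letter_deg_ge[of a] by simp
qed simp

lemma full_paths_0: "full_paths E 0 v = {[]}"
  by (auto simp: full_paths_def)

lemma full_paths_Suc:
  "full_paths E (Suc n) v =
    (if out_arcs E v = {} then {[]} else (\<Union>e\<in>out_arcs E v. (#) e ` full_paths E n (head E e)))"
    (is "_ = ?R")
proof (intro set_eqI)
  fix p show "p \<in> full_paths E (Suc n) v \<longleftrightarrow> p \<in> ?R"
    by (cases p) (auto simp: full_paths_def)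
qed

lemma poly_scale_sum_left: "poly_scale (sum c A) x = (\<Sum>a\<in>A. poly_scale (c a) x)"
  by (induction A rule: infinite_finite_induct) (simp_all add: poly_scale_add_left)

lemma pP_free: "v \<in> verts E \<Longrightarrow> pP v \<in> free_star_algebra (graph_gens E)"
  by (rule free_gen) (simp add: graph_gens_def)

lemma pS_free: "e \<in> arcs E \<Longrightarrow> pS e \<in> free_star_algebra (graph_gens E)"
  by (rule free_gen) (simp add: graph_gens_def)

lemma path_elt_free:
  "wf_digraph E \<Longrightarrow> v \<in> verts E \<Longrightarrow> path_from E v p \<Longrightarrow> path_elt E v p \<in> free_star_algebra (graph_gens E)"
  by (induction p arbitrary: v) (auto intro: pP_free pS_free free_mult wf_digraph.head_in_verts)

lemma graph_rels_free:
  assumes "fin_digraph E"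
  shows "graph_rels E \<subseteq> free_star_algebra (graph_gens E)"
proof -
  interpret fin_digraph E by fact
  show ?thesis
    unfolding graph_rels_def
    by (auto intro!: free_diff free_mult free_star free_sum pP_free pS_free)
qed

lemma (in cseminorm) eqv_sum_delta:
  assumes "finite A" "a \<in> A" "f a \<doteq> x" "\<And>b. b \<in> A \<Longrightarrow> b \<noteq> a \<Longrightarrow> f b \<doteq> 0"
  shows "sum f A \<doteq> x"
proof -
  have "f a + sum f (A - {a}) \<doteq> x + 0"
    by (intro eqv_add assms(3) eqv_sum_zero) (use assms(4) in auto)
  then show ?thesis using assms by (simp add: sum.remove[of A a])
qed

text \<open>The seminorm is arbitrary because the results are needed for three kinds: for an
  admissible seminorm before the universal one is known to be finite, for the universal one, and for
  pullbacks along substitutions.\<close>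

locale graph_seminorm = cseminorm q
  for q :: "('v, 'e) graph_gen star_poly \<Rightarrow> real" +
  fixes E :: "('v, 'e) pre_digraph"
  assumes fin: "fin_digraph E"
    and rel: "r \<in> graph_rels E \<Longrightarrow> q r = 0"
begin

abbreviation "Fr \<equiv> free_star_algebra (graph_gens E)"

lemma finite_V: "finite (verts E)" and finite_out: "finite (out_arcs E v)"
  and head_V: "e \<in> arcs E \<Longrightarrow> head E e \<in> verts E"
  and tail_V: "e \<in> arcs E \<Longrightarrow> tail E e \<in> verts E"
  and wf: "wf_digraph E"
proof -
  interpret fin_digraph E by (rule fin)
  show "finite (verts E)" "finite (out_arcs E v)" "wf_digraph E"
    "e \<in> arcs E \<Longrightarrow> head E e \<in> verts E" "e \<in> arcs E \<Longrightarrow> tail E e \<in> verts E"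
    by (auto simp: wf_digraph_axioms)
qed

section \<open>Consequences of the graph relations\<close>

lemma P_star: "v \<in> verts E \<Longrightarrow> poly_star (pP v) \<doteq> pP v"
  unfolding eqv_def by (rule rel) (unfold graph_rels_def, blast)

lemma P_idem: "v \<in> verts E \<Longrightarrow> pP v * pP v \<doteq> pP v"
  unfolding eqv_def by (rule rel) (unfold graph_rels_def, blast)

lemma P_orth: "v \<in> verts E \<Longrightarrow> w \<in> verts E \<Longrightarrow> v \<noteq> w \<Longrightarrow> pP v * pP w \<doteq> 0"
  unfolding eqv_zero_iff by (rule rel) (unfold graph_rels_def, blast)

lemma S_partial: "e \<in> arcs E \<Longrightarrow> pS e * poly_star (pS e) * pS e \<doteq> pS e"
  unfolding eqv_def by (rule rel) (unfold graph_rels_def, blast)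

lemma S_source: "e \<in> arcs E \<Longrightarrow> poly_star (pS e) * pS e \<doteq> pP (head E e)"
  unfolding eqv_def by (rule rel) (unfold graph_rels_def, blast)

lemma CK: "v \<in> verts E \<Longrightarrow> out_arcs E v \<noteq> {} \<Longrightarrow>
    (\<Sum>e\<in>out_arcs E v. pS e * poly_star (pS e)) \<doteq> pP v"
  unfolding eqv_def by (rule rel) (unfold graph_rels_def, blast)

lemma qP: "v \<in> verts E \<Longrightarrow> q (pP v) \<le> 1"
  by (intro q_proj P_star P_idem)

lemma qS: "e \<in> arcs E \<Longrightarrow> q (pS e) \<le> 1"
proof -
  assume e: "e \<in> arcs E"
  have "(q (pS e))\<^sup>2 \<le> 1"
    using q_cstar[of "pS e"] eqv_q[OF S_source[OF e]] qP[OF head_V[OF e]] by simp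
  then show ?thesis using power2_le_imp_le[of _ 1] by simp
qed

text \<open>The range projections of the edges leaving a vertex sum to its vertex projection, so
  \<open>proj_sum_orthogonal\<close> applies.\<close>

lemma S_star_S_same_tail:
  assumes e: "e \<in> arcs E" and f: "f \<in> arcs E" and t: "tail E e = tail E f" and ne: "e \<noteq> f"
  shows "poly_star (pS e) * pS f \<doteq> 0"
proof -
  let ?I = "out_arcs E (tail E e)" and ?p = "\<lambda>e. pS e * poly_star (pS e)"
  have sum: "sum ?p ?I \<doteq> pP (tail E e)" using e by (intro CK tail_V) (auto simp: out_arcs_def)
  have o: "?p e * ?p f \<doteq> 0"
  proof (rule proj_sum_orthogonal[of ?I])
    show "?p i * ?p i \<doteq> ?p i" if "i \<in> ?I" for i
      using eqv_mult_left[OF S_partial[of i], of "poly_star (pS i)"] that by (simp add: mult.assoc)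
    show "sum ?p ?I * sum ?p ?I \<doteq> sum ?p ?I"
      using eqv_trans[OF eqv_mult[OF sum sum] eqv_trans[OF P_idem[OF tail_V[OF e]] eqv_sym[OF sum]]] .
  qed (use e f t ne finite_out in auto)
  have "poly_star (pS e) * pS f \<doteq> poly_star (pS e * poly_star (pS e) * pS e) * (pS f * poly_star (pS f) * pS f)"
    by (intro eqv_mult eqv_star eqv_sym[OF S_partial] e f)
  also have "\<dots> = poly_star (pS e) * (?p e * ?p f) * pS f" by (simp add: mult.assoc)
  also have "\<dots> \<doteq> poly_star (pS e) * 0 * pS f" by (intro eqv_mult eqv_refl o)
  finally show ?thesis by simp
qed

lemma P_S: assumes e: "e \<in> arcs E" shows "pP (tail E e) * pS e \<doteq> pS e"
proof -
  let ?I = "out_arcs E (tail E e)"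
  have e': "e \<in> ?I" using e by simp
  have "pP (tail E e) * pS e \<doteq> (\<Sum>f\<in>?I. pS f * poly_star (pS f)) * pS e"
    using e e' by (intro eqv_mult_left eqv_sym[OF CK] tail_V) auto
  also have "(\<Sum>f\<in>?I. pS f * poly_star (pS f)) * pS e = (\<Sum>f\<in>?I. pS f * (poly_star (pS f) * pS e))"
    by (simp add: sum_distrib_right mult.assoc)
  also have "\<dots> \<doteq> pS e"
  proof (rule eqv_sum_delta[OF finite_out e'])
    show "pS e * (poly_star (pS e) * pS e) \<doteq> pS e" using S_partial[OF e] by (simp add: mult.assoc)
    show "pS f * (poly_star (pS f) * pS e) \<doteq> 0" if "f \<in> ?I" "f \<noteq> e" for f
      using that e by (intro eqv_mult_zero(2) S_star_S_same_tail) auto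
  qed
  finally show ?thesis .
qed

lemma P_S_zero: assumes e: "e \<in> arcs E" "v \<in> verts E" "v \<noteq> tail E e" shows "pP v * pS e \<doteq> 0"
proof -
  have "pP v * pS e \<doteq> pP v * (pP (tail E e) * pS e)" by (intro eqv_mult_right eqv_sym[OF P_S] e)
  also have "\<dots> = (pP v * pP (tail E e)) * pS e" by (simp add: mult.assoc)
  also have "\<dots> \<doteq> 0" by (intro eqv_mult_zero(1) P_orth tail_V e)
  finally show ?thesis .
qed

lemma S_P: assumes e: "e \<in> arcs E" shows "pS e * pP (head E e) \<doteq> pS e"
  using eqv_trans[OF eqv_mult_right[OF eqv_sym[OF S_source[OF e]], of "pS e"]] S_partial[OF e]
  by (simp add: mult.assoc)

lemma S_P_zero: assumes e: "e \<in> arcs E" "v \<in> verts E" "v \<noteq> head E e" shows "pS e * pP v \<doteq> 0"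
proof -
  have "pS e * pP v \<doteq> (pS e * pP (head E e)) * pP v" by (intro eqv_mult_left eqv_sym[OF S_P] e)
  also have "\<dots> = pS e * (pP (head E e) * pP v)" by (simp add: mult.assoc)
  also have "\<dots> \<doteq> 0" by (intro eqv_mult_zero(2) P_orth head_V e) (use e in auto)
  finally show ?thesis .
qed

lemma S_star_S_zero:
  assumes e: "e \<in> arcs E" and f: "f \<in> arcs E" and ne: "e \<noteq> f"
  shows "poly_star (pS e) * pS f \<doteq> 0"
proof (cases "tail E e = tail E f")
  case False
  have "poly_star (pS e) * pS f \<doteq> poly_star (pP (tail E e) * pS e) * (pP (tail E f) * pS f)"
    by (intro eqv_mult eqv_star eqv_sym[OF P_S] e f)
  also have "\<dots> = poly_star (pS e) * ((poly_star (pP (tail E e)) * pP (tail E f)) * pS f)"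
    by (simp add: mult.assoc)
  also have "\<dots> \<doteq> poly_star (pS e) * ((pP (tail E e) * pP (tail E f)) * pS f)"
    by (intro eqv_mult_right eqv_mult_left P_star tail_V e)
  also have "\<dots> \<doteq> 0"
    by (intro eqv_mult_zero(2) eqv_mult_zero(1) P_orth tail_V e f False)
  finally show ?thesis .
qed (rule S_star_S_same_tail[OF e f _ ne])

lemma S_star_P_zero:
  assumes "e \<in> arcs E" "v \<in> verts E" "v \<noteq> tail E e" shows "poly_star (pS e) * pP v \<doteq> 0"
proof -
  have "poly_star (pS e) * pP v \<doteq> poly_star (pS e) * poly_star (pP v)"
    by (intro eqv_mult_right eqv_sym[OF P_star] assms)
  then show ?thesis using eqv_star[OF P_S_zero[OF assms]] by (simp add: eqv_trans)
qed

section \<open>Path elements and the action of words on them\<close>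

lemma path_end_V: "v \<in> verts E \<Longrightarrow> path_from E v p \<Longrightarrow> path_end E v p \<in> verts E"
  by (induction p arbitrary: v) (auto simp: head_V)

lemma P_path:
  assumes "v \<in> verts E" "path_from E v p" "w \<in> verts E"
  shows "pP w * path_elt E v p \<doteq> (if w = v then path_elt E v p else 0)"
proof (cases p)
  case Nil
  then show ?thesis using assms P_idem P_orth by simp
next
  case (Cons e p')
  show ?thesis
  proof (cases "w = v")
    case True
    then show ?thesis using Cons assms eqv_mult_left[OF P_S[of e]] by (simp add: mult.assoc[symmetric])
  next
    case False
    then show ?thesis using Cons assms eqv_mult_zero(1)[OF P_S_zero[of e w]] by (simp add: mult.assoc[symmetric])
  qed
qed

lemma path_P:
  "v \<in> verts E \<Longrightarrow> path_from E v p \<Longrightarrow> path_elt E v p * pP (path_end E v p) \<doteq> path_elt E v p"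
proof (induction p arbitrary: v)
  case Nil
  then show ?case by (simp add: P_idem)
next
  case (Cons e p)
  then show ?case using eqv_mult_right[OF Cons.IH[of "head E e"], of "pS e"] by (simp add: mult.assoc head_V)
qed

lemma q_path: "v \<in> verts E \<Longrightarrow> path_from E v p \<Longrightarrow> q (path_elt E v p) \<le> 1"
  by (induction p arbitrary: v) (auto intro!: qP q_mult_le1 qS head_V)

text \<open>The condition \<open>ne\<close> excludes the one bad case, an adjoint of an edge that
  meets the bare projection of a vertex emitting this edge: the product is then neither 0 nor a path
  element.\<close>

lemma letter_path:
  assumes a: "fst a \<in> graph_gens E" and v: "v \<in> verts E" and p: "path_from E v p"
    and ne: "p \<noteq> [] \<or> out_arcs E v = {}"
  shows "letter_val poly_gen a * path_elt E v p \<doteq> 0 \<or>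
    (\<exists>v' p'. v' \<in> verts E \<and> path_from E v' p' \<and> path_end E v' p' = path_end E v p \<and>
      int (length p') = int (length p) + letter_deg a \<and>
      letter_val poly_gen a * path_elt E v p \<doteq> path_elt E v' p')"
proof (cases a rule: letter_deg.cases)
  case (1 w b)
  then have w: "w \<in> verts E" using a by (auto simp: graph_gens_def)
  have "letter_val poly_gen a * path_elt E v p \<doteq> pP w * path_elt E v p"
    using 1 w by (intro eqv_mult_left) (auto simp: letter_val_def P_star)
  then have "letter_val poly_gen a * path_elt E v p \<doteq> (if w = v then path_elt E v p else 0)"
    using eqv_trans[OF _ P_path[OF v p w]] by simp
  then show ?thesis using v p 1 by (cases "w = v") auto
next
  case (2 e b)
  then have e: "e \<in> arcs E" using a by (auto simp: graph_gens_def)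
  show ?thesis
  proof (cases b)
    case False
    show ?thesis
    proof (cases "head E e = v")
      case True
      then show ?thesis using e p 2 False
        by (intro disjI2 exI[of _ "tail E e"] exI[of _ "e # p"]) (auto simp: letter_val_def tail_V)
    next
      case ne: False
      have "pS e * path_elt E v p \<doteq> pS e * (pP v * path_elt E v p)"
        using eqv_sym[OF P_path[OF v p v]] by (intro eqv_mult_right) simp
      also have "\<dots> = (pS e * pP v) * path_elt E v p" by (simp add: mult.assoc)
      also have "\<dots> \<doteq> 0" using ne by (intro eqv_mult_zero(1) S_P_zero e v) auto
      finally show ?thesis using 2 False by (simp add: letter_val_def)
    qed
  next
    case True
    show ?thesis
    proof (cases p)
      case Nil
      then have "v \<noteq> tail E e" using ne e by (auto simp: out_arcs_def)
      then show ?thesis using Nil S_star_P_zero[OF e v] 2 True by (simp add: letter_val_def)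
    next
      case (Cons f p')
      then have f: "f \<in> arcs E" "tail E f = v" "path_from E (head E f) p'" using p by auto
      show ?thesis
      proof (cases "e = f")
        case False
        then have "poly_star (pS e) * (pS f * path_elt E (head E f) p') \<doteq> 0"
          using eqv_mult_zero(1)[OF S_star_S_zero[OF e f(1)]] by (simp add: mult.assoc[symmetric])
        then show ?thesis using Cons 2 True by (simp add: letter_val_def)
      next
        case ef: True
        have "poly_star (pS e) * (pS f * path_elt E (head E f) p') \<doteq> pP (head E f) * path_elt E (head E f) p'"
          using eqv_mult_left[OF S_source[OF f(1)]] by (simp add: mult.assoc[symmetric] ef)
        then have "poly_star (pS e) * (pS f * path_elt E (head E f) p') \<doteq> path_elt E (head E f) p'"
          using eqv_trans[OF _ P_path[OF head_V[OF f(1)] f(3) head_V[OF f(1)]]] by simp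
        then show ?thesis using Cons 2 True f
          by (intro disjI2 exI[of _ "head E f"] exI[of _ p']) (simp add: letter_val_def head_V)
      qed
    qed
  qed
qed

text \<open>Letters act from the last to the first, and each removes at most one edge. A word no
  longer than the path therefore never runs past its end; if the path ends in a sink, running past
  the end gives 0.\<close>

lemma letters_path:
  assumes l: "fst ` set l \<subseteq> graph_gens E" and v: "v \<in> verts E" and p: "path_from E v p"
    and n: "length l \<le> length p \<or> out_arcs E (path_end E v p) = {}"
  shows "prod_list (map (letter_val poly_gen) l) * path_elt E v p \<doteq> 0 \<or>
    (\<exists>v' p'. v' \<in> verts E \<and> path_from E v' p' \<and> path_end E v' p' = path_end E v p \<and>
      int (length p') = int (length p) + (\<Sum>a\<leftarrow>l. letter_deg a) \<and>
      prod_list (map (letter_val poly_gen) l) * path_elt E v p \<doteq> path_elt E v' p')"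
  using l n
proof (induction l)
  case Nil
  then show ?case using v p by (intro disjI2 exI[of _ v] exI[of _ p]) simp
next
  case (Cons a l)
  let ?W = "prod_list (map (letter_val poly_gen) l)" and ?a = "letter_val poly_gen a"
  have IH: "?W * path_elt E v p \<doteq> 0 \<or>
    (\<exists>v' p'. v' \<in> verts E \<and> path_from E v' p' \<and> path_end E v' p' = path_end E v p \<and>
      int (length p') = int (length p) + (\<Sum>a\<leftarrow>l. letter_deg a) \<and>
      ?W * path_elt E v p \<doteq> path_elt E v' p')"
    using Cons by auto
  show ?case
  proof (rule disjE[OF IH])
    assume "?W * path_elt E v p \<doteq> 0"
    then have "?a * (?W * path_elt E v p) \<doteq> 0" by (rule eqv_mult_zero(2))
    then show ?thesis by (simp add: mult.assoc)
  next
    assume "\<exists>v' p'. v' \<in> verts E \<and> path_from E v' p' \<and> path_end E v' p' = path_end E v p \<and>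
      int (length p') = int (length p) + (\<Sum>a\<leftarrow>l. letter_deg a) \<and>
      ?W * path_elt E v p \<doteq> path_elt E v' p'"
    then obtain v' p' where v': "v' \<in> verts E" "path_from E v' p'" "path_end E v' p' = path_end E v p"
      "int (length p') = int (length p) + (\<Sum>a\<leftarrow>l. letter_deg a)"
      "?W * path_elt E v p \<doteq> path_elt E v' p'" by blast
    \<comment> \<open>Either an edge is still left for the next letter, or \<open>p'\<close> is
      empty and \<open>v'\<close> is the end of the original path, a sink.\<close>
    have ne: "p' \<noteq> [] \<or> out_arcs E v' = {}"
      using Cons.prems(2) v'(3,4) sum_letter_deg_ge[of l] by (cases p') auto
    have a: "fst a \<in> graph_gens E" using Cons.prems by auto
    have eq: "prod_list (map (letter_val poly_gen) (a # l)) * path_elt E v p \<doteq> ?a * path_elt E v' p'"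
      using eqv_mult_right[OF v'(5), of ?a] by (simp add: mult.assoc)
    from letter_path[OF a v'(1,2) ne] show ?thesis
    proof (elim disjE exE conjE)
      assume "?a * path_elt E v' p' \<doteq> 0"
      then show ?thesis using eqv_trans[OF eq] by blast
    next
      fix v'' p'' assume *: "v'' \<in> verts E" "path_from E v'' p''" "path_end E v'' p'' = path_end E v' p'"
        "int (length p'') = int (length p') + letter_deg a" "?a * path_elt E v' p' \<doteq> path_elt E v'' p''"
      show ?thesis
        using *(1-4) v'(3,4) eqv_trans[OF eq *(5)]
        by (intro disjI2 exI[of _ v''] exI[of _ p'']) simp
    qed
  qed
qed

lemma finite_full_paths: "finite (full_paths E n v)"
  by (induction n arbitrary: v) (auto simp: full_paths_0 full_paths_Suc finite_out)

text \<open>A full path of less than full length ends in a sink and cannot be prolonged, so no full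
  path is a proper prefix of another. Two different ones from the same vertex separate at some edge,
  where edge orthogonality gives 0.\<close>

lemma path_star_path:
  assumes "v \<in> verts E" "w \<in> verts E" "p \<in> full_paths E n v" "r \<in> full_paths E n w"
  shows "poly_star (path_elt E v p) * path_elt E w r \<doteq>
    (if v = w \<and> p = r then pP (path_end E v p) else 0)"
  using assms
proof (induction n arbitrary: v w p r)
  case 0
  have "poly_star (pP v) * pP w \<doteq> pP v * pP w" by (intro eqv_mult_left P_star 0)
  moreover have "pP v * pP w \<doteq> (if v = w then pP v else 0)" using 0 P_idem[of v] P_orth[of v w] by (cases "v = w") simp_all
  ultimately have "poly_star (pP v) * pP w \<doteq> (if v = w then pP v else 0)" by (rule eqv_trans)
  then show ?case using 0 by (cases "v = w") (simp_all add: full_paths_0)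
next
  case (Suc n)
  show ?case
  proof (cases p)
    case Nil
    then have sv: "out_arcs E v = {}" using Suc by (auto simp: full_paths_Suc split: if_splits)
    have "poly_star (pP v) * path_elt E w r \<doteq> pP v * path_elt E w r" by (intro eqv_mult_left P_star Suc)
    moreover have "pP v * path_elt E w r \<doteq> (if v = w then path_elt E w r else 0)"
      using Suc by (intro P_path) (auto simp: full_paths_def)
    moreover have "r = []" if "v = w" using Suc(5) sv that by (auto simp: full_paths_Suc)
    ultimately show ?thesis using Nil eqv_trans[of "poly_star (pP v) * path_elt E w r" "pP v * path_elt E w r"]
      by (cases "v = w") auto
  next
    case (Cons e p')
    then have e: "e \<in> arcs E" "tail E e = v" "p' \<in> full_paths E n (head E e)"
      using Suc.prems by (auto simp: full_paths_Suc split: if_splits)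
    show ?thesis
    proof (cases r)
      case Nil
      then have "out_arcs E w = {}" using Suc by (auto simp: full_paths_Suc split: if_splits)
      then have "w \<noteq> tail E e" using e by (auto simp: out_arcs_def)
      then have "poly_star (path_elt E (head E e) p') * (poly_star (pS e) * pP w) \<doteq> 0"
        by (intro eqv_mult_zero(2) S_star_P_zero Suc e)
      then show ?thesis using Nil Cons by (simp add: mult.assoc)
    next
      case Cr: (Cons f r')
      then have f: "f \<in> arcs E" "tail E f = w" "r' \<in> full_paths E n (head E f)"
        using Suc.prems by (auto simp: full_paths_Suc split: if_splits)
      have assoc: "poly_star (path_elt E v p) * path_elt E w r =
          poly_star (path_elt E (head E e) p') * ((poly_star (pS e) * pS f) * path_elt E (head E f) r')"
        by (simp add: Cons Cr mult.assoc)
      show ?thesis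
      proof (cases "e = f")
        case False
        then have "poly_star (path_elt E v p) * path_elt E w r \<doteq> 0"
          unfolding assoc by (intro eqv_mult_zero(2) eqv_mult_zero(1) S_star_S_zero e f)
        then show ?thesis using False Cons Cr by simp
      next
        case True
        have "poly_star (path_elt E v p) * path_elt E w r \<doteq>
            poly_star (path_elt E (head E e) p') * (pP (head E e) * path_elt E (head E f) r')"
          unfolding assoc True by (intro eqv_mult_right eqv_mult_left S_source f)
        also have "\<dots> \<doteq> poly_star (path_elt E (head E e) p') * path_elt E (head E f) r'"
          using P_path[of "head E f" r' "head E e"] f head_V[OF f(1)] True
          by (intro eqv_mult_right) (auto simp: full_paths_def)
        also have "\<dots> \<doteq> (if head E e = head E f \<and> p' = r' then pP (path_end E (head E e) p') else 0)"
          by (intro Suc.IH head_V e f)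
        finally show ?thesis using True Cons Cr e f by auto
      qed
    qed
  qed
qed

lemma sum_paths: "v \<in> verts E \<Longrightarrow>
  (\<Sum>p\<in>full_paths E n v. path_elt E v p * poly_star (path_elt E v p)) \<doteq> pP v"
proof (induction n arbitrary: v)
  case 0
  have "pP v * poly_star (pP v) \<doteq> pP v * pP v" by (intro eqv_mult_right P_star 0)
  then show ?case using eqv_trans[OF _ P_idem[OF 0]] by (simp add: full_paths_0)
next
  case (Suc n)
  show ?case
  proof (cases "out_arcs E v = {}")
    case True
    have "pP v * poly_star (pP v) \<doteq> pP v * pP v" by (intro eqv_mult_right P_star Suc)
    then show ?thesis using eqv_trans[OF _ P_idem[OF Suc(2)]] True by (simp add: full_paths_Suc)
  next
    case False
    let ?t = "\<lambda>p. path_elt E v p * poly_star (path_elt E v p)"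
    have "(\<Sum>p\<in>full_paths E (Suc n) v. ?t p) =
        (\<Sum>e\<in>out_arcs E v. \<Sum>p\<in>(#) e ` full_paths E n (head E e). ?t p)"
      unfolding full_paths_Suc if_not_P[OF False]
      by (rule sum.UNION_disjoint) (auto simp: finite_out finite_full_paths)
    also have "\<dots> = (\<Sum>e\<in>out_arcs E v. pS e * (\<Sum>p\<in>full_paths E n (head E e).
        path_elt E (head E e) p * poly_star (path_elt E (head E e) p)) * poly_star (pS e))"
      by (intro sum.cong refl, subst sum.reindex)
        (auto simp: sum_distrib_left sum_distrib_right mult.assoc)
    also have "\<dots> \<doteq> (\<Sum>e\<in>out_arcs E v. pS e * pP (head E e) * poly_star (pS e))"
      by (intro eqv_sum eqv_mult_left eqv_mult_right Suc.IH head_V) auto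
    also have "\<dots> \<doteq> (\<Sum>e\<in>out_arcs E v. pS e * poly_star (pS e))"
      by (intro eqv_sum eqv_mult_left S_P) auto
    also have "\<dots> \<doteq> pP v" by (intro CK Suc False)
    finally show ?thesis .
  qed
qed

text \<open>Modulo the relations the graph algebra has this unit. It has to be distinguished from
  the 1 of the polynomial ring, which is the empty word.\<close>

lemma unit_left_right:
  assumes "x \<in> Fr"
  shows "sum pP (verts E) * x \<doteq> x \<and> x * sum pP (verts E) \<doteq> x"
proof -
  let ?u = "sum pP (verts E)"
  have su: "poly_star ?u \<doteq> ?u" unfolding poly_star_sum by (intro eqv_sum P_star)
  from assms show ?thesis
  proof (induction rule: free_induct)
    case zero
    then show ?case by simp
  next
    case (gen g)
    show ?case
    proof (cases g)
      case (Vtx v)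
      then have v: "v \<in> verts E" using gen by (auto simp: graph_gens_def)
      show ?thesis unfolding Vtx sum_distrib_left sum_distrib_right
        using v by (intro conjI eqv_sum_delta[OF finite_V v] P_idem P_orth) auto
    next
      case (Edg e)
      then have e: "e \<in> arcs E" using gen by (auto simp: graph_gens_def)
      show ?thesis unfolding Edg sum_distrib_left sum_distrib_right
        using eqv_sum_delta[OF finite_V tail_V[OF e], of "\<lambda>v. pP v * pS e" "pS e"]
          eqv_sum_delta[OF finite_V head_V[OF e], of "\<lambda>v. pS e * pP v" "pS e"]
        by (simp add: P_S P_S_zero S_P S_P_zero e)
    qed
  next
    case (star x)
    have "poly_star (poly_star ?u * poly_star x) \<doteq> x" "poly_star (poly_star x * poly_star ?u) \<doteq> x"
      using star by simp_all
    then have "poly_star ?u * poly_star x \<doteq> poly_star x" "poly_star x * poly_star ?u \<doteq> poly_star x"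
      using eqv_star by fastforce+
    then show ?case using eqv_mult_left[OF eqv_sym[OF su]] eqv_mult_right[OF eqv_sym[OF su]] eqv_trans by blast
  next
    case (add x y)
    then show ?case by (simp add: distrib_left distrib_right eqv_add)
  next
    case (scale c x)
    then show ?case by (simp add: poly_scale_mult_left poly_scale_mult_right eqv_scale)
  next
    case (mult x y)
    then show ?case using eqv_mult_left[of "?u * x" x y] eqv_mult_right[of "y * ?u" y x] by (simp add: mult.assoc)
  qed
qed

section \<open>Matrix units of a given level\<close>

definition paths :: "nat \<Rightarrow> ('v \<times> 'e list) set" where
  "paths n = Sigma (verts E) (full_paths E n)"

abbreviation "sp a \<equiv> path_elt E (fst a) (snd a)"
abbreviation "pe a \<equiv> path_end E (fst a) (snd a)"

lemma pathsD: "a \<in> paths n \<Longrightarrow> fst a \<in> verts E \<and> path_from E (fst a) (snd a) \<and> snd a \<in> full_paths E n (fst a)"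
  by (cases a) (simp add: paths_def full_paths_def)

lemma paths_orth: "a \<in> paths n \<Longrightarrow> b \<in> paths n \<Longrightarrow>
    poly_star (sp a) * sp b \<doteq> (if a = b then pP (pe a) else 0)"
  using path_star_path[of "fst a" "fst b" "snd a" n "snd b"] pathsD[of a n] pathsD[of b n]
  by (simp add: prod_eq_iff)

lemma paths_unit: "(\<Sum>a\<in>paths n. sp a * poly_star (sp a)) \<doteq> sum pP (verts E)"
proof -
  have "(\<Sum>a\<in>paths n. sp a * poly_star (sp a)) =
      (\<Sum>v\<in>verts E. \<Sum>p\<in>full_paths E n v. path_elt E v p * poly_star (path_elt E v p))"
    unfolding paths_def by (subst sum.Sigma) (auto simp: finite_V finite_full_paths case_prod_beta)
  also have "\<dots> \<doteq> sum pP (verts E)" by (intro eqv_sum sum_paths)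
  finally show ?thesis .
qed

lemma paths_unit_left: "x \<in> Fr \<Longrightarrow> (\<Sum>a\<in>paths n. sp a * (poly_star (sp a) * x)) \<doteq> x"
  using eqv_trans[OF eqv_mult_left[OF paths_unit]] unit_left_right[of x]
  by (simp add: sum_distrib_right mult.assoc)

lemma paths_unit_right: "x \<in> Fr \<Longrightarrow> (\<Sum>b\<in>paths n. x * sp b * poly_star (sp b)) \<doteq> x"
  using eqv_trans[OF eqv_mult_right[OF paths_unit]] unit_left_right[of x]
  by (simp add: sum_distrib_left mult.assoc)

text \<open>Modulo the seminorm this is the finite-dimensional algebra spanned by the matrix units
  \<open>S\<^sub>a S\<^sub>b\<^sup>*\<close> with \<open>a\<close>, \<open>b\<close> of level \<open>n\<close>, described without choosing coefficients.\<close>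

definition matrix_level :: "nat \<Rightarrow> ('v, 'e) graph_gen star_poly set" where
  "matrix_level n = {x \<in> Fr. \<forall>a\<in>paths n. \<forall>b\<in>paths n. \<exists>c. poly_star (sp a) * x * sp b \<doteq> poly_scale c (pP (pe a)) \<and>
      (c = 0 \<or> pe a = pe b)}"

lemma matrix_level_zero: "0 \<in> matrix_level n"
  by (auto simp: matrix_level_def intro!: exI[of _ 0])

lemma matrix_level_scale: assumes x: "x \<in> matrix_level n" shows "poly_scale d x \<in> matrix_level n"
  unfolding matrix_level_def
proof (clarsimp, intro conjI ballI)
  show "poly_scale d x \<in> Fr" using x by (auto simp: matrix_level_def)
  fix a b assume ab: "a \<in> paths n" "b \<in> paths n"
  then obtain c where c: "poly_star (sp a) * x * sp b \<doteq> poly_scale c (pP (pe a))" "c = 0 \<or> pe a = pe b"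
    using x by (auto simp: matrix_level_def)
  show "\<exists>c. poly_star (sp a) * poly_scale d x * sp b \<doteq> poly_scale c (pP (pe a)) \<and> (c = 0 \<or> pe a = pe b)"
    using eqv_scale[OF c(1), of d] c(2)
    by (intro exI[of _ "d * c"]) (simp add: poly_scale_mult_left poly_scale_mult_right)
qed

lemma matrix_level_add: assumes x: "x \<in> matrix_level n" and y: "y \<in> matrix_level n"
  shows "x + y \<in> matrix_level n"
  unfolding matrix_level_def
proof (clarsimp, intro conjI ballI)
  show "x + y \<in> Fr" using x y by (auto simp: matrix_level_def)
  fix a b assume ab: "a \<in> paths n" "b \<in> paths n"
  then obtain c where c: "poly_star (sp a) * x * sp b \<doteq> poly_scale c (pP (pe a))" "c = 0 \<or> pe a = pe b"
    using x by (auto simp: matrix_level_def)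
  obtain d where d: "poly_star (sp a) * y * sp b \<doteq> poly_scale d (pP (pe a))" "d = 0 \<or> pe a = pe b"
    using y ab by (auto simp: matrix_level_def)
  show "\<exists>c. poly_star (sp a) * (x + y) * sp b \<doteq> poly_scale c (pP (pe a)) \<and> (c = 0 \<or> pe a = pe b)"
    using eqv_add[OF c(1) d(1)] c(2) d(2)
    by (intro exI[of _ "c + d"]) (auto simp: distrib_left distrib_right poly_scale_add_left)
qed

lemma matrix_level_star: assumes x: "x \<in> matrix_level n" shows "poly_star x \<in> matrix_level n"
  unfolding matrix_level_def
proof (clarsimp, intro conjI ballI)
  show "poly_star x \<in> Fr" using x by (auto simp: matrix_level_def)
  fix a b assume ab: "a \<in> paths n" "b \<in> paths n"
  then obtain c where c: "poly_star (sp b) * x * sp a \<doteq> poly_scale c (pP (pe b))" "c = 0 \<or> pe b = pe a"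
    using x by (auto simp: matrix_level_def)
  have "poly_star (sp a) * poly_star x * sp b \<doteq> poly_scale (cnj c) (poly_star (pP (pe b)))"
    using eqv_star[OF c(1)] by (simp add: mult.assoc)
  also have "\<dots> \<doteq> poly_scale (cnj c) (pP (pe b))"
    using pathsD[OF ab(2)] by (intro eqv_scale P_star path_end_V) auto
  also have "\<dots> = poly_scale (cnj c) (pP (pe a))" using c(2) by auto
  finally show "\<exists>c. poly_star (sp a) * poly_star x * sp b \<doteq> poly_scale c (pP (pe a)) \<and> (c = 0 \<or> pe a = pe b)"
    using c(2) by (intro exI[of _ "cnj c"]) auto
qed

text \<open>Inserting the unit as the sum over level \<open>n\<close> between the factors turns this
  into multiplication of the coefficient matrices. Coefficients for paths with different ends are 0,
  which makes the products of vertex projections harmless.\<close>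

lemma matrix_level_mult: assumes x: "x \<in> matrix_level n" and y: "y \<in> matrix_level n"
  shows "x * y \<in> matrix_level n"
  unfolding matrix_level_def
proof (clarsimp, intro conjI ballI)
  have F: "x \<in> Fr" "y \<in> Fr" using x y by (auto simp: matrix_level_def)
  then show "x * y \<in> Fr" by auto
  fix a b assume ab: "a \<in> paths n" "b \<in> paths n"
  have "\<forall>d\<in>paths n. \<exists>c. poly_star (sp a) * x * sp d \<doteq> poly_scale c (pP (pe a)) \<and> (c = 0 \<or> pe a = pe d)"
    using x ab by (auto simp: matrix_level_def)
  then obtain c where c: "\<And>d. d \<in> paths n \<Longrightarrow> poly_star (sp a) * x * sp d \<doteq> poly_scale (c d) (pP (pe a))"
     "\<And>d. d \<in> paths n \<Longrightarrow> c d = 0 \<or> pe a = pe d" by metis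
  have "\<forall>d\<in>paths n. \<exists>c. poly_star (sp d) * y * sp b \<doteq> poly_scale c (pP (pe d)) \<and> (c = 0 \<or> pe d = pe b)"
    using y ab by (auto simp: matrix_level_def)
  then obtain c' where c': "\<And>d. d \<in> paths n \<Longrightarrow> poly_star (sp d) * y * sp b \<doteq> poly_scale (c' d) (pP (pe d))"
     "\<And>d. d \<in> paths n \<Longrightarrow> c' d = 0 \<or> pe d = pe b" by metis
  have "poly_star (sp a) * (x * y) * sp b \<doteq> poly_star (sp a) * (x * (\<Sum>d\<in>paths n. sp d * (poly_star (sp d) * y))) * sp b"
    by (intro eqv_mult_left eqv_mult_right eqv_sym[OF paths_unit_left] F)
  also have "\<dots> = (\<Sum>d\<in>paths n. (poly_star (sp a) * x * sp d) * (poly_star (sp d) * y * sp b))"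
    by (simp add: sum_distrib_left sum_distrib_right mult.assoc)
  also have "\<dots> \<doteq> (\<Sum>d\<in>paths n. poly_scale (c d) (pP (pe a)) * poly_scale (c' d) (pP (pe d)))"
    by (intro eqv_sum eqv_mult c(1) c'(1))
  also have "\<dots> \<doteq> (\<Sum>d\<in>paths n. poly_scale (c d * c' d) (pP (pe a)))"
  proof (rule eqv_sum)
    fix d assume d: "d \<in> paths n"
    show "poly_scale (c d) (pP (pe a)) * poly_scale (c' d) (pP (pe d)) \<doteq> poly_scale (c d * c' d) (pP (pe a))"
    proof (cases "c d = 0")
      case False
      then have "pe a = pe d" using c(2)[OF d] by simp
      moreover have "pP (pe a) * pP (pe a) \<doteq> pP (pe a)"
        using pathsD[OF ab(1)] by (intro P_idem path_end_V) auto
      ultimately show ?thesis by (simp add: poly_scale_mult_left poly_scale_mult_right eqv_scale mult.commute)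
    qed simp
  qed
  also have "\<dots> = poly_scale (\<Sum>d\<in>paths n. c d * c' d) (pP (pe a))"
    by (simp add: poly_scale_sum_left)
  finally have "poly_star (sp a) * (x * y) * sp b \<doteq> poly_scale (\<Sum>d\<in>paths n. c d * c' d) (pP (pe a))" .
  moreover have "(\<Sum>d\<in>paths n. c d * c' d) = 0 \<or> pe a = pe b"
  proof (cases "pe a = pe b")
    case False
    then have "c d * c' d = 0" if "d \<in> paths n" for d using c(2)[OF that] c'(2)[OF that] by auto
    then show ?thesis by (simp add: sum.neutral)
  qed simp
  ultimately show "\<exists>c. poly_star (sp a) * (x * y) * sp b \<doteq> poly_scale c (pP (pe a)) \<and> (c = 0 \<or> pe a = pe b)"
    by blast
qed

text \<open>The bound on the length keeps the word from exhausting a path of length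
  \<open>n\<close>. Degree 0 preserves the length and every word preserves the end, so a path of the
  level is sent to 0 or to another path of the same level.\<close>

lemma matrix_level_word:
  assumes w: "letters w \<noteq> []" "fst ` set (letters w) \<subseteq> graph_gens E" and deg: "word_deg w = 0"
    and n: "length (letters w) \<le> n"
  shows "word_val poly_gen w \<in> matrix_level n"
  unfolding matrix_level_def
proof (clarsimp, intro conjI ballI)
  show "word_val poly_gen w \<in> Fr" using w by (intro word_val_free[of "graph_gens E"]) auto
  fix a b assume ab: "a \<in> paths n" "b \<in> paths n"
  have b: "fst b \<in> verts E" "path_from E (fst b) (snd b)" "length (snd b) \<le> n"
    "length (snd b) = n \<or> out_arcs E (pe b) = {}"
    using pathsD[OF ab(2)] by (simp_all add: full_paths_def)
  have len: "length (letters w) \<le> length (snd b) \<or> out_arcs E (pe b) = {}" using b n by auto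
  from letters_path[OF w(2) b(1,2) len]
  show "\<exists>c. poly_star (sp a) * word_val poly_gen w * sp b \<doteq> poly_scale c (pP (pe a)) \<and> (c = 0 \<or> pe a = pe b)"
  proof (elim disjE exE conjE)
    assume "prod_list (map (letter_val poly_gen) (letters w)) * sp b \<doteq> 0"
    then have "poly_star (sp a) * word_val poly_gen w * sp b \<doteq> 0"
      using eqv_mult_zero(2) by (simp add: word_val_def mult.assoc)
    then show ?thesis by (intro exI[of _ 0]) simp
  next
    fix v' p' assume v': "v' \<in> verts E" "path_from E v' p'" "path_end E v' p' = pe b"
      "int (length p') = int (length (snd b)) + (\<Sum>a\<leftarrow>letters w. letter_deg a)"
      "prod_list (map (letter_val poly_gen) (letters w)) * sp b \<doteq> path_elt E v' p'"
    have "length p' = length (snd b)" using v'(4) deg by (simp add: word_deg_def)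
    then have b': "(v', p') \<in> paths n" using v'(1-3) b(3,4) by (simp add: paths_def full_paths_def)
    have "poly_star (sp a) * word_val poly_gen w * sp b \<doteq> poly_star (sp a) * sp (v', p')"
      using eqv_mult_right[OF v'(5)] by (simp add: word_val_def mult.assoc)
    also have "\<dots> \<doteq> (if a = (v', p') then pP (pe a) else 0)" by (rule paths_orth[OF ab(1) b'])
    also have "\<dots> = poly_scale (if a = (v', p') then 1 else 0) (pP (pe a))" by simp
    finally show ?thesis using v'(3) by (intro exI[of _ "if a = (v', p') then 1 else 0"]) auto
  qed
qed

lemma matrix_level_deg_zero:
  assumes x: "x \<in> Fr" and deg: "\<And>w. w \<in> Poly_Mapping.keys x \<Longrightarrow> word_deg w = 0"
  shows "\<exists>n. x \<in> matrix_level n"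
proof -
  obtain n where n: "\<And>w. w \<in> Poly_Mapping.keys x \<Longrightarrow> length (letters w) \<le> n"
    using finite_nat_set_iff_bounded_le[of "(\<lambda>w. length (letters w)) ` Poly_Mapping.keys x"] by auto
  have "finite K \<Longrightarrow> K \<subseteq> Poly_Mapping.keys x \<Longrightarrow>
      (\<Sum>w\<in>K. poly_scale (Poly_Mapping.lookup x w) (word_val poly_gen w)) \<in> matrix_level n" for K
  proof (induction K rule: finite_induct)
    case empty
    then show ?case by (simp add: matrix_level_zero)
  next
    case (insert w K)
    have "word_val poly_gen w \<in> matrix_level n"
      using insert x deg[of w] n[of w] by (intro matrix_level_word) (auto simp: free_star_algebra_def)
    then show ?case using insert by (simp add: matrix_level_add matrix_level_scale)
  qed
  from this[of "Poly_Mapping.keys x"] have "subst poly_gen x \<in> matrix_level n" by (simp add: subst_def)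
  then show ?thesis by auto
qed

end

subsection \<open>Uniqueness on the fixed-point algebra\<close>

text \<open>Two seminorms are equivalent on each matrix level, and the C*-identity removes the constant.\<close>

lemma deg_zero_seminorm_unique:
  assumes 1: "graph_seminorm q1 E" and 2: "graph_seminorm q2 E"
    and le: "\<And>x. x \<in> free_star_algebra (graph_gens E) \<Longrightarrow> q2 x \<le> q1 x"
    and P: "\<And>v. v \<in> verts E \<Longrightarrow> q1 (pP v) \<le> q2 (pP v)"
    and x: "x \<in> free_star_algebra (graph_gens E)"
    and deg: "\<And>w. w \<in> Poly_Mapping.keys x \<Longrightarrow> word_deg w = 0"
  shows "q1 x = q2 x"
proof -
  interpret A: graph_seminorm q1 E by fact
  interpret B: graph_seminorm q2 E by fact
  obtain n where n: "x \<in> A.matrix_level n" using A.matrix_level_deg_zero[OF x deg] by blast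
  \<comment> \<open>The number of matrix entries; each contributes at most \<open>q2 y\<close> to
    \<open>q1 y\<close>.\<close>
  define M where "M = (real (card (A.paths n)))\<^sup>2"
  have spF: "A.sp a \<in> A.Fr" if "a \<in> A.paths n" for a
    using A.pathsD[OF that] path_elt_free[OF A.wf] by blast
  have bound: "q1 y \<le> M * q2 y" if y: "y \<in> A.matrix_level n" for y
  proof -
    have yF: "y \<in> A.Fr" using y by (simp add: A.matrix_level_def)
    have entry: "q1 (poly_star (A.sp a) * y * A.sp b) \<le> q2 y" if ab: "a \<in> A.paths n" "b \<in> A.paths n" for a b
    proof -
      obtain c where c: "A.eqv (poly_star (A.sp a) * y * A.sp b) (poly_scale c (pP (A.pe a)))"
        using y ab by (auto simp: A.matrix_level_def)
      have pv: "A.pe a \<in> verts E" using A.pathsD[OF ab(1)] A.path_end_V by blast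
      \<comment> \<open>Domination of \<open>q2\<close> by \<open>q1\<close> makes the coefficient
        \<open>c\<close> valid for both seminorms, so they only have to be compared on one vertex
        projection.\<close>
      have "poly_star (A.sp a) * y * A.sp b - poly_scale c (pP (A.pe a)) \<in> A.Fr"
        by (intro free_diff free_mult free_star free_scale spF ab yF pP_free pv)
      from le[OF this] have c2: "B.eqv (poly_star (A.sp a) * y * A.sp b) (poly_scale c (pP (A.pe a)))"
        using c B.q_nonneg by (simp add: A.eqv_def B.eqv_def antisym)
      have "q1 (poly_star (A.sp a) * y * A.sp b) = cmod c * q1 (pP (A.pe a))"
        using A.eqv_q[OF c] by (simp add: A.q_scale)
      also have "\<dots> \<le> cmod c * q2 (pP (A.pe a))" by (intro mult_left_mono P pv) simp
      also have "\<dots> = q2 (poly_star (A.sp a) * y * A.sp b)"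
        using B.eqv_q[OF c2] by (simp add: B.q_scale)
      also have "\<dots> \<le> (q2 (A.sp a) * q2 y) * q2 (A.sp b)"
        by (rule order_trans[OF B.q_mult mult_right_mono[OF order_trans[OF B.q_mult] B.q_nonneg]]) simp
      also have "\<dots> \<le> (1 * q2 y) * 1"
        using A.pathsD[OF ab(1)] A.pathsD[OF ab(2)]
        by (intro mult_mono mult_right_mono B.q_path) simp_all
      finally show ?thesis by simp
    qed
    let ?z = "\<Sum>a\<in>A.paths n. A.sp a * (poly_star (A.sp a) * (\<Sum>b\<in>A.paths n. y * A.sp b * poly_star (A.sp b)))"
    have "A.eqv ?z (\<Sum>a\<in>A.paths n. A.sp a * (poly_star (A.sp a) * y))"
      by (intro A.eqv_sum A.eqv_mult_right A.paths_unit_right yF)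
    then have z: "A.eqv ?z y" using A.eqv_trans A.paths_unit_left[OF yF] by blast
    have "?z = (\<Sum>a\<in>A.paths n. \<Sum>b\<in>A.paths n. A.sp a * (poly_star (A.sp a) * y * A.sp b) * poly_star (A.sp b))"
      by (simp add: sum_distrib_left mult.assoc)
    then have "q1 y = q1 (\<Sum>a\<in>A.paths n. \<Sum>b\<in>A.paths n. A.sp a * (poly_star (A.sp a) * y * A.sp b) * poly_star (A.sp b))"
      using A.eqv_q[OF z] by simp
    also have "\<dots> \<le> (\<Sum>a\<in>A.paths n. \<Sum>b\<in>A.paths n. q1 (A.sp a * (poly_star (A.sp a) * y * A.sp b) * poly_star (A.sp b)))"
      by (rule order_trans[OF A.q_sum sum_mono[OF A.q_sum]])
    also have "\<dots> \<le> (\<Sum>a\<in>A.paths n. \<Sum>b\<in>A.paths n. q2 y)"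
    proof (intro sum_mono)
      fix a b assume ab: "a \<in> A.paths n" "b \<in> A.paths n"
      have "q1 (A.sp a * (poly_star (A.sp a) * y * A.sp b) * poly_star (A.sp b)) \<le>
          (q1 (A.sp a) * q1 (poly_star (A.sp a) * y * A.sp b)) * q1 (poly_star (A.sp b))"
        by (rule order_trans[OF A.q_mult mult_right_mono[OF A.q_mult A.q_nonneg]])
      also have "\<dots> \<le> (1 * q2 y) * 1"
        using A.pathsD[OF ab(1)] A.pathsD[OF ab(2)]
        by (intro mult_mono entry ab) (simp_all add: A.q_path)
      finally show "q1 (A.sp a * (poly_star (A.sp a) * y * A.sp b) * poly_star (A.sp b)) \<le> q2 y" by simp
    qed
    also have "\<dots> = M * q2 y" by (simp add: M_def power2_eq_square)
    finally show ?thesis .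
  qed
  \<comment> \<open>Iterated squares of a self-adjoint element stay in the matrix level, and both
    seminorms take exact powers on them; the constant \<open>M\<close> then disappears in the
    limit.\<close>
  define h where "h k = ((\<lambda>y. y * y) ^^ k) (poly_star x * x)" for k
  have h: "h k \<in> A.matrix_level n \<and> poly_star (h k) = h k \<and>
      q1 (h k) = q1 (h 0) ^ (2 ^ k) \<and> q2 (h k) = q2 (h 0) ^ (2 ^ k)" for k
  proof (induction k)
    case 0
    then show ?case using n by (simp add: h_def A.matrix_level_mult A.matrix_level_star)
  next
    case (Suc k)
    have S: "h (Suc k) = h k * h k" by (simp add: h_def)
    have "q1 (h k * h k) = (q1 (h k))\<^sup>2" "q2 (h k * h k) = (q2 (h k))\<^sup>2"
      using A.q_cstar[of "h k"] B.q_cstar[of "h k"] Suc by simp_all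
    then show ?case using Suc unfolding S
      by (simp add: A.matrix_level_mult power_mult[symmetric] mult.commute)
  qed
  have "q1 (h 0) \<le> q2 (h 0)"
  proof (rule pow_bound_imp_le)
    show "q1 (h 0) ^ (2 ^ k) \<le> M * q2 (h 0) ^ (2 ^ k)" for k using h[of k] bound[of "h k"] by simp
  qed simp
  then have "(q1 x)\<^sup>2 \<le> (q2 x)\<^sup>2" by (simp add: h_def A.q_cstar B.q_cstar)
  then have "q1 x \<le> q2 x" using power2_le_imp_le B.q_nonneg by blast
  then show ?thesis using le[OF x] by simp
qed

section \<open>Graph C*-algebras and the gauge action\<close>

lemma (in cseminorm) subst_graph_rels:
  fixes t :: "('v, 'e) graph_gen \<Rightarrow> 'g star_poly"
  assumes "\<And>v. v \<in> verts E \<Longrightarrow> poly_star (t (Vtx v)) \<doteq> t (Vtx v)"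
    and "\<And>v. v \<in> verts E \<Longrightarrow> t (Vtx v) * t (Vtx v) \<doteq> t (Vtx v)"
    and "\<And>v w. v \<in> verts E \<Longrightarrow> w \<in> verts E \<Longrightarrow> v \<noteq> w \<Longrightarrow> t (Vtx v) * t (Vtx w) \<doteq> 0"
    and "\<And>e. e \<in> arcs E \<Longrightarrow> t (Edg e) * poly_star (t (Edg e)) * t (Edg e) \<doteq> t (Edg e)"
    and "\<And>e. e \<in> arcs E \<Longrightarrow> poly_star (t (Edg e)) * t (Edg e) \<doteq> t (Vtx (head E e))"
    and "\<And>v. v \<in> verts E \<Longrightarrow> out_arcs E v \<noteq> {} \<Longrightarrow>
      (\<Sum>e\<in>out_arcs E v. t (Edg e) * poly_star (t (Edg e))) \<doteq> t (Vtx v)"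
    and r: "r \<in> graph_rels E"
  shows "q (subst t r) = 0"
proof -
  note eqs = assms(1-6)[unfolded eqv_def]
  from r show ?thesis
    unfolding graph_rels_def
    by (elim UnE CollectE exE conjE) (simp_all add: eqs eqs(3)[simplified] subst_sum)
qed

locale finite_graph =
  fixes E :: "('v, 'e) pre_digraph"
  assumes fin_graph: "fin_digraph E"

text \<open>Each admissible seminorm is extended to the unital algebra first; the bounds on vertex
  projections and partial isometries hold for it on its own, before any supremum is formed.\<close>

sublocale finite_graph \<subseteq> bounded_presentation "graph_gens E" "graph_rels E"
proof
  show sub: "graph_rels E \<subseteq> free_star_algebra (graph_gens E)"
    by (rule graph_rels_free[OF fin_graph])
  fix q g assume q: "cstar_seminorm (graph_gens E) q" "\<forall>r\<in>graph_rels E. q r = 0" and g: "g \<in> graph_gens E"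
  let ?p = "total_seminorm (graph_gens E) q"
  interpret p: cseminorm ?p by (rule cseminorm_total[OF q(1)])
  interpret p: graph_seminorm ?p E
    by (intro graph_seminorm.intro p.cseminorm_axioms graph_seminorm_axioms.intro fin_graph)
      (use q sub in \<open>auto simp: total_eq[OF q(1)]\<close>)
  have "?p (poly_gen g) \<le> 1" using g p.qP p.qS by (auto simp: graph_gens_def)
  then show "q (poly_gen g) \<le> 1" using total_eq[OF q(1) free_gen[OF g]] by simp
qed

sublocale finite_graph \<subseteq> graph_seminorm uq E
  by (intro graph_seminorm.intro cseminorm_axioms graph_seminorm_axioms.intro fin_graph uq_rel)

section \<open>The gauge action on polynomials and averaging\<close>

definition gauge_sub :: "complex \<Rightarrow> ('v, 'e) graph_gen \<Rightarrow> ('v, 'e) graph_gen star_poly" where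
  "gauge_sub z = case_graph_gen pP (\<lambda>e. poly_scale z (pS e))"

lemma gauge_sub_simps [simp]: "gauge_sub z (Vtx v) = pP v" "gauge_sub z (Edg e) = poly_scale z (pS e)"
  by (simp_all add: gauge_sub_def)

lemma gauge_sub_free: "g \<in> graph_gens E \<Longrightarrow> gauge_sub z g \<in> free_star_algebra (graph_gens E)"
  by (cases g) (simp_all add: free_gen free_scale)

text \<open>Words are eigenvectors of the gauge action. The adjoint letters contribute negative
  powers because the conjugate of \<open>z\<close> is its inverse on the circle.\<close>

lemma word_val_gauge:
  assumes z: "cmod z = 1"
  shows "word_val (gauge_sub z) w = Poly_Mapping.single w (z powi word_deg w)"
proof -
  have z0: "z \<noteq> 0" using z by auto
  have cz: "cnj z = inverse z" using z z0
    by (metis complex_norm_square inverse_unique mult.commute of_real_1 one_power2)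
  have lv: "letter_val (gauge_sub z) a = Poly_Mapping.single (Word [a]) (z powi letter_deg a)" for a :: "('v, 'e) graph_gen \<times> bool"
    by (cases a rule: letter_deg.cases)
      (auto simp: letter_val_def poly_gen_def word_star_def cz power_int_minus)
  have "prod_list (map (letter_val (gauge_sub z)) l) =
      Poly_Mapping.single (Word l) (z powi (\<Sum>a\<leftarrow>l. letter_deg a))" for l :: "(('v, 'e) graph_gen \<times> bool) list"
  proof (induction l)
    case Nil
    then show ?case by (simp add: zero_star_word_def[symmetric] single_one)
  next
    case (Cons a l)
    then show ?case using z0 by (simp add: lv mult_single plus_star_word_def power_int_add)
  qed
  then show ?thesis by (cases w) (simp add: word_val_def word_deg_def)
qed

lemma lookup_gauge:
  assumes z: "cmod z = 1"
  shows "Poly_Mapping.lookup (subst (gauge_sub z) x) w = Poly_Mapping.lookup x w * z powi word_deg w"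
  by (induction x rule: star_poly_induct)
    (simp_all add: word_val_gauge[OF z] lookup_single when_def lookup_add distrib_right)

text \<open>On polynomials this is the conditional expectation onto gauge-invariant
  elements.\<close>

definition deg_zero_part :: "('v, 'e) graph_gen star_poly \<Rightarrow> ('v, 'e) graph_gen star_poly" where
  "deg_zero_part x = (\<Sum>w\<in>{w \<in> Poly_Mapping.keys x. word_deg w = 0}. Poly_Mapping.single w (Poly_Mapping.lookup x w))"

lemma lookup_deg_zero_part:
  "Poly_Mapping.lookup (deg_zero_part x) w = (if word_deg w = 0 then Poly_Mapping.lookup x w else 0)"
  by (auto simp: deg_zero_part_def lookup_sum lookup_single when_def sum.delta in_keys_iff)

lemma deg_zero_part_deg: "w \<in> Poly_Mapping.keys (deg_zero_part x) \<Longrightarrow> word_deg w = 0"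
  by (auto simp: in_keys_iff lookup_deg_zero_part split: if_splits)

lemma deg_zero_part_free: "x \<in> free_star_algebra G \<Longrightarrow> deg_zero_part x \<in> free_star_algebra G"
  unfolding free_star_algebra_def
proof (clarify)
  fix w assume x: "\<forall>w\<in>Poly_Mapping.keys x. letters w \<noteq> [] \<and> fst ` set (letters w) \<subseteq> G"
    and w: "w \<in> Poly_Mapping.keys (deg_zero_part x)"
  then have "w \<in> Poly_Mapping.keys x" by (auto simp: in_keys_iff lookup_deg_zero_part split: if_splits)
  then show "letters w \<noteq> [] \<and> fst ` set (letters w) \<subseteq> G" using x by blast
qed

lemma gauge_deg_zero:
  assumes "cmod z = 1" "\<And>w. w \<in> Poly_Mapping.keys x \<Longrightarrow> word_deg w = 0"
  shows "subst (gauge_sub z) x = x"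
  by (rule poly_mapping_eqI) (metis assms in_keys_iff lookup_gauge mult_zero_left power_int_0_right mult_1_right)

text \<open>The bound on \<open>d\<close> excludes nonzero multiples of \<open>m\<close>, so for
  nonzero \<open>d\<close> this is a geometric sum with ratio different from 1.\<close>

lemma sum_roots_of_unity:
  fixes d :: int
  assumes m: "\<bar>d\<bar> < int m"
  shows "(\<Sum>k<m. cis (2 * pi * real k / real m) powi d) = (if d = 0 then of_nat m else 0)"
proof (cases "d = 0")
  case False
  let ?w = "cis (2 * pi * of_int d / real m)"
  have m0: "m > 0" using m by linarith
  have "?w \<noteq> 1"
  proof
    assume "?w = 1"
    then have "exp (\<i> * of_real (2 * pi * of_int d / real m)) = 1" by (simp add: cis_conv_exp)
    then obtain n :: int where "2 * pi * of_int d / real m = of_int (2 * n) * pi"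
      unfolding exp_eq_1 by auto
    then have "of_int d = of_int n * real m" using m0 by (simp add: field_simps)
    then have "d = n * int m" by (metis of_int_eq_iff of_int_mult of_int_of_nat_eq)
    then have "\<bar>d\<bar> = \<bar>n\<bar> * int m" by (simp add: abs_mult)
    moreover have "\<bar>n\<bar> \<ge> 1" using \<open>d = n * int m\<close> False by auto
    ultimately have "int m \<le> \<bar>d\<bar>" by (metis mult_right_mono mult_1 of_nat_0_le_iff)
    then show False using m by simp
  qed
  have "cis (2 * pi * real k / real m) powi d = ?w ^ k" for k
    by (simp add: cis_power_int Complex.DeMoivre mult_ac)
  then have "(\<Sum>k<m. cis (2 * pi * real k / real m) powi d) = (\<Sum>k<m. ?w ^ k)" by simp
  also have "\<dots> = (?w ^ m - 1) / (?w - 1)" using \<open>?w \<noteq> 1\<close> by (simp add: geometric_sum)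
  also have "?w ^ m = cis (2 * pi * of_int d)" using m0 by (simp add: Complex.DeMoivre)
  also have "\<dots> = 1" by (rule cis_multiple_2pi) simp
  finally show ?thesis using False by simp
qed simp

text \<open>A polynomial has finitely many degrees, so averaging over sufficiently many roots of
  unity yields its degree 0 part exactly, without integration over the circle. The seminorm need not
  be gauge invariant: only the displacements of this \<open>x\<close> are bounded, which is what is
  known after passing to a quotient.\<close>

lemma deg_zero_part_approx:
  fixes x :: "('v, 'e) graph_gen star_poly"
  assumes p: "cseminorm p"
    and le: "\<And>z. cmod z = 1 \<Longrightarrow> p (x - subst (gauge_sub z) x) \<le> e"
  shows "p (x - deg_zero_part x) \<le> e"
proof -
  interpret p: cseminorm p by fact
  have "finite ((\<lambda>w. nat \<bar>word_deg w\<bar>) ` Poly_Mapping.keys x)" by simp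
  then obtain m where m: "\<And>w. w \<in> Poly_Mapping.keys x \<Longrightarrow> nat \<bar>word_deg w\<bar> < m"
    using finite_nat_set_iff_bounded by (metis imageI)
  \<comment> \<open>The successor keeps the number of roots positive even for \<open>x = 0\<close>,
    so that the final inequality can be divided by it.\<close>
  define M where "M = Suc m"
  have M: "\<And>w. w \<in> Poly_Mapping.keys x \<Longrightarrow> \<bar>word_deg w\<bar> < int M" using m by (fastforce simp: M_def)
  let ?z = "\<lambda>k. cis (2 * pi * real k / real M)"
  have avg: "poly_scale (of_nat M) (deg_zero_part x) = (\<Sum>k<M. subst (gauge_sub (?z k)) x)"
  proof (rule poly_mapping_eqI)
    fix w
    have "Poly_Mapping.lookup (\<Sum>k<M. subst (gauge_sub (?z k)) x) w =
        Poly_Mapping.lookup x w * (\<Sum>k<M. ?z k powi word_deg w)"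
      by (simp add: lookup_sum lookup_gauge sum_distrib_left)
    also have "\<dots> = Poly_Mapping.lookup x w * (if word_deg w = 0 then of_nat M else 0)"
    proof (cases "w \<in> Poly_Mapping.keys x")
      case True
      then show ?thesis by (simp only: sum_roots_of_unity[OF M])
    qed (simp add: in_keys_iff)
    also have "\<dots> = Poly_Mapping.lookup (poly_scale (of_nat M) (deg_zero_part x)) w"
      by (simp add: lookup_poly_scale lookup_deg_zero_part)
    finally show "Poly_Mapping.lookup (poly_scale (of_nat M) (deg_zero_part x)) w =
        Poly_Mapping.lookup (\<Sum>k<M. subst (gauge_sub (?z k)) x) w" by simp
  qed
  have "poly_scale (of_nat M) x = (\<Sum>k<M. x)" by (simp add: poly_scale_conv_mult)
  then have "poly_scale (of_nat M) (x - deg_zero_part x) = (\<Sum>k<M. x - subst (gauge_sub (?z k)) x)"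
    by (simp add: poly_scale_diff_right avg sum_subtractf)
  then have "real M * p (x - deg_zero_part x) = p (\<Sum>k<M. x - subst (gauge_sub (?z k)) x)"
    using p.q_scale[of "of_nat M" "x - deg_zero_part x"] by simp
  also have "\<dots> \<le> (\<Sum>k<M. e)" by (rule order_trans[OF p.q_sum sum_mono[OF le]]) simp
  finally show ?thesis by (simp add: M_def)
qed

context finite_graph
begin

notation eqv (infix \<open>\<doteq>\<close> 50)

lemma graph_cstar_UA: "graph_cstar E = UA"
  by (simp add: graph_cstar_def)

lemma unit_scale: "cmod z = 1 \<Longrightarrow> poly_scale (z * cnj z) x = x" "cmod z = 1 \<Longrightarrow> poly_scale (cnj z * z) x = x"
  using complex_norm_square[of z] by (simp_all add: mult.commute)

lemma gauge_hom:
  assumes z: "cmod z = 1"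
  shows "presentation_hom (graph_gens E) (graph_rels E) (graph_gens E) (graph_rels E) (gauge_sub z)"
proof
  show "gauge_sub z g \<in> Fr" if "g \<in> graph_gens E" for g using that by (rule gauge_sub_free)
  show "uq (subst (gauge_sub z) r) = 0" if "r \<in> graph_rels E" for r
  proof (rule subst_graph_rels[OF _ _ _ _ _ _ that])
    fix e assume e: "e \<in> arcs E"
    show "gauge_sub z (Edg e) * poly_star (gauge_sub z (Edg e)) * gauge_sub z (Edg e) \<doteq> gauge_sub z (Edg e)"
      using eqv_scale[OF S_partial[OF e], of z] z
      by (simp add: poly_scale_mult_left poly_scale_mult_right mult.assoc[of z] complex_norm_square[symmetric] mult.commute[of "cnj z"])
    show "poly_star (gauge_sub z (Edg e)) * gauge_sub z (Edg e) \<doteq> gauge_sub z (Vtx (head E e))"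
      using S_source[OF e] z by (simp add: poly_scale_mult_left poly_scale_mult_right unit_scale)
  next
    fix v assume v: "v \<in> verts E" "out_arcs E v \<noteq> {}"
    show "(\<Sum>e\<in>out_arcs E v. gauge_sub z (Edg e) * poly_star (gauge_sub z (Edg e))) \<doteq> gauge_sub z (Vtx v)"
      using CK[OF v] z by (simp add: poly_scale_mult_left poly_scale_mult_right unit_scale)
  qed (simp_all add: P_star P_idem P_orth)
qed

lemma gP_cl: "gP E v = cl (\<lambda>n. pP v)" and gS_cl: "gS E e = cl (\<lambda>n. pS e)"
  by (simp_all add: gP_def gS_def univ_gen_def)

lemma gauge_eq:
  assumes z: "cmod z = 1"
  shows "gauge E z = presentation_hom.hom (graph_gens E) (graph_rels E) (graph_gens E) (graph_rels E) (gauge_sub z)"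
proof -
  interpret h: presentation_hom "graph_gens E" "graph_rels E" "graph_gens E" "graph_rels E" "gauge_sub z"
    by (rule gauge_hom[OF z])
  show ?thesis unfolding gauge_def graph_hom_def graph_cstar_UA
  proof (rule h.univ_hom_eq)
    fix g assume g: "g \<in> graph_gens E"
    show "case_graph_gen (gP E) (\<lambda>e. cscale UA z (gS E e)) g = cl (\<lambda>n. gauge_sub z g)"
      using g by (cases g) (simp_all add: gP_cl gS_cl cscale_cl free_gen)
  qed
qed

lemma gauge_cl: "cmod z = 1 \<Longrightarrow> Cau x \<Longrightarrow> gauge E z (cl x) = cl (\<lambda>n. subst (gauge_sub z) (x n))"
  using presentation_hom.hom_cl[OF gauge_hom] by (simp add: gauge_eq)

lemma star_hom_gauge: "cmod z = 1 \<Longrightarrow> star_hom UA UA (gauge E z)"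
  using presentation_hom.star_hom_hom[OF gauge_hom] by (simp add: gauge_eq)

lemma gauge_contractive: "cmod z = 1 \<Longrightarrow> X \<in> car UA \<Longrightarrow> cnorm UA (gauge E z X) \<le> cnorm UA X"
  using presentation_hom.hom_contractive[OF gauge_hom] by (simp add: gauge_eq)

lemma car_gauge_fixed: "car (gauge_fixed E) = {x \<in> car UA. \<forall>z\<in>sphere 0 1. gauge E z x = x}"
  by (simp add: gauge_fixed_def graph_cstar_UA)

lemma cstar_algebra_graph: "cstar_algebra (graph_cstar E)"
  by (simp add: graph_cstar_UA cstar_algebra_UA)

lemma cstar_algebra_gauge_fixed: "cstar_algebra (gauge_fixed E)"
  unfolding gauge_fixed_def graph_cstar_UA
  by (rule cstar_algebra_fixed[OF cstar_algebra_UA]) (auto intro: star_hom_gauge gauge_contractive)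

lemma deg_zero_fixed:
  assumes x: "Cau x" and deg: "\<And>n w. w \<in> Poly_Mapping.keys (x n) \<Longrightarrow> word_deg w = 0"
  shows "cl x \<in> car (gauge_fixed E)"
proof -
  have "subst (gauge_sub z) (x n) = x n" if "cmod z = 1" for z n
    using gauge_deg_zero[OF that deg] .
  then show ?thesis by (simp add: car_gauge_fixed car_cl x gauge_cl)
qed

text \<open>Both \<open>x\<close> and its image under the gauge action are within \<open>e\<close>
  of the fixed element \<open>X\<close>.\<close>

lemma fixed_seminorm_bound:
  assumes X: "X \<in> car (gauge_fixed E)" and x: "x \<in> Fr" and e: "cnorm UA (csub UA X (cl (\<lambda>_. x))) < e"
    and z: "cmod z = 1"
  shows "uq (x - subst (gauge_sub z) x) \<le> 2 * e"
proof -
  interpret A: cstar_algebra UA by (rule cstar_algebra_UA)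
  let ?x = "cl (\<lambda>_. x)"
  have c: "X \<in> car UA" "?x \<in> car UA" "gauge E z ?x \<in> car UA"
    using X x star_homD(1)[OF star_hom_gauge[OF z]] by (auto simp: car_gauge_fixed car_cl)
  have gX: "gauge E z X = X" using X z by (simp add: car_gauge_fixed)
  have "csub UA X (gauge E z ?x) = gauge E z (csub UA X ?x)"
    using star_hom_sub[OF star_hom_gauge[OF z] cstar_algebra_UA c(1,2)] gX by simp
  then have 1: "cnorm UA (csub UA X (gauge E z ?x)) < e"
    using gauge_contractive[OF z A.sub_closed[OF c(1,2)]] e by simp
  have "cnorm UA (csub UA ?x (gauge E z ?x)) \<le> 2 * e"
    using A.norm_sub_triangle[OF c(2,1,3)] A.norm_sub_commute[OF c(2,1)] e 1 by simp
  moreover have "csub UA ?x (gauge E z ?x) = cl (\<lambda>_. x - subst (gauge_sub z) x)"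
    using x z by (simp add: gauge_cl csub_cl subst_free[OF gauge_sub_free])
  moreover have "x - subst (gauge_sub z) x \<in> Fr" using x by (intro free_diff subst_free[OF gauge_sub_free])
  ultimately show ?thesis by (simp add: cnorm_const)
qed

text \<open>A polynomial within \<open>e / 3\<close> of \<open>X\<close> is displaced by at most
  \<open>2 * e / 3\<close>, and so is moved at most that far when replaced by its degree 0 part; the
  two distances add up to \<open>e\<close>.\<close>

lemma fixed_approx:
  assumes X: "X \<in> car (gauge_fixed E)" and e: "e > 0"
  shows "\<exists>x\<in>Fr. (\<forall>w\<in>Poly_Mapping.keys x. word_deg w = 0) \<and> cnorm UA (csub UA X (cl (\<lambda>_. x))) < e"
proof -
  interpret A: cstar_algebra UA by (rule cstar_algebra_UA)
  have XU: "X \<in> car UA" using X by (simp add: car_gauge_fixed)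
  then obtain y where y: "Cau y" "X = cl y" by (rule carE)
  obtain n where n: "cnorm UA (csub UA X (cl (\<lambda>_. y n))) < e / 3"
    using dense[OF y(1), of "e / 3"] e y(2) by auto
  let ?x = "deg_zero_part (y n)"
  have yF: "y n \<in> Fr" by (rule Cau_free[OF y(1)])
  have xF: "?x \<in> Fr" by (rule deg_zero_part_free[OF yF])
  have "uq (y n - ?x) \<le> 2 * (e / 3)"
    by (rule deg_zero_part_approx[OF cseminorm_axioms fixed_seminorm_bound[OF X yF n]])
  then have "cnorm UA (csub UA (cl (\<lambda>_. y n)) (cl (\<lambda>_. ?x))) \<le> 2 * (e / 3)"
    using yF xF by (simp add: csub_cl cnorm_const free_diff)
  then have "cnorm UA (csub UA X (cl (\<lambda>_. ?x))) < e"
    using A.norm_sub_triangle[OF XU car_cl[OF Cau_const[OF yF]] car_cl[OF Cau_const[OF xF]]] n by simp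
  then show ?thesis using xF deg_zero_part_deg by blast
qed

end

section \<open>The quotient by the ideal of a sink\<close>

lemma free_word_induct [consumes 1, case_names zero word add scale]:
  assumes x: "x \<in> free_star_algebra G" and z: "P 0"
    and w: "\<And>w. letters w \<noteq> [] \<Longrightarrow> fst ` set (letters w) \<subseteq> G \<Longrightarrow> P (word_val poly_gen w)"
    and ad: "\<And>x y. P x \<Longrightarrow> P y \<Longrightarrow> P (x + y)"
    and sc: "\<And>c x. P x \<Longrightarrow> P (poly_scale c x)"
  shows "P x"
proof -
  have "finite K \<Longrightarrow> K \<subseteq> Poly_Mapping.keys x \<Longrightarrow>
      P (\<Sum>w\<in>K. poly_scale (Poly_Mapping.lookup x w) (word_val poly_gen w))" for K
  proof (induction K rule: finite_induct)
    case (insert w K)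
    then have "P (word_val poly_gen w)" using x by (intro w) (auto simp: free_star_algebra_def)
    then show ?case using insert by (simp add: ad sc)
  qed (simp add: z)
  from this[of "Poly_Mapping.keys x"] have "P (subst poly_gen x)" by (simp add: subst_def)
  then show ?thesis by simp
qed

locale sink_seminorm = graph_seminorm q E
  for q :: "('v, 'e) graph_gen star_poly \<Rightarrow> real" and E +
  fixes vb :: 'v
  assumes vb: "vb \<in> verts E" and sink: "out_arcs E vb = {}"
begin

section \<open>Paths into the sink and the ideal they span\<close>

definition sink_paths :: "('v \<times> 'e list) set" where
  "sink_paths = {a. fst a \<in> verts E \<and> path_from E (fst a) (snd a) \<and> pe a = vb}"

abbreviation "fsets \<equiv> {A. finite A \<and> A \<subseteq> sink_paths}"

definition range_proj :: "('v \<times> 'e list) set \<Rightarrow> ('v, 'e) graph_gen star_poly" where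
  "range_proj A = (\<Sum>a\<in>A. sp a * poly_star (sp a))"

text \<open>As they end in a sink, these paths belong to every level above their length. Any two can
  thus be compared at a common level, and their elements obey the relations of one infinite system
  of matrix units.\<close>

lemma sink_paths_full: "a \<in> sink_paths \<Longrightarrow> length (snd a) \<le> n \<Longrightarrow> a \<in> paths n"
  by (cases a) (simp add: sink_paths_def paths_def full_paths_def sink)

lemma sink_orth:
  assumes "a \<in> sink_paths" "b \<in> sink_paths"
  shows "poly_star (sp a) * sp b \<doteq> (if a = b then pP vb else 0)"
proof -
  let ?n = "max (length (snd a)) (length (snd b))"
  have "poly_star (sp a) * sp b \<doteq> (if a = b then pP (pe a) else 0)"
    by (rule paths_orth[of _ ?n]) (use assms in \<open>auto intro: sink_paths_full\<close>)
  moreover have "pe a = vb" using assms by (simp add: sink_paths_def)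
  ultimately show ?thesis by (simp only:)
qed

lemma sp_P: "a \<in> sink_paths \<Longrightarrow> sp a * pP vb \<doteq> sp a"
  using path_P[of "fst a" "snd a"] by (simp add: sink_paths_def)

lemma sp_free: "a \<in> sink_paths \<Longrightarrow> sp a \<in> Fr"
  by (simp add: sink_paths_def path_elt_free wf)

lemma range_proj_star [simp]: "poly_star (range_proj A) = range_proj A"
  by (simp add: range_proj_def poly_star_sum)

lemma range_proj_sp:
  assumes A: "finite A" "A \<subseteq> sink_paths" and a: "a \<in> A"
  shows "range_proj A * sp a \<doteq> sp a"
proof -
  have as: "a \<in> sink_paths" using A a by blast
  have "range_proj A * sp a = (\<Sum>b\<in>A. sp b * (poly_star (sp b) * sp a))"
    by (simp add: range_proj_def sum_distrib_right mult.assoc)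
  also have "\<dots> \<doteq> sp a"
  proof (rule eqv_sum_delta[OF A(1) a])
    have "sp a * (poly_star (sp a) * sp a) \<doteq> sp a * pP vb"
      using sink_orth[OF as as] by (intro eqv_mult_right) simp
    then show "sp a * (poly_star (sp a) * sp a) \<doteq> sp a" using eqv_trans sp_P[OF as] by blast
    fix b assume "b \<in> A" "b \<noteq> a"
    then show "sp b * (poly_star (sp b) * sp a) \<doteq> 0"
      using sink_orth[of b a] A as by (intro eqv_mult_zero(2)[of "poly_star (sp b) * sp a"]) auto
  qed
  finally show ?thesis .
qed

lemma range_proj_mono:
  assumes B: "finite B" "B \<subseteq> sink_paths" and AB: "A \<subseteq> B"
  shows "range_proj B * range_proj A \<doteq> range_proj A"
proof -
  have "range_proj B * range_proj A = (\<Sum>a\<in>A. (range_proj B * sp a) * poly_star (sp a))"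
    by (simp add: range_proj_def[of A] sum_distrib_left mult.assoc)
  also have "\<dots> \<doteq> range_proj A"
    unfolding range_proj_def[of A] by (intro eqv_sum eqv_mult_left range_proj_sp B) (use AB in auto)
  finally show ?thesis .
qed

lemma range_proj_mono':
  assumes B: "finite B" "B \<subseteq> sink_paths" and AB: "A \<subseteq> B"
  shows "range_proj A * range_proj B \<doteq> range_proj A"
  using eqv_star[OF range_proj_mono[OF assms]] by simp

lemma q_compl: assumes A: "finite A" "A \<subseteq> sink_paths" shows "q (1 - range_proj A) \<le> 1"
proof (rule q_proj)
  have "1 - range_proj A - range_proj A + range_proj A * range_proj A \<doteq>
      1 - range_proj A - range_proj A + range_proj A"
    by (intro eqv_add eqv_refl range_proj_mono A) simp
  then show "(1 - range_proj A) * (1 - range_proj A) \<doteq> 1 - range_proj A" by (simp add: algebra_simps)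
qed simp

text \<open>An algebraic form of membership in the right ideal generated by the elements of paths
  into the sink, with no closure taken.\<close>

definition local_unit :: "('v, 'e) graph_gen star_poly \<Rightarrow> bool" where
  "local_unit x \<longleftrightarrow> (\<exists>A\<in>fsets. range_proj A * x \<doteq> x)"

lemma local_unit_mono:
  assumes B: "finite B" "B \<subseteq> sink_paths" and AB: "A \<subseteq> B" and x: "range_proj A * x \<doteq> x"
  shows "range_proj B * x \<doteq> x"
proof -
  have "range_proj B * x \<doteq> range_proj B * (range_proj A * x)" by (intro eqv_mult_right eqv_sym[OF x])
  also have "\<dots> = (range_proj B * range_proj A) * x" by (simp add: mult.assoc)
  also have "\<dots> \<doteq> range_proj A * x" by (intro eqv_mult_left range_proj_mono B AB)
  also have "\<dots> \<doteq> x" by (rule x)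
  finally show ?thesis .
qed

lemma local_unit_zero: "local_unit 0"
  unfolding local_unit_def by (intro bexI[of _ "{}"]) simp_all

lemma local_unit_add: assumes "local_unit x" "local_unit y" shows "local_unit (x + y)"
proof -
  obtain A B where A: "A \<in> fsets" "range_proj A * x \<doteq> x" and B: "B \<in> fsets" "range_proj B * y \<doteq> y"
    using assms unfolding local_unit_def by blast
  have AB: "finite (A \<union> B)" "A \<union> B \<subseteq> sink_paths" using A B by auto
  have "range_proj (A \<union> B) * (x + y) \<doteq> x + y"
    unfolding distrib_left using A(2) B(2) by (intro eqv_add local_unit_mono[OF AB]) auto
  then show ?thesis using AB unfolding local_unit_def by blast
qed

lemma local_unit_scale: "local_unit x \<Longrightarrow> local_unit (poly_scale c x)"
  unfolding local_unit_def using eqv_scale by (fastforce simp: poly_scale_mult_right)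

lemma local_unit_mult: "local_unit x \<Longrightarrow> local_unit (x * y)"
  unfolding local_unit_def using eqv_mult_left[of "range_proj _ * x" x y] by (auto simp: mult.assoc)

lemma local_unit_eqv: assumes "x \<doteq> y" "local_unit y" shows "local_unit x"
proof -
  obtain A where A: "A \<in> fsets" "range_proj A * y \<doteq> y" using assms(2) unfolding local_unit_def by blast
  have "range_proj A * x \<doteq> range_proj A * y" by (intro eqv_mult_right assms(1))
  then have "range_proj A * x \<doteq> x" using eqv_trans[OF _ eqv_trans[OF A(2) eqv_sym[OF assms(1)]]] by blast
  then show ?thesis using A(1) unfolding local_unit_def by blast
qed

lemma local_unit_sum: "(\<And>a. a \<in> A \<Longrightarrow> local_unit (f a)) \<Longrightarrow> local_unit (sum f A)"
  by (induction A rule: infinite_finite_induct) (auto intro: local_unit_zero local_unit_add)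

lemma local_unit_sp: "a \<in> sink_paths \<Longrightarrow> local_unit (sp a)"
  unfolding local_unit_def using range_proj_sp[of "{a}" a] by (intro bexI[of _ "{a}"]) auto

text \<open>No bound on the length of the word is needed here, since the path ends in a
  sink.\<close>

lemma word_sp:
  assumes w: "fst ` set (letters w) \<subseteq> graph_gens E" and a: "a \<in> sink_paths"
  shows "word_val poly_gen w * sp a \<doteq> 0 \<or> (\<exists>b\<in>sink_paths. word_val poly_gen w * sp a \<doteq> sp b)"
proof -
  have a': "fst a \<in> verts E" "path_from E (fst a) (snd a)" "pe a = vb"
    using a by (auto simp: sink_paths_def)
  have "length (letters w) \<le> length (snd a) \<or> out_arcs E (pe a) = {}" unfolding a'(3) sink by simp
  from letters_path[OF w a'(1,2) this] show ?thesis
  proof (elim disjE exE conjE)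
    fix v' p' assume "v' \<in> verts E" "path_from E v' p'" "path_end E v' p' = pe a"
      and eq: "prod_list (map (letter_val poly_gen) (letters w)) * sp a \<doteq> path_elt E v' p'"
    then have "(v', p') \<in> sink_paths" using a'(3) by (simp add: sink_paths_def)
    then show ?thesis using eq by (intro disjI2 bexI[of _ "(v', p')"]) (simp_all add: word_val_def)
  qed (simp add: word_val_def)
qed

lemma local_unit_left: assumes x: "x \<in> Fr" and a: "a \<in> sink_paths" shows "local_unit (x * sp a)"
  using x
proof (induction rule: free_word_induct)
  case zero
  then show ?case by (simp add: local_unit_zero)
next
  case (word w)
  then show ?case using word_sp[OF word(2) a] local_unit_eqv local_unit_zero local_unit_sp by blast
next
  case (add x y)
  then show ?case by (simp add: distrib_right local_unit_add)
next
  case (scale c x)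
  then show ?case by (simp add: poly_scale_mult_left local_unit_scale)
qed

text \<open>Applying \<open>local_unit\<close> to the adjoint of \<open>x\<close> times
  \<open>range_proj A\<close> and taking adjoints gives the projection on the right. This is how the
  ideal property enters the submultiplicativity of \<open>quot_norm\<close>.\<close>

lemma range_proj_absorb:
  assumes x: "x \<in> Fr" and A: "A \<subseteq> sink_paths"
  shows "\<exists>B\<in>fsets. range_proj A * x * range_proj B \<doteq> range_proj A * x"
proof -
  have "local_unit (poly_star x * range_proj A)"
    unfolding range_proj_def sum_distrib_left mult.assoc[symmetric]
    by (intro local_unit_sum local_unit_mult local_unit_left free_star x) (use A in auto)
  then obtain B where B: "B \<in> fsets" "range_proj B * (poly_star x * range_proj A) \<doteq> poly_star x * range_proj A"
    unfolding local_unit_def by blast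
  show ?thesis using eqv_star[OF B(2)] B(1) by (intro bexI[of _ B]) (simp_all add: mult.assoc)
qed

text \<open>The product is a sum of terms \<open>x * sp a * poly_star (sp a)\<close>, and a word of
  \<open>x\<close> sends \<open>sp a\<close> to 0 or to another path element. So it lies in the span
  of the matrix units, up to \<open>eqv\<close>.\<close>

lemma ideal_induct [consumes 3, case_names zero path add scale eqv]:
  assumes x: "x \<in> Fr" and A: "finite A" "A \<subseteq> sink_paths" and z: "P 0"
    and b: "\<And>a b. a \<in> sink_paths \<Longrightarrow> b \<in> sink_paths \<Longrightarrow> P (sp b * poly_star (sp a))"
    and ad: "\<And>x y. P x \<Longrightarrow> P y \<Longrightarrow> P (x + y)"
    and sc: "\<And>c x. P x \<Longrightarrow> P (poly_scale c x)"
    and eq: "\<And>x y. x \<doteq> y \<Longrightarrow> P y \<Longrightarrow> P x"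
  shows "P (x * range_proj A)"
proof -
  have 1: "P (x * sp a * poly_star (sp a))" if a: "a \<in> sink_paths" for a
    using x
  proof (induction rule: free_word_induct)
    case zero
    then show ?case by (simp add: z)
  next
    case (word w)
    show ?case using word_sp[OF word(2) a]
    proof (elim disjE bexE)
      assume "word_val poly_gen w * sp a \<doteq> 0"
      then show ?thesis using eq[OF eqv_mult_zero(1) z] by blast
    next
      fix c assume c: "c \<in> sink_paths" "word_val poly_gen w * sp a \<doteq> sp c"
      then show ?thesis using eq[OF eqv_mult_left[OF c(2)] b[OF a c(1)]] by blast
    qed
  next
    case (add x y)
    then show ?case by (simp add: distrib_right ad)
  next
    case (scale c x)
    then show ?case by (simp add: poly_scale_mult_left sc)
  qed
  have "finite B \<Longrightarrow> B \<subseteq> sink_paths \<Longrightarrow> P (\<Sum>a\<in>B. x * sp a * poly_star (sp a))" for B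
    by (induction B rule: finite_induct) (simp_all add: z ad 1)
  from this[OF A] show ?thesis by (simp add: range_proj_def sum_distrib_left mult.assoc)
qed

text \<open>The quotient norm modulo the ideal with approximate unit \<open>range_proj\<close>.\<close>

definition quot_norm :: "('v, 'e) graph_gen star_poly \<Rightarrow> real" where
  "quot_norm x = (INF A\<in>fsets. q (x * (1 - range_proj A)))"

lemma quot_norm_le: "finite A \<Longrightarrow> A \<subseteq> sink_paths \<Longrightarrow> quot_norm x \<le> q (x * (1 - range_proj A))"
  unfolding quot_norm_def by (rule cINF_lower) (auto intro!: bdd_belowI2[of _ 0])

lemma quot_norm_less:
  assumes "quot_norm x < e" shows "\<exists>A\<in>fsets. q (x * (1 - range_proj A)) < e"
proof -
  have ne: "fsets \<noteq> {}" by (auto intro!: exI[of _ "{}"])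
  have "bdd_below ((\<lambda>A. q (x * (1 - range_proj A))) ` fsets)" by (auto intro!: bdd_belowI2[of _ 0])
  then show ?thesis using cINF_less_iff[OF ne] assms unfolding quot_norm_def by blast
qed

lemma quot_norm_ge: "(\<And>A. finite A \<Longrightarrow> A \<subseteq> sink_paths \<Longrightarrow> c \<le> q (x * (1 - range_proj A))) \<Longrightarrow> c \<le> quot_norm x"
  unfolding quot_norm_def by (rule cINF_greatest) (auto intro!: exI[of _ "{}"])

lemma quot_norm_nonneg: "0 \<le> quot_norm x"
  by (rule quot_norm_ge) simp

lemma quot_norm_le_q: "quot_norm x \<le> q x"
  using quot_norm_le[of "{}" x] by (simp add: range_proj_def)

text \<open>The infimum in \<open>quot_norm\<close> is thus a limit along finite sets ordered by
  inclusion, and finitely many sets can be replaced by their union.\<close>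

lemma compl_antimono:
  assumes B: "finite B" "B \<subseteq> sink_paths" and AB: "A \<subseteq> B"
  shows "q (x * (1 - range_proj B)) \<le> q (x * (1 - range_proj A))"
proof -
  have "(1 - range_proj B - range_proj A) + range_proj A * range_proj B \<doteq> (1 - range_proj B - range_proj A) + range_proj A"
    by (intro eqv_add eqv_refl range_proj_mono' B AB)
  then have "(1 - range_proj A) * (1 - range_proj B) \<doteq> 1 - range_proj B" by (simp add: algebra_simps)
  then have "q (x * (1 - range_proj B)) = q (x * (1 - range_proj A) * (1 - range_proj B))"
    using eqv_q[OF eqv_mult_right] by (metis mult.assoc)
  also have "\<dots> \<le> q (x * (1 - range_proj A)) * 1"
    by (rule order_trans[OF q_mult mult_left_mono[OF q_compl[OF B] q_nonneg]])
  finally show ?thesis by simp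
qed

lemma quot_norm_add: "quot_norm (x + y) \<le> quot_norm x + quot_norm y"
proof (rule field_le_epsilon)
  fix e :: real assume e: "e > 0"
  obtain A where A: "A \<in> fsets" "q (x * (1 - range_proj A)) < quot_norm x + e / 2"
    using quot_norm_less[of x "quot_norm x + e / 2"] e by auto
  obtain B where B: "B \<in> fsets" "q (y * (1 - range_proj B)) < quot_norm y + e / 2"
    using quot_norm_less[of y "quot_norm y + e / 2"] e by auto
  have AB: "finite (A \<union> B)" "A \<union> B \<subseteq> sink_paths" using A B by auto
  have "quot_norm (x + y) \<le> q (x * (1 - range_proj (A \<union> B)) + y * (1 - range_proj (A \<union> B)))"
    using quot_norm_le[OF AB, of "x + y"] by (simp add: distrib_right)
  also have "\<dots> \<le> q (x * (1 - range_proj A)) + q (y * (1 - range_proj B))"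
    by (intro order_trans[OF q_add] add_mono compl_antimono[OF AB]) auto
  also have "\<dots> \<le> quot_norm x + quot_norm y + e" using A B by simp
  finally show "quot_norm (x + y) \<le> quot_norm x + quot_norm y + e" .
qed

lemma quot_norm_scale_le: "quot_norm (poly_scale c x) \<le> cmod c * quot_norm x"
proof (cases "c = 0")
  case False
  have "quot_norm (poly_scale c x) / cmod c \<le> quot_norm x"
  proof (rule quot_norm_ge)
    fix A assume "finite A" "A \<subseteq> sink_paths"
    from quot_norm_le[OF this, of "poly_scale c x"]
    show "quot_norm (poly_scale c x) / cmod c \<le> q (x * (1 - range_proj A))"
      using False by (simp add: poly_scale_mult_left q_scale pos_divide_le_eq mult.commute)
  qed
  then show ?thesis using False by (simp add: pos_divide_le_eq mult.commute)
next
  case True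
  then show ?thesis using quot_norm_le_q[of 0] by simp
qed

lemma quot_norm_scale: "quot_norm (poly_scale c x) = cmod c * quot_norm x"
proof (cases "c = 0")
  case True
  then show ?thesis using quot_norm_scale_le[of 0 x] quot_norm_nonneg[of 0] by simp
next
  case False
  have "quot_norm x \<le> inverse (cmod c) * quot_norm (poly_scale c x)"
    using quot_norm_scale_le[of "inverse c" "poly_scale c x"] False by (simp add: norm_inverse)
  then show ?thesis using quot_norm_scale_le[of c x] False by (simp add: field_simps)
qed

text \<open>Given \<open>A\<close>, enlarge \<open>B\<close> to a set \<open>D\<close> whose
  projection absorbs \<open>range_proj A * y\<close> from the right. Then
  \<open>x * y * (1 - range_proj D)\<close> equals
  \<open>x * (1 - range_proj A) * (y * (1 - range_proj D))\<close> modulo \<open>q\<close>.\<close>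

lemma quot_norm_mult: assumes y: "y \<in> Fr" shows "quot_norm (x * y) \<le> quot_norm x * quot_norm y"
proof -
  have 1: "quot_norm (x * y) \<le> q (x * (1 - range_proj A)) * q (y * (1 - range_proj B))"
    if A: "finite A" "A \<subseteq> sink_paths" and B: "finite B" "B \<subseteq> sink_paths" for A B
  proof -
    obtain C where C: "C \<in> fsets" "range_proj A * y * range_proj C \<doteq> range_proj A * y"
      using range_proj_absorb[OF y A(2)] by blast
    define D where "D = B \<union> C"
    have D: "finite D" "D \<subseteq> sink_paths" using B C by (auto simp: D_def)
    have "range_proj A * y * range_proj D \<doteq> (range_proj A * y * range_proj C) * range_proj D"
      by (intro eqv_mult_left eqv_sym[OF C(2)])
    also have "\<dots> = range_proj A * y * (range_proj C * range_proj D)" by (simp add: mult.assoc)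
    also have "\<dots> \<doteq> range_proj A * y * range_proj C"
      by (intro eqv_mult_right range_proj_mono' D) (simp add: D_def)
    also have "\<dots> \<doteq> range_proj A * y" by (rule C(2))
    finally have "range_proj A * y * range_proj D \<doteq> range_proj A * y" .
    then have "range_proj A * y * (1 - range_proj D) \<doteq> 0"
      unfolding right_diff_distrib mult_1_right eqv_diff_iff by (rule eqv_sym)
    then have "x * (range_proj A * y * (1 - range_proj D)) \<doteq> 0" by (rule eqv_mult_zero(2))
    then have "x * (1 - range_proj A) * (y * (1 - range_proj D)) + x * (range_proj A * y * (1 - range_proj D)) \<doteq>
      x * (1 - range_proj A) * (y * (1 - range_proj D)) + 0" by (intro eqv_add eqv_refl)
    then have "x * y * (1 - range_proj D) \<doteq> x * (1 - range_proj A) * (y * (1 - range_proj D))"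
      by (simp add: algebra_simps)
    then have "quot_norm (x * y) \<le> q (x * (1 - range_proj A) * (y * (1 - range_proj D)))"
      using quot_norm_le[OF D, of "x * y"] eqv_q by simp
    also have "\<dots> \<le> q (x * (1 - range_proj A)) * q (y * (1 - range_proj D))" by (rule q_mult)
    also have "\<dots> \<le> q (x * (1 - range_proj A)) * q (y * (1 - range_proj B))"
      by (intro mult_left_mono compl_antimono D) (simp_all add: D_def)
    finally show ?thesis .
  qed
  \<comment> \<open>The infimum over \<open>B\<close> is taken first and the one over
    \<open>A\<close> afterwards; a factor 0 is treated separately because the other one is divided
    out.\<close>
  have 2: "quot_norm (x * y) \<le> q (x * (1 - range_proj A)) * quot_norm y"
    if A: "finite A" "A \<subseteq> sink_paths" for A
  proof (cases "q (x * (1 - range_proj A)) = 0")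
    case True
    then show ?thesis using 1[OF A, of "{}"] by simp
  next
    case False
    then have p: "q (x * (1 - range_proj A)) > 0" using q_nonneg by (metis less_eq_real_def)
    then have "quot_norm (x * y) / q (x * (1 - range_proj A)) \<le> quot_norm y"
      by (intro quot_norm_ge) (simp add: pos_divide_le_eq mult.commute 1[OF A])
    then show ?thesis using p by (simp add: pos_divide_le_eq mult.commute)
  qed
  show ?thesis
  proof (cases "quot_norm y = 0")
    case True
    then show ?thesis using 2[of "{}"] by simp
  next
    case False
    then have p: "quot_norm y > 0" using quot_norm_nonneg by (metis less_eq_real_def)
    then have "quot_norm (x * y) / quot_norm y \<le> quot_norm x"
      by (intro quot_norm_ge) (simp add: pos_divide_le_eq 2)
    then show ?thesis using p by (simp add: pos_divide_le_eq)
  qed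
qed

lemma quot_norm_cstar_ge: "(quot_norm x)\<^sup>2 \<le> quot_norm (poly_star x * x)"
proof (rule quot_norm_ge)
  fix A assume A: "finite A" "A \<subseteq> sink_paths"
  have "(quot_norm x)\<^sup>2 \<le> (q (x * (1 - range_proj A)))\<^sup>2"
    by (intro power_mono quot_norm_le A quot_norm_nonneg)
  also have "\<dots> = q ((1 - range_proj A) * (poly_star x * x * (1 - range_proj A)))"
    by (simp add: q_cstar[symmetric] mult.assoc)
  also have "\<dots> \<le> 1 * q (poly_star x * x * (1 - range_proj A))"
    by (rule order_trans[OF q_mult mult_right_mono[OF q_compl[OF A] q_nonneg]])
  finally show "(quot_norm x)\<^sup>2 \<le> q (poly_star x * x * (1 - range_proj A))" by simp
qed

lemma quot_norm_star_le: assumes x: "x \<in> Fr" shows "quot_norm x \<le> quot_norm (poly_star x)"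
proof (cases "quot_norm x = 0")
  case False
  have "quot_norm x * quot_norm x \<le> quot_norm (poly_star x) * quot_norm x"
    using quot_norm_mult[OF x, of "poly_star x"] quot_norm_cstar_ge[of x] by (simp add: power2_eq_square)
  then show ?thesis using False quot_norm_nonneg[of x] by (simp add: less_eq_real_def)
qed (simp add: quot_norm_nonneg)

text \<open>Stated for subsets \<open>H\<close> because it is used twice: for the generators of
  \<open>E\<close> itself, and for those left without the sink, where it competes with their
  universal norm.\<close>

lemma cstar_seminorm_quot: assumes H: "H \<subseteq> graph_gens E" shows "cstar_seminorm H quot_norm"
proof -
  have sub: "free_star_algebra H \<subseteq> Fr" using H by (auto simp: free_star_algebra_def)
  have "quot_norm (poly_star x * x) = (quot_norm x)\<^sup>2" if x: "x \<in> Fr" for x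
  proof (rule antisym)
    have "quot_norm (poly_star x * x) \<le> quot_norm (poly_star x) * quot_norm x" by (rule quot_norm_mult[OF x])
    also have "\<dots> \<le> quot_norm x * quot_norm x"
      using quot_norm_star_le[OF free_star[OF x]] by (intro mult_right_mono quot_norm_nonneg) simp
    finally show "quot_norm (poly_star x * x) \<le> (quot_norm x)\<^sup>2" by (simp add: power2_eq_square)
  qed (rule quot_norm_cstar_ge)
  then show ?thesis using sub by (auto simp: cstar_seminorm_def quot_norm_add quot_norm_scale intro!: quot_norm_mult)
qed

lemma quot_norm_P: "quot_norm (pP vb) = 0"
  and quot_norm_S: "e \<in> arcs E \<Longrightarrow> head E e = vb \<Longrightarrow> quot_norm (pS e) = 0"
proof -
  \<comment> \<open>The empty path at the sink, whose range projection is \<open>pP vb\<close>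
    modulo \<open>q\<close>.\<close>
  let ?A = "{(vb, [])}"
  have A: "finite ?A" "?A \<subseteq> sink_paths" using vb by (auto simp: sink_paths_def)
  have pr: "range_proj ?A \<doteq> pP vb"
    using eqv_trans[OF eqv_mult_right[OF P_star[OF vb]] P_idem[OF vb]] by (simp add: range_proj_def)
  have *: "quot_norm x = 0" if "x * pP vb \<doteq> x" for x
  proof -
    have "x * range_proj ?A \<doteq> x" using eqv_trans[OF eqv_mult_right[OF pr] that] .
    then have "x * (1 - range_proj ?A) \<doteq> 0" by (simp add: right_diff_distrib eqv_diff_iff eqv_sym)
    then show ?thesis using quot_norm_le[OF A, of x] quot_norm_nonneg[of x] by (simp add: eqv_zero_iff)
  qed
  show "quot_norm (pP vb) = 0" by (rule *[OF P_idem[OF vb]])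
  show "quot_norm (pS e) = 0" if "e \<in> arcs E" "head E e = vb" using S_P[of e] that by (intro *) simp
qed

end

definition quot_sub :: "('v, 'e) pre_digraph \<Rightarrow> 'v \<Rightarrow> ('v, 'e) graph_gen \<Rightarrow> ('v, 'e) graph_gen star_poly" where
  "quot_sub E vb = case_graph_gen (\<lambda>v. if v = vb then 0 else pP v) (\<lambda>e. if head E e = vb then 0 else pS e)"

lemma quot_sub_simps [simp]:
  "quot_sub E vb (Vtx v) = (if v = vb then 0 else pP v)"
  "quot_sub E vb (Edg e) = (if head E e = vb then 0 else pS e)"
  by (simp_all add: quot_sub_def)

section \<open>Comparison with the graph without the sink\<close>

context sink_seminorm
begin

abbreviation "E2 \<equiv> pre_digraph.del_vert E vb"

lemma verts_E2: "verts E2 = verts E - {vb}"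
  and arcs_E2: "arcs E2 = {e \<in> arcs E. head E e \<noteq> vb}"
  and head_E2: "head E2 = head E" and tail_E2: "tail E2 = tail E"
  and out_E2: "v \<noteq> vb \<Longrightarrow> out_arcs E2 v = {e \<in> out_arcs E v. head E e \<noteq> vb}"
proof -
  have nt: "tail E e \<noteq> vb" if "e \<in> arcs E" for e using sink that by (auto simp: out_arcs_def)
  show "verts E2 = verts E - {vb}" "head E2 = head E" "tail E2 = tail E"
    by (simp_all add: pre_digraph.del_vert_def)
  show arcs: "arcs E2 = {e \<in> arcs E. head E e \<noteq> vb}"
    using nt by (auto simp: pre_digraph.del_vert_def)
  show "v \<noteq> vb \<Longrightarrow> out_arcs E2 v = {e \<in> out_arcs E v. head E e \<noteq> vb}"
    using nt by (auto simp: out_arcs_def pre_digraph.del_vert_def)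
qed

lemma gens_E2: "graph_gens E2 \<subseteq> graph_gens E"
  by (auto simp: graph_gens_def verts_E2 arcs_E2)

lemma fin_E2: "fin_digraph E2"
proof -
  interpret fin_digraph E by (rule fin)
  show ?thesis by (rule fin_digraph_del_vert)
qed

text \<open>Only the Cuntz-Krieger relations change when the sink is removed. They lose the edges
  into the sink, and the partial isometries of these edges have quotient norm 0.\<close>

lemma quot_norm_rel:
  assumes r: "r \<in> graph_rels E2" shows "quot_norm r = 0"
proof (rule antisym[OF _ quot_norm_nonneg])
  show "quot_norm r \<le> 0"
  proof (cases "r \<in> graph_rels E")
    case True
    then show ?thesis using quot_norm_le_q[of r] rel by simp
  next
    case False
    have "\<exists>v. v \<in> verts E2 \<and> out_arcs E2 v \<noteq> {} \<and> r = (\<Sum>e\<in>out_arcs E2 v. pS e * poly_star (pS e)) - pP v"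
      using r False unfolding graph_rels_def Un_iff mem_Collect_eq
      by (elim disjE) (auto simp: verts_E2 arcs_E2 head_E2 simp del: in_out_arcs_conv)
    then obtain v where v': "v \<in> verts E2" "out_arcs E2 v \<noteq> {}"
      "r = (\<Sum>e\<in>out_arcs E2 v. pS e * poly_star (pS e)) - pP v" by blast
    have "v \<in> verts E" "v \<noteq> vb" using v'(1) unfolding verts_E2 by simp_all
    note v = this v'(2,3)
    let ?t = "\<lambda>e. pS e * poly_star (pS e)" and ?I = "{e \<in> out_arcs E v. head E e = vb}"
    have out: "out_arcs E v = out_arcs E2 v \<union> ?I" "out_arcs E2 v \<inter> ?I = {}" unfolding out_E2[OF v(2)] by blast+
    have ne: "out_arcs E v \<noteq> {}" using v(3) out(1) by blast
    have "sum ?t (out_arcs E2 v \<union> ?I) = sum ?t (out_arcs E2 v) + sum ?t ?I"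
    proof (rule sum.union_disjoint[OF _ _ out(2)])
      show "finite (out_arcs E2 v)" "finite ?I"
        unfolding out_E2[OF v(2)] by (rule finite_subset[OF _ finite_out[of v]], blast)+
    qed
    then have s: "sum ?t (out_arcs E v) = sum ?t (out_arcs E2 v) + sum ?t ?I"
      by (simp only: out(1)[symmetric])
    have "a - p = (s - p) + - b" if "s = a + b" for s a b p :: "('v, 'e) graph_gen star_poly"
      using that by simp
    from this[OF s] have r_eq: "r = (sum ?t (out_arcs E v) - pP v) + poly_scale (-1) (sum ?t ?I)"
      unfolding v(4) poly_scale_minus_one .
    have "quot_norm r \<le> quot_norm (sum ?t (out_arcs E v) - pP v) + quot_norm (poly_scale (-1) (sum ?t ?I))"
      unfolding r_eq by (rule quot_norm_add)
    also have "quot_norm (sum ?t (out_arcs E v) - pP v) \<le> 0"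
      using quot_norm_le_q[of "sum ?t (out_arcs E v) - pP v"] CK[OF v(1) ne] by (simp add: eqv_def)
    also have "quot_norm (poly_scale (-1) (sum ?t ?I)) \<le> 0"
    proof -
      have "finite K \<Longrightarrow> K \<subseteq> ?I \<Longrightarrow> quot_norm (sum ?t K) \<le> 0" for K
      proof (induction K rule: finite_induct)
        case empty
        then show ?case using quot_norm_le_q[of 0] by simp
      next
        case (insert e K)
        then have e: "e \<in> arcs E" "head E e = vb" by simp_all
        have "quot_norm (?t e) \<le> quot_norm (pS e) * quot_norm (poly_star (pS e))"
          by (intro quot_norm_mult free_star pS_free e)
        then have "quot_norm (?t e) \<le> 0" using quot_norm_S[OF e] by simp
        then show ?case using insert quot_norm_add[of "?t e" "sum ?t K"] by simp
      qed
      moreover have "finite ?I" by (rule finite_subset[OF _ finite_out[of v]]) blast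
      ultimately have "quot_norm (sum ?t ?I) \<le> 0" by blast
      then show ?thesis by (simp only: quot_norm_scale) simp
    qed
    finally show ?thesis by simp
  qed
qed

lemma quot_sub_free: "g \<in> graph_gens E \<Longrightarrow> quot_sub E vb g \<in> free_star_algebra (graph_gens E2)"
  by (cases g) (auto simp: graph_gens_def verts_E2 arcs_E2 intro!: free_gen)

text \<open>The substitution changes generators only by elements of the ideal, and congruence modulo
  the ideal passes to sums and products.\<close>

lemma quot_norm_quot_sub:
  assumes x: "x \<in> Fr" shows "quot_norm (x - subst (quot_sub E vb) x) = 0"
proof -
  let ?k = "subst (quot_sub E vb)"
  have kF: "?k x \<in> Fr" if "x \<in> Fr" for x
    by (rule subst_free[OF _ that])
      (use quot_sub_free gens_E2 in \<open>auto simp: free_star_algebra_def\<close>)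
  have sn: "cstar_seminorm (graph_gens E) quot_norm" by (rule cstar_seminorm_quot) simp
  have z: "quot_norm 0 = 0" using quot_norm_scale[of 0 0] by simp
  have nz: "quot_norm x = 0" if "quot_norm x \<le> 0" for x using that quot_norm_nonneg[of x] by simp
  from x show ?thesis
  proof (induction rule: free_induct)
    case zero
    then show ?case by (simp add: z)
  next
    case (gen g)
    show ?case
    proof (cases g)
      case (Vtx v)
      then show ?thesis using quot_norm_P z by auto
    next
      case (Edg e)
      then have "e \<in> arcs E" using gen by (auto simp: graph_gens_def)
      then show ?thesis using Edg quot_norm_S z by auto
    qed
  next
    case (star x)
    then show ?case using sn_star[OF sn free_diff[OF star(1) kF[OF star(1)]]] by simp
  next
    case (add x y)
    have "quot_norm ((x - ?k x) + (y - ?k y)) \<le> 0"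
      using quot_norm_add[of "x - ?k x" "y - ?k y"] add by simp
    then show ?case by (intro nz) (simp add: algebra_simps)
  next
    case (scale c x)
    then show ?case by (simp add: poly_scale_diff_right[symmetric] quot_norm_scale)
  next
    case (mult x y)
    have "quot_norm ((x - ?k x) * y + ?k x * (y - ?k y)) \<le> 0"
    proof (rule order_trans[OF quot_norm_add])
      show "quot_norm ((x - ?k x) * y) + quot_norm (?k x * (y - ?k y)) \<le> 0"
        using quot_norm_mult[OF mult(2), of "x - ?k x"] quot_norm_mult[OF free_diff[OF mult(2) kF[OF mult(2)]], of "?k x"] mult
        by simp
    qed
    then show ?case by (intro nz) (simp add: algebra_simps)
  qed
qed

text \<open>The kernel of the map that kills the sink is no larger than the ideal:
  \<open>quot_norm\<close> kills the relations of \<open>E2\<close>, so the universal norm there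
  dominates it, and a polynomial with small image is close to an element of the ideal.\<close>

theorem quotient_approx:
  assumes x: "x \<in> Fr" and lt: "bounded_presentation.uq (graph_gens E2) (graph_rels E2) (subst (quot_sub E vb) x) < e"
  shows "\<exists>A. finite A \<and> A \<subseteq> sink_paths \<and> q (x - x * range_proj A) < e"
proof -
  interpret C: finite_graph E2 by (rule finite_graph.intro[OF fin_E2])
  let ?k = "subst (quot_sub E vb) x"
  have kF: "?k \<in> C.Fr" by (rule subst_free[OF quot_sub_free x])
  have "quot_norm x \<le> quot_norm (x - ?k) + quot_norm ?k" using quot_norm_add[of "x - ?k" ?k] by simp
  also have "\<dots> = quot_norm ?k" by (simp add: quot_norm_quot_sub[OF x])
  also have "\<dots> \<le> univ_norm (graph_gens E2) (graph_rels E2) ?k"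
    by (rule C.admissible_le_univ[OF cstar_seminorm_quot[OF gens_E2] _ kF]) (simp add: quot_norm_rel)
  also have "\<dots> = C.uq ?k" by (rule C.univ_norm_eq_uq[OF kF])
  also have "\<dots> < e" by (rule lt)
  finally obtain A where "A \<in> fsets" "q (x * (1 - range_proj A)) < e" using quot_norm_less by blast
  then show ?thesis by (auto simp: right_diff_distrib)
qed

end

section \<open>Homogeneous *-polynomials\<close>

definition hom_deg :: "int \<Rightarrow> ('v, 'e) graph_gen star_poly \<Rightarrow> bool" where
  "hom_deg d x \<longleftrightarrow> (\<forall>w\<in>Poly_Mapping.keys x. word_deg w = d)"

lemma word_deg_plus: "word_deg (u + v) = word_deg u + word_deg v"
  by (simp add: word_deg_def plus_star_word_def)

lemma word_deg_star: "word_deg (word_star w) = - word_deg w"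
proof -
  have neg: "letter_deg (case a of (g, b) \<Rightarrow> (g, \<not> b)) = - letter_deg a" for a :: "('v, 'e) graph_gen \<times> bool"
    by (cases a rule: letter_deg.cases) auto
  have "(\<Sum>a\<leftarrow>map (\<lambda>(g, b). (g, \<not> b)) l. letter_deg a) = - (\<Sum>a\<leftarrow>l. letter_deg a)"
    for l :: "(('v, 'e) graph_gen \<times> bool) list"
    by (induction l) (simp_all add: neg)
  then show ?thesis by (simp add: word_deg_def word_star_def rev_map[symmetric] sum_list_rev)
qed

lemma hom_deg_zero: "hom_deg d 0"
  by (simp add: hom_deg_def)

lemma hom_deg_add: "hom_deg d x \<Longrightarrow> hom_deg d y \<Longrightarrow> hom_deg d (x + y)"
  unfolding hom_deg_def using keys_add[of x y] by blast

lemma hom_deg_scale: "hom_deg d x \<Longrightarrow> hom_deg d (poly_scale c x)"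
  by (simp add: hom_deg_def in_keys_iff lookup_poly_scale)

lemma hom_deg_mult: "hom_deg d x \<Longrightarrow> hom_deg k y \<Longrightarrow> hom_deg (d + k) (x * y)"
  unfolding hom_deg_def using keys_mult[of x y] by (auto simp: word_deg_plus dest!: subsetD)

lemma hom_deg_star: assumes "hom_deg d x" shows "hom_deg (- d) (poly_star x)"
  unfolding hom_deg_def
proof
  fix w assume "w \<in> Poly_Mapping.keys (poly_star x)"
  then have "word_star w \<in> Poly_Mapping.keys x" by (simp add: in_keys_iff lookup_poly_star)
  then have "word_deg (word_star w) = d" using assms unfolding hom_deg_def by blast
  then show "word_deg w = - d" by (simp add: word_deg_star)
qed

lemma hom_deg_P: "hom_deg 0 (pP v)" and hom_deg_S: "hom_deg 1 (pS e)"
  by (simp_all add: hom_deg_def poly_gen_def word_deg_def)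

lemma hom_deg_power: "hom_deg 1 x \<Longrightarrow> hom_deg (int n) (x ^ n)"
proof (induction n)
  case 0
  then show ?case by (simp add: hom_deg_def word_deg_def zero_star_word_def)
next
  case (Suc n)
  then show ?case using hom_deg_mult[of 1 x "int n" "x ^ n"] by simp
qed

lemma hom_deg_path: "hom_deg (int (length p)) (path_elt E v p)"
proof (induction p arbitrary: v)
  case Nil
  then show ?case by (simp add: hom_deg_P)
next
  case (Cons e p)
  then show ?case using hom_deg_mult[OF hom_deg_S[of e] Cons] by simp
qed

section \<open>Composition of substitution homomorphisms\<close>

text \<open>The composite is named by any \<open>u\<close> that agrees with it on generators, so
  that explicit substitutions can be recognised as composites.\<close>

lemma presentation_hom_comp:
  assumes t: "presentation_hom G R H S t" and s: "presentation_hom H S K T s"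
    and u: "\<And>g. g \<in> G \<Longrightarrow> u g = subst s (t g)"
  shows "presentation_hom G R K T u"
proof -
  interpret t: presentation_hom G R H S t by fact
  interpret s: presentation_hom H S K T s by fact
  show ?thesis
  proof
    show "u g \<in> free_star_algebra K" if "g \<in> G" for g using that by (simp add: u s.subst_closed t.t_free)
    fix r assume r: "r \<in> R"
    then have rF: "r \<in> t.A.F" using t.A.R_free by blast
    have "s.B.uq (subst u r) = s.B.uq (subst s (subst t r))"
      by (simp add: subst_subst subst_cong[OF rF u])
    also have "\<dots> \<le> t.B.uq (subst t r)" by (rule s.subst_le[OF t.subst_closed[OF rF]])
    also have "\<dots> = 0" by (rule t.t_rel[OF r])
    finally show "s.B.uq (subst u r) = 0" using s.B.q_nonneg[of "subst u r"] by simp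
  qed
qed

lemma hom_comp:
  assumes t: "presentation_hom G R H S t" and s: "presentation_hom H S K T s"
    and u: "\<And>g. g \<in> G \<Longrightarrow> u g = subst s (t g)" and X: "X \<in> car (univ_cstar G R)"
  shows "presentation_hom.hom G R K T u X = presentation_hom.hom H S K T s (presentation_hom.hom G R H S t X)"
proof -
  interpret t: presentation_hom G R H S t by fact
  interpret s: presentation_hom H S K T s by fact
  interpret u: presentation_hom G R K T u by (rule presentation_hom_comp[OF t s u])
  obtain x where x: "t.A.Cau x" "X = t.A.cl x" using X by (rule t.A.carE)
  have "subst u (x n) = subst s (subst t (x n))" for n
    using subst_cong[OF t.A.Cau_free[OF x(1)] u] by (simp add: subst_subst)
  then show ?thesis by (simp add: x t.hom_cl u.hom_cl s.hom_cl t.subst_Cau)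
qed

section \<open>Trimmable graphs\<close>

text \<open>This is f followed by evaluation at the point \<open>z\<close> of the circle;
  \<open>theta_sub vb eb 1\<close> is the map g of the overview.\<close>

definition theta_sub :: "'v \<Rightarrow> 'e \<Rightarrow> complex \<Rightarrow> ('v, 'e) graph_gen \<Rightarrow> ('v, 'e) graph_gen star_poly" where
  "theta_sub vb eb z = case_graph_gen pP (\<lambda>e. poly_scale z (if e = eb then pP vb else pS e))"

lemma theta_sub_simps [simp]:
  "theta_sub vb eb z (Vtx v) = pP v"
  "theta_sub vb eb z (Edg e) = poly_scale z (if e = eb then pP vb else pS e)"
  by (simp_all add: theta_sub_def)

locale trimmable_graph =
  fixes E :: "('v, 'e) pre_digraph" and vb :: 'v and eb :: 'e
  assumes trim: "trimmable E vb eb"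
begin

abbreviation "E1 \<equiv> trim1 E eb"
abbreviation "E2 \<equiv> trim2 E vb eb"

lemma fin_E: "fin_digraph E" and vb_V: "vb \<in> verts E" and eb_A: "eb \<in> arcs E"
  and tail_eb: "tail E eb = vb" and head_eb: "head E eb = vb" and out_vb: "out_arcs E vb = {eb}"
  and T2: "v \<in> tail E ` (in_arcs E vb - {eb}) \<Longrightarrow> out_arcs E v - in_arcs E vb \<noteq> {}"
  using trim by (auto simp: trimmable_def)

lemma E1_simps [simp]: "verts E1 = verts E" "arcs E1 = arcs E - {eb}" "tail E1 = tail E" "head E1 = head E"
  by (simp_all add: pre_digraph.del_arc_def)

lemma fin_E1: "fin_digraph E1"
proof -
  interpret fin_digraph E by (rule fin_E)
  show ?thesis by (rule fin_digraph_del_arc)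
qed

lemma out_E1: "out_arcs E1 v = (if v = vb then {} else out_arcs E v)"
  using out_vb tail_eb by (auto simp: out_arcs_def)

lemma gens_E1: "graph_gens E1 \<subseteq> graph_gens E"
  by (auto simp: graph_gens_def)

lemma free_E1: "x \<in> free_star_algebra (graph_gens E1) \<Longrightarrow> x \<in> free_star_algebra (graph_gens E)"
  using gens_E1 by (auto simp: free_star_algebra_def)

end

sublocale trimmable_graph \<subseteq> A: finite_graph E
  by (rule finite_graph.intro[OF fin_E])

sublocale trimmable_graph \<subseteq> B: finite_graph E1
  by (rule finite_graph.intro[OF fin_E1])

text \<open>By (T1) only the loop leaves \<open>vb\<close>, so its removal turns \<open>vb\<close>
  into a sink.\<close>

sublocale trimmable_graph \<subseteq> B: sink_seminorm B.uq E1 vb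
proof (intro sink_seminorm.intro B.graph_seminorm_axioms sink_seminorm_axioms.intro)
  show "vb \<in> verts E1" by (simp add: vb_V)
  show "out_arcs E1 vb = {}" by (simp only: out_E1) simp
qed

sublocale trimmable_graph \<subseteq> C: finite_graph E2
  by (rule finite_graph.intro[OF B.fin_E2])

context trimmable_graph
begin

abbreviation "theta \<equiv> theta_sub vb eb"
abbreviation "kappa \<equiv> quot_sub E1 vb"

subsection \<open>The maps of the square\<close>

text \<open>A projection is a partial isometry with itself as source and range projection, so it can
  take the place of the loop: the Cuntz-Krieger relation at \<open>vb\<close>, whose only edge is
  the loop, holds. The other vertices emit the same edges in both graphs.\<close>

lemma theta1_hom:
  "presentation_hom (graph_gens E) (graph_rels E) (graph_gens E1) (graph_rels E1) (theta 1)"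
proof (intro presentation_hom.intro presentation_hom_axioms.intro A.bounded_presentation_axioms B.bounded_presentation_axioms)
  show "theta 1 g \<in> B.Fr" if "g \<in> graph_gens E" for g
    using that vb_V by (cases g) (auto simp: graph_gens_def intro!: free_gen)
  show "B.uq (subst (theta 1) r) = 0" if "r \<in> graph_rels E" for r
  proof (rule B.subst_graph_rels[OF _ _ _ _ _ _ that])
    fix v assume "v \<in> verts E"
    then show "B.eqv (poly_star (theta 1 (Vtx v))) (theta 1 (Vtx v))"
      "B.eqv (theta 1 (Vtx v) * theta 1 (Vtx v)) (theta 1 (Vtx v))"
      by (simp_all add: B.P_star B.P_idem)
  next
    fix v w assume "v \<in> verts E" "w \<in> verts E" "v \<noteq> w"
    then show "B.eqv (theta 1 (Vtx v) * theta 1 (Vtx w)) 0" by (simp add: B.P_orth)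
  next
    have PP: "B.eqv (pP vb * poly_star (pP vb)) (pP vb)" "B.eqv (poly_star (pP vb) * pP vb) (pP vb)"
      using B.eqv_trans[OF B.eqv_mult_right[OF B.P_star] B.P_idem, of vb]
        B.eqv_trans[OF B.eqv_mult_left[OF B.P_star] B.P_idem, of vb] vb_V by simp_all
    {
      fix e assume e: "e \<in> arcs E"
      have "B.eqv (pP vb * poly_star (pP vb) * pP vb) (pP vb)"
        using B.eqv_trans[OF B.eqv_mult_left[OF PP(1)] B.P_idem] vb_V by simp
      then show "B.eqv (theta 1 (Edg e) * poly_star (theta 1 (Edg e)) * theta 1 (Edg e)) (theta 1 (Edg e))"
        using e B.S_partial[of e] by simp
      show "B.eqv (poly_star (theta 1 (Edg e)) * theta 1 (Edg e)) (theta 1 (Vtx (head E e)))"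
        using e B.S_source[of e] PP(2) head_eb by simp
    next
      fix v assume v: "v \<in> verts E" "out_arcs E v \<noteq> {}"
      show "B.eqv (\<Sum>e\<in>out_arcs E v. theta 1 (Edg e) * poly_star (theta 1 (Edg e))) (theta 1 (Vtx v))"
      proof (cases "v = vb")
        case True
        then show ?thesis using PP(1) by (simp add: out_vb)
      next
        case False
        have "(\<Sum>e\<in>out_arcs E v. theta 1 (Edg e) * poly_star (theta 1 (Edg e))) =
            (\<Sum>e\<in>out_arcs E1 v. pS e * poly_star (pS e))"
          using False tail_eb by (intro sum.cong) (auto simp: out_E1)
        moreover have "out_arcs E1 v \<noteq> {}" using v False by (simp only: out_E1) simp
        ultimately show ?thesis using B.CK[of v] v(1) by simp
      qed
    }
  qed
qed

text \<open>Evaluating f at \<open>z\<close> is applying the gauge action and then evaluating at 1.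
  This equivariance reduces every point of the circle to the point 1.\<close>

lemma theta_gauge: "theta z g = subst (theta 1) (gauge_sub z g)"
  by (cases g) simp_all

lemma theta_hom:
  "cmod z = 1 \<Longrightarrow> presentation_hom (graph_gens E) (graph_rels E) (graph_gens E1) (graph_rels E1) (theta z)"
  by (rule presentation_hom_comp[OF A.gauge_hom theta1_hom theta_gauge])

lemma kappa_hom:
  "presentation_hom (graph_gens E1) (graph_rels E1) (graph_gens E2) (graph_rels E2) kappa"
proof (intro presentation_hom.intro presentation_hom_axioms.intro B.bounded_presentation_axioms C.bounded_presentation_axioms)
  show "kappa g \<in> C.Fr" if "g \<in> graph_gens E1" for g using that by (rule B.quot_sub_free)
  have VV: "v \<in> verts E2" if "v \<in> verts E1" "v \<noteq> vb" for v using that unfolding B.verts_E2 by simp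
  have AA: "e \<in> arcs E2" if "e \<in> arcs E1" "head E1 e \<noteq> vb" for e using that unfolding B.arcs_E2 by simp
  show "C.uq (subst kappa r) = 0" if "r \<in> graph_rels E1" for r
  proof (rule C.subst_graph_rels[OF _ _ _ _ _ _ that])
    fix v assume "v \<in> verts E1"
    then show "C.eqv (poly_star (kappa (Vtx v))) (kappa (Vtx v))"
      "C.eqv (kappa (Vtx v) * kappa (Vtx v)) (kappa (Vtx v))"
      using C.P_star[OF VV] C.P_idem[OF VV] by simp_all
  next
    fix v w assume vw: "v \<in> verts E1" "w \<in> verts E1" "v \<noteq> w"
    then show "C.eqv (kappa (Vtx v) * kappa (Vtx w)) 0"
      using C.P_orth[OF VV VV, of v w] by auto
  next
    fix e assume e: "e \<in> arcs E1"
    then show "C.eqv (kappa (Edg e) * poly_star (kappa (Edg e)) * kappa (Edg e)) (kappa (Edg e))"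
      using C.S_partial[OF AA[OF e]] by simp
    show "C.eqv (poly_star (kappa (Edg e)) * kappa (Edg e)) (kappa (Vtx (head E1 e)))"
      using C.S_source[OF AA[OF e]] by (simp add: B.head_E2)
  next
    fix v assume v: "v \<in> verts E1" "out_arcs E1 v \<noteq> {}"
    then have nv: "v \<noteq> vb" using B.sink by blast
    \<comment> \<open>Here (T2) is used. If all edges of \<open>v\<close> ended in
      \<open>vb\<close>, the left side of its Cuntz-Krieger relation would become 0 while
      \<open>pP v\<close> is kept.\<close>
    have ne: "out_arcs E2 v \<noteq> {}"
    proof
      assume "out_arcs E2 v = {}"
      then have all: "head E e = vb" if "e \<in> out_arcs E1 v" for e
        using that unfolding B.out_E2[OF nv] by auto
      obtain e where e: "e \<in> out_arcs E1 v" using v by blast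
      then have "e \<in> in_arcs E vb - {eb}" "v = tail E e" using all[OF e] by auto
      then obtain e' where e': "e' \<in> out_arcs E v" "e' \<notin> in_arcs E vb" using T2[of v] by blast
      then have "e' \<in> out_arcs E1 v" unfolding out_E1 using nv by simp
      then have "head E e' = vb" by (rule all)
      then show False using e' by (simp add: in_arcs_def)
    qed
    have "(\<Sum>e\<in>out_arcs E1 v. kappa (Edg e) * poly_star (kappa (Edg e))) =
        (\<Sum>e\<in>out_arcs E2 v. pS e * poly_star (pS e))"
      unfolding B.out_E2[OF nv] using B.finite_out[of v]
      by (intro sum.mono_neutral_cong_right) auto
    then show "C.eqv (\<Sum>e\<in>out_arcs E1 v. kappa (Edg e) * poly_star (kappa (Edg e))) (kappa (Vtx v))"
      using C.CK[OF VV[OF v(1) nv] ne] nv by simp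
  qed
qed

text \<open>The source of commutativity of the square: the loop ends in \<open>vb\<close>, so it is
  killed on the left, and on the right it is first turned into the projection of \<open>vb\<close>,
  which is then killed.\<close>

lemma kappa_theta: "quot_sub E vb g = subst kappa (theta 1 g)"
  by (cases g) (simp_all add: head_eb)

lemma kappaE_hom:
  "presentation_hom (graph_gens E) (graph_rels E) (graph_gens E2) (graph_rels E2) (quot_sub E vb)"
  by (rule presentation_hom_comp[OF theta1_hom kappa_hom kappa_theta])

end

sublocale trimmable_graph \<subseteq> th: presentation_hom "graph_gens E" "graph_rels E" "graph_gens E1" "graph_rels E1" "theta 1"
  by (rule theta1_hom)

sublocale trimmable_graph \<subseteq> ka: presentation_hom "graph_gens E1" "graph_rels E1" "graph_gens E2" "graph_rels E2" kappa
  by (rule kappa_hom)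

context trimmable_graph
begin

lemma pi2_eq: "pi2 E vb eb = ka.hom"
  unfolding pi2_def quot_map_def graph_hom_def C.graph_cstar_UA
proof (rule ka.univ_hom_eq)
  fix g assume "g \<in> graph_gens E1"
  show "case_graph_gen (\<lambda>v. if v = vb then czero C.UA else gP E2 v)
      (\<lambda>e. if head E1 e = vb then czero C.UA else gS E2 e) g = C.cl (\<lambda>n. kappa g)"
    by (cases g) (simp_all add: C.czero_cl C.gP_cl C.gS_cl)
qed

lemma pi1_eq: "X \<in> car A.UA \<Longrightarrow> pi1 E vb eb X = ka.hom (th.hom X)"
proof -
  assume X: "X \<in> car A.UA"
  interpret h: presentation_hom "graph_gens E" "graph_rels E" "graph_gens E2" "graph_rels E2" "quot_sub E vb"
    by (rule kappaE_hom)
  have "pi1 E vb eb = h.hom"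
    unfolding pi1_def quot_map_def graph_hom_def C.graph_cstar_UA
  proof (rule h.univ_hom_eq)
    fix g assume "g \<in> graph_gens E"
    show "case_graph_gen (\<lambda>v. if v = vb then czero C.UA else gP E2 v)
        (\<lambda>e. if head E e = vb then czero C.UA else gS E2 e) g = C.cl (\<lambda>n. quot_sub E vb g)"
      by (cases g) (simp_all add: C.czero_cl C.gP_cl C.gS_cl)
  qed
  then show ?thesis using hom_comp[OF theta1_hom kappa_hom kappa_theta X] by simp
qed

lemma kappa_gauge: "subst (gauge_sub z) (subst kappa x) = subst kappa (subst (gauge_sub z) x)"
proof -
  have "subst (gauge_sub z) (kappa g) = subst kappa (gauge_sub z g)" for g
    by (cases g) simp_all
  then show ?thesis by (simp add: subst_subst)
qed

lemma pi1_gauge_fixed: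
  assumes X: "X \<in> car (gauge_fixed E)" shows "pi1 E vb eb X \<in> car (gauge_fixed E2)"
proof -
  interpret h: presentation_hom "graph_gens E" "graph_rels E" "graph_gens E2" "graph_rels E2" "quot_sub E vb"
    by (rule kappaE_hom)
  have XU: "X \<in> car A.UA" using X by (simp add: A.car_gauge_fixed)
  then obtain x where x: "A.Cau x" "X = A.cl x" by (rule A.carE)
  have pi: "pi1 E vb eb Y = h.hom Y" if "Y \<in> car A.UA" for Y
    using pi1_eq[OF that] hom_comp[OF theta1_hom kappa_hom kappa_theta that] by simp
  have k: "subst (gauge_sub z) (subst (quot_sub E vb) y) = subst (quot_sub E vb) (subst (gauge_sub z) y)" for z y
  proof -
    have "subst (gauge_sub z) (quot_sub E vb g) = subst (quot_sub E vb) (gauge_sub z g)" for g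
      by (cases g) simp_all
    then show ?thesis by (simp add: subst_subst)
  qed
  have "gauge E2 z (h.hom X) = h.hom X" if z: "cmod z = 1" for z
  proof -
    have gx: "A.Cau (\<lambda>n. subst (gauge_sub z) (x n))"
      using presentation_hom.subst_Cau[OF A.gauge_hom[OF z] x(1)] .
    have "gauge E2 z (h.hom X) = h.hom (gauge E z X)"
      by (simp add: x(2) h.hom_cl[OF x(1)] h.hom_cl[OF gx] C.gauge_cl[OF z h.subst_Cau[OF x(1)]]
          A.gauge_cl[OF z x(1)] k)
    also have "gauge E z X = X" using X z by (simp add: A.car_gauge_fixed)
    finally show ?thesis .
  qed
  moreover have "h.hom X \<in> car C.UA" by (rule star_homD(1)[OF h.star_hom_hom XU])
  ultimately show ?thesis by (simp add: pi[OF XU] C.car_gauge_fixed)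
qed

subsection \<open>The map into the tensor product\<close>

abbreviation thz :: "complex \<Rightarrow> (nat \<Rightarrow> ('v, 'e) graph_gen star_poly) set \<Rightarrow> (nat \<Rightarrow> ('v, 'e) graph_gen star_poly) set" where
  "thz z \<equiv> presentation_hom.hom (graph_gens E) (graph_rels E) (graph_gens E1) (graph_rels E1) (theta z)"

text \<open>The explicit candidate for f, as a function on the circle whose value at
  \<open>z\<close> is the homomorphism given by \<open>theta z\<close>.\<close>

definition tensor_hom :: "(nat \<Rightarrow> ('v, 'e) graph_gen star_poly) set \<Rightarrow> complex \<Rightarrow> (nat \<Rightarrow> ('v, 'e) graph_gen star_poly) set" where
  "tensor_hom = (\<lambda>X\<in>car A.UA. \<lambda>z\<in>sphere 0 1. thz z X)"

text \<open>The universal property of the map into the tensor product is checked at each point of the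
  circle, so the tensor product itself need not be shown to be a C*-algebra; boundedness only
  ensures that the supremum norm of its elements is not a junk value.\<close>

lemma alg_tensor_bounded:
  assumes "F \<in> alg_tensor_circle B.UA"
  shows "\<exists>M. \<forall>z\<in>sphere 0 1. F z \<in> car B.UA \<and> cnorm B.UA (F z) \<le> M"
  using assms
proof induction
  case (elem a g)
  interpret U: cstar_algebra B.UA by (rule B.cstar_algebra_UA)
  have "bounded (g ` sphere 0 1)"
    by (intro compact_imp_bounded compact_continuous_image elem(2) compact_sphere)
  then obtain C where C: "\<And>z. z \<in> sphere 0 1 \<Longrightarrow> cmod (g z) \<le> C" unfolding bounded_iff by blast
  have "elem_tensor B.UA a g z \<in> car B.UA \<and> cnorm B.UA (elem_tensor B.UA a g z) \<le> C * cnorm B.UA a"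
    if "z \<in> sphere 0 1" for z
    using C[OF that] elem(1) that unfolding elem_tensor_def
    by (simp add: U.norm_scale U.scale_closed mult_right_mono U.norm_nonneg)
  then show ?case by blast
next
  case (add F H)
  interpret U: cstar_algebra B.UA by (rule B.cstar_algebra_UA)
  obtain M N where "\<forall>z\<in>sphere 0 1. F z \<in> car B.UA \<and> cnorm B.UA (F z) \<le> M"
    "\<forall>z\<in>sphere 0 1. H z \<in> car B.UA \<and> cnorm B.UA (H z) \<le> N" using add by blast
  then have "cadd B.UA (F z) (H z) \<in> car B.UA \<and> cnorm B.UA (cadd B.UA (F z) (H z)) \<le> M + N"
    if "z \<in> sphere 0 1" for z
    using that U.norm_triangle[of "F z" "H z"] U.add_closed[of "F z" "H z"] by fastforce
  then show ?case by (intro exI[of _ "M + N"]) simp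
qed

text \<open>An element is within 1 of a bounded function, hence bounded, so its supremum norm does
  bound its values. This makes evaluation at a point contractive, as \<open>hom_unique\<close>
  requires.\<close>

lemma tensor_norm_bound:
  assumes F: "F \<in> car (tensor_circle B.UA)" and z: "z \<in> sphere 0 1"
  shows "F z \<in> car B.UA" "cnorm B.UA (F z) \<le> cnorm (tensor_circle B.UA) F"
proof -
  interpret U: cstar_algebra B.UA by (rule B.cstar_algebra_UA)
  have Fz: "F z \<in> car B.UA" if "z \<in> sphere 0 1" for z using F that by (auto simp: tensor_circle_def)
  then show "F z \<in> car B.UA" using z .
  obtain H where H: "H \<in> alg_tensor_circle B.UA" "\<forall>z\<in>sphere 0 1. cnorm B.UA (csub B.UA (F z) (H z)) < 1"
    using F unfolding tensor_circle_def by (auto dest: spec[of _ "1::real"])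
  obtain M where M: "\<forall>z\<in>sphere 0 1. H z \<in> car B.UA \<and> cnorm B.UA (H z) \<le> M"
    using alg_tensor_bounded[OF H(1)] by blast
  have "cnorm B.UA (F w) \<le> 1 + M" if w: "w \<in> sphere 0 1" for w
  proof -
    have Hw: "H w \<in> car B.UA" using M w by blast
    have "cnorm B.UA (F w) \<le> cnorm B.UA (csub B.UA (F w) (H w)) + cnorm B.UA (H w)"
      using U.norm_triangle[OF U.sub_closed[OF Fz[OF w] Hw] Hw] U.sub_add_cancel[OF Fz[OF w] Hw] by simp
    also have "\<dots> \<le> 1 + M" using H(2) M w by (intro add_mono) (auto intro: less_imp_le)
    finally show ?thesis .
  qed
  then have "bdd_above ((\<lambda>w. cnorm B.UA (F w)) ` sphere 0 1)" by (intro bdd_aboveI2)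
  then show "cnorm B.UA (F z) \<le> cnorm (tensor_circle B.UA) F"
    unfolding tensor_circle_def cstar_alg.simps using z by (rule cSUP_upper2) simp
qed

lemma thz_cl: "cmod z = 1 \<Longrightarrow> A.Cau x \<Longrightarrow> thz z (A.cl x) = B.cl (\<lambda>n. subst (theta z) (x n))"
  by (rule presentation_hom.hom_cl[OF theta_hom])

lemma word_val_theta: "cmod z = 1 \<Longrightarrow> word_val (theta z) w = poly_scale (z powi word_deg w) (word_val (theta 1) w)"
proof -
  assume z: "cmod z = 1"
  have "subst (theta z) (Poly_Mapping.single w 1) = subst (theta 1) (subst (gauge_sub z) (Poly_Mapping.single w 1))"
    by (simp only: subst_subst theta_gauge[symmetric])
  then show ?thesis by (simp add: word_val_gauge[OF z])
qed

text \<open>A word of degree \<open>d\<close> contributes its value at 1 times the continuous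
  function sending \<open>z\<close> to its power with exponent \<open>d\<close>. A polynomial
  therefore gives a finite sum of elementary tensors.\<close>

lemma tensor_hom_const:
  assumes x: "x \<in> A.Fr"
  shows "(\<lambda>z\<in>sphere 0 1. thz z (A.cl (\<lambda>_. x))) \<in> alg_tensor_circle B.UA"
proof -
  have w: "word_val (theta 1) w \<in> B.Fr" if "w \<in> Poly_Mapping.keys x" for w
    using that x by (intro word_val_free[of "graph_gens E", OF th.t_free]) (auto simp: free_star_algebra_def)
  let ?t = "\<lambda>z w. poly_scale (Poly_Mapping.lookup x w) (word_val (theta z) w)"
  have tF: "?t z w \<in> B.Fr" if "w \<in> Poly_Mapping.keys x" "cmod z = 1" for z w
    unfolding word_val_theta[OF that(2)] by (intro free_scale w that)
  have "finite K \<Longrightarrow> K \<subseteq> Poly_Mapping.keys x \<Longrightarrow>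
      (\<lambda>z\<in>sphere 0 1. B.cl (\<lambda>_. \<Sum>w\<in>K. ?t z w)) \<in> alg_tensor_circle B.UA" for K
  proof (induction K rule: finite_induct)
    case empty
    have "elem_tensor B.UA (B.cl (\<lambda>_. 0)) (\<lambda>z. 1) \<in> alg_tensor_circle B.UA"
      by (intro alg_tensor_circle.elem B.car_cl) auto
    moreover have "elem_tensor B.UA (B.cl (\<lambda>_. 0)) (\<lambda>z. 1) = (\<lambda>z\<in>sphere 0 1. B.cl (\<lambda>_. 0))"
      by (simp add: elem_tensor_def B.cscale_cl)
    ultimately show ?case by (simp only: sum.empty)
  next
    case (insert w K)
    let ?a = "B.cl (\<lambda>_. ?t 1 w)"
    have wk: "w \<in> Poly_Mapping.keys x" "K \<subseteq> Poly_Mapping.keys x" using insert by auto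
    have KF: "(\<Sum>w\<in>K. ?t z w) \<in> B.Fr" if "cmod z = 1" for z
      using wk that by (intro free_sum tF) auto
    have "elem_tensor B.UA ?a (\<lambda>z. z powi word_deg w) \<in> alg_tensor_circle B.UA"
      by (intro alg_tensor_circle.elem B.car_cl B.Cau_const tF wk continuous_intros) auto
    from alg_tensor_circle.add[OF this insert.IH[OF wk(2)]]
    have mem: "(\<lambda>z\<in>sphere 0 1. cadd B.UA (elem_tensor B.UA ?a (\<lambda>z. z powi word_deg w) z)
        ((\<lambda>z\<in>sphere 0 1. B.cl (\<lambda>_. \<Sum>w\<in>K. ?t z w)) z)) \<in> alg_tensor_circle B.UA" .
    have "cadd B.UA (elem_tensor B.UA ?a (\<lambda>z. z powi word_deg w) z)
        ((\<lambda>z\<in>sphere 0 1. B.cl (\<lambda>_. \<Sum>w\<in>K. ?t z w)) z) = B.cl (\<lambda>_. \<Sum>w\<in>insert w K. ?t z w)"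
      if z: "z \<in> sphere 0 1" for z
    proof -
      have cz: "cmod z = 1" using z by simp
      have "elem_tensor B.UA ?a (\<lambda>z. z powi word_deg w) z = B.cl (\<lambda>_. ?t z w)"
        using z tF[OF wk(1), of 1]
        by (simp add: elem_tensor_def B.cscale_cl word_val_theta[OF cz, of w] mult.commute)
      then show ?thesis using z insert(1,2) tF[OF wk(1) cz] KF[OF cz] by (simp add: B.cadd_cl)
    qed
    then have "(\<lambda>z\<in>sphere 0 1. cadd B.UA (elem_tensor B.UA ?a (\<lambda>z. z powi word_deg w) z)
        ((\<lambda>z\<in>sphere 0 1. B.cl (\<lambda>_. \<Sum>w\<in>K. ?t z w)) z)) = (\<lambda>z\<in>sphere 0 1. B.cl (\<lambda>_. \<Sum>w\<in>insert w K. ?t z w))"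
      by (intro restrict_ext)
    then show ?case using mem by (simp only:)
  qed
  from this[OF finite_keys order_refl]
  have "(\<lambda>z\<in>sphere 0 1. B.cl (\<lambda>_. subst (theta z) x)) \<in> alg_tensor_circle B.UA" by (simp only: subst_def)
  moreover have "(\<lambda>z\<in>sphere 0 1. B.cl (\<lambda>_. subst (theta z) x)) = (\<lambda>z\<in>sphere 0 1. thz z (A.cl (\<lambda>_. x)))"
    by (rule restrict_ext) (simp add: thz_cl x)
  ultimately show ?thesis by (simp only:)
qed

lemma thz_props:
  assumes "z \<in> sphere 0 1"
  shows "star_hom A.UA B.UA (thz z)" "X \<in> car A.UA \<Longrightarrow> cnorm B.UA (thz z X) \<le> cnorm A.UA X"
  using presentation_hom.star_hom_hom[OF theta_hom[of z]]
    presentation_hom.hom_contractive[OF theta_hom[of z]] assms by simp_all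

text \<open>All evaluations are contractive, so approximation of \<open>X\<close> by a polynomial is
  uniform over the circle.\<close>

lemma tensor_hom_car: assumes X: "X \<in> car A.UA" shows "tensor_hom X \<in> car (tensor_circle B.UA)"
proof -
  interpret UA: cstar_algebra A.UA by (rule A.cstar_algebra_UA)
  have "\<exists>H\<in>alg_tensor_circle B.UA. \<forall>z\<in>sphere 0 1. cnorm B.UA (csub B.UA (tensor_hom X z) (H z)) < e"
    if e: "e > 0" for e :: real
  proof -
    obtain x where x: "A.Cau x" "X = A.cl x" using X by (rule A.carE)
    obtain n where n: "cnorm A.UA (csub A.UA X (A.cl (\<lambda>_. x n))) < e"
      using A.dense[OF x(1) e] x(2) by blast
    have xn: "x n \<in> A.Fr" by (rule A.Cau_free[OF x(1)])
    then have Y: "A.cl (\<lambda>_. x n) \<in> car A.UA" by (simp add: A.car_cl)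
    have "cnorm B.UA (csub B.UA (tensor_hom X z) ((\<lambda>z\<in>sphere 0 1. thz z (A.cl (\<lambda>_. x n))) z)) < e"
      if z: "z \<in> sphere 0 1" for z
      using star_hom_sub[OF thz_props(1)[OF z] A.cstar_algebra_UA X Y]
        thz_props(2)[OF z UA.sub_closed[OF X Y]] n z X by (simp add: tensor_hom_def)
    then show ?thesis using tensor_hom_const[OF xn] by blast
  qed
  moreover have "tensor_hom X \<in> sphere 0 1 \<rightarrow>\<^sub>E car B.UA"
    using X star_homD(1)[OF thz_props(1)] by (auto simp: tensor_hom_def)
  ultimately show ?thesis by (simp add: tensor_circle_def)
qed

lemma star_hom_tensor_hom: "star_hom A.UA (tensor_circle B.UA) tensor_hom"
proof -
  interpret UA: cstar_algebra A.UA by (rule A.cstar_algebra_UA)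
  show ?thesis
    unfolding star_hom_def
  proof (intro conjI ballI allI tensor_hom_car)
    fix X Y c assume X: "X \<in> car A.UA" and Y: "Y \<in> car A.UA"
    show "tensor_hom (cadd A.UA X Y) = cadd (tensor_circle B.UA) (tensor_hom X) (tensor_hom Y)"
      using X Y star_homD(2)[OF thz_props(1) X Y] by (auto simp: tensor_hom_def tensor_circle_def UA.add_closed intro!: restrict_ext)
    show "tensor_hom (cmul A.UA X Y) = cmul (tensor_circle B.UA) (tensor_hom X) (tensor_hom Y)"
      using X Y star_homD(4)[OF thz_props(1) X Y] by (auto simp: tensor_hom_def tensor_circle_def UA.mul_closed intro!: restrict_ext)
  next
    fix X c assume X: "X \<in> car A.UA"
    show "tensor_hom (cscale A.UA c X) = cscale (tensor_circle B.UA) c (tensor_hom X)"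
      using X star_homD(3)[OF thz_props(1) X] by (auto simp: tensor_hom_def tensor_circle_def UA.scale_closed intro!: restrict_ext)
    show "tensor_hom (cstar A.UA X) = cstar (tensor_circle B.UA) (tensor_hom X)"
      using X star_homD(5)[OF thz_props(1) X] by (auto simp: tensor_hom_def tensor_circle_def UA.star_closed intro!: restrict_ext)
  qed
qed

lemma tensor_hom_contractive:
  assumes X: "X \<in> car A.UA"
  shows "cnorm (tensor_circle B.UA) (tensor_hom X) \<le> cnorm A.UA X"
  unfolding tensor_circle_def cstar_alg.simps
proof (rule cSUP_least)
  show "sphere (0::complex) 1 \<noteq> {}" by simp
  show "cnorm B.UA (tensor_hom X z) \<le> cnorm A.UA X" if "z \<in> sphere 0 1" for z
    using thz_props(2)[OF that X] that X by (simp add: tensor_hom_def)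
qed

definition tensor_gen :: "('v, 'e) graph_gen \<Rightarrow> complex \<Rightarrow> (nat \<Rightarrow> ('v, 'e) graph_gen star_poly) set" where
  "tensor_gen = case_graph_gen (\<lambda>v. elem_tensor B.UA (gP E1 v) (\<lambda>z. 1))
      (\<lambda>e. elem_tensor B.UA (if e = eb then gP E1 vb else gS E1 e) (\<lambda>z. z))"

lemma thz_gen:
  assumes g: "g \<in> graph_gens E" and z: "z \<in> sphere 0 1"
  shows "thz z (univ_gen (graph_gens E) (graph_rels E) g) = tensor_gen g z"
proof -
  have "thz z (univ_gen (graph_gens E) (graph_rels E) g) = B.cl (\<lambda>_. theta z g)"
    using z by (intro presentation_hom.hom_gen[OF theta_hom g]) simp
  also have "\<dots> = tensor_gen g z"
  proof (cases g)
    case (Vtx v)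
    then have "pP v \<in> B.Fr" using g by (intro pP_free) (auto simp: graph_gens_def)
    then show ?thesis using Vtx z by (simp add: tensor_gen_def elem_tensor_def B.gP_cl B.cscale_cl)
  next
    case (Edg e)
    then have "e \<noteq> eb \<Longrightarrow> pS e \<in> B.Fr" using g by (intro pS_free) (auto simp: graph_gens_def)
    moreover have "pP vb \<in> B.Fr" by (intro pP_free) (simp add: vb_V)
    ultimately show ?thesis using Edg z by (simp add: tensor_gen_def elem_tensor_def B.gP_cl B.gS_cl B.cscale_cl)
  qed
  finally show ?thesis .
qed

lemma f_map_eq: "f_map E vb eb = tensor_hom"
proof -
  have "f_map E vb eb = univ_hom (graph_gens E) (graph_rels E) (tensor_circle B.UA) tensor_gen"
    by (simp add: f_map_def Let_def graph_hom_def B.graph_cstar_UA tensor_gen_def)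
  also have "\<dots> = tensor_hom"
    unfolding univ_hom_def
  proof (rule the_equality, intro conjI ballI)
    show "tensor_hom \<in> extensional (car A.UA)" by (simp add: tensor_hom_def)
    show "star_hom A.UA (tensor_circle B.UA) tensor_hom" by (rule star_hom_tensor_hom)
    show "cnorm (tensor_circle B.UA) (tensor_hom x) \<le> cnorm A.UA x" if "x \<in> car A.UA" for x
      by (rule tensor_hom_contractive[OF that])
    fix g assume g: "g \<in> graph_gens E"
    have "tensor_hom (univ_gen (graph_gens E) (graph_rels E) g) = (\<lambda>z\<in>sphere 0 1. tensor_gen g z)"
      using g by (auto simp: tensor_hom_def univ_gen_def A.car_cl free_gen thz_gen[unfolded univ_gen_def] intro!: restrict_ext)
    also have "\<dots> = tensor_gen g"
      by (cases g) (auto simp: tensor_gen_def elem_tensor_def intro!: restrict_ext)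
    finally show "tensor_hom (univ_gen (graph_gens E) (graph_rels E) g) = tensor_gen g" .
  next
    fix \<phi> assume p: "\<phi> \<in> extensional (car A.UA) \<and> star_hom A.UA (tensor_circle B.UA) \<phi> \<and>
       (\<forall>x\<in>car A.UA. cnorm (tensor_circle B.UA) (\<phi> x) \<le> cnorm A.UA x) \<and>
       (\<forall>g\<in>graph_gens E. \<phi> (univ_gen (graph_gens E) (graph_rels E) g) = tensor_gen g)"
    then have ph: "star_hom A.UA (tensor_circle B.UA) \<phi>" by blast
    note pD = star_homD[OF ph]
    show "\<phi> = tensor_hom"
    proof (rule extensionalityI[of _ "car A.UA"])
      fix X assume X: "X \<in> car A.UA"
      have "\<phi> X z = thz z X" if z: "z \<in> sphere 0 1" for z
      proof (rule A.hom_unique[OF B.cstar_algebra_UA _ thz_props(1)[OF z] _ thz_props(2)[OF z] _ X])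
        show "star_hom A.UA B.UA (\<lambda>X. \<phi> X z)"
          unfolding star_hom_def using z tensor_norm_bound(1)[OF pD(1) z] pD(2-5)
          by (simp add: tensor_circle_def)
        show "cnorm B.UA (\<phi> Y z) \<le> cnorm A.UA Y" if Y: "Y \<in> car A.UA" for Y
          using tensor_norm_bound(2)[OF pD(1)[OF Y] z] p Y by (meson order_trans)
        show "\<phi> (univ_gen (graph_gens E) (graph_rels E) g) z = thz z (univ_gen (graph_gens E) (graph_rels E) g)"
          if "g \<in> graph_gens E" for g
          using p thz_gen[OF that z] that by simp
      qed
      moreover have "\<phi> X \<in> sphere 0 1 \<rightarrow>\<^sub>E car B.UA" using pD(1)[OF X] by (simp add: tensor_circle_def)
      ultimately show "\<phi> X = tensor_hom X"
        using X by (intro extensionalityI[of _ "sphere 0 1"]) (auto simp: tensor_hom_def PiE_def)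
    qed (use p in \<open>auto simp: tensor_hom_def\<close>)
  qed
  finally show ?thesis .
qed

text \<open>By equivariance the value of f at \<open>z\<close> is the value at 1 of the rotated
  element, and \<open>X\<close> is not moved by the rotation. So the function is constant, and its
  constant value is the unique \<open>b\<close>.\<close>

lemma f_fixed_eq:
  assumes X: "X \<in> car (gauge_fixed E)" shows "f_fixed E vb eb X = th.hom X"
proof -
  interpret U: cstar_algebra B.UA by (rule B.cstar_algebra_UA)
  have XU: "X \<in> car A.UA" using X by (simp add: A.car_gauge_fixed)
  have gX: "th.hom X \<in> car B.UA" by (rule star_homD(1)[OF th.star_hom_hom XU])
  have "thz z X = th.hom X" if z: "z \<in> sphere 0 1" for z
  proof -
    have cz: "cmod z = 1" using z by simp
    have "thz z X = th.hom (gauge E z X)"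
      unfolding A.gauge_eq[OF cz]
      by (rule hom_comp[OF A.gauge_hom[OF cz] theta1_hom theta_gauge XU])
    then show ?thesis using X z by (simp add: A.car_gauge_fixed)
  qed
  then have "(\<lambda>z\<in>sphere 0 1. thz z X) = (\<lambda>z\<in>sphere 0 1. th.hom X)" by (rule restrict_ext)
  then have fX: "f_map E vb eb X = (\<lambda>z\<in>sphere 0 1. th.hom X)"
    unfolding f_map_eq tensor_hom_def by (simp only: restrict_apply' XU)
  have el: "elem_tensor B.UA b (\<lambda>z. 1) = (\<lambda>z\<in>sphere 0 1. b)" if "b \<in> car B.UA" for b
    using that by (simp add: elem_tensor_def U.scale_one)
  have "(THE b. b \<in> car B.UA \<and> elem_tensor B.UA b (\<lambda>z. 1) = f_map E vb eb X) = th.hom X"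
  proof (rule the_equality)
    show "th.hom X \<in> car B.UA \<and> elem_tensor B.UA (th.hom X) (\<lambda>z. 1) = f_map E vb eb X"
      using gX by (simp add: el fX)
    fix b assume b: "b \<in> car B.UA \<and> elem_tensor B.UA b (\<lambda>z. 1) = f_map E vb eb X"
    then have "(\<lambda>z\<in>sphere 0 1. b) = (\<lambda>z\<in>sphere (0::complex) 1. th.hom X)"
      using el[of b] fX by (metis (no_types))
    from fun_cong[OF this, of 1] show "b = th.hom X" by simp
  qed
  then show ?thesis using X by (simp add: f_fixed_def Let_def B.graph_cstar_UA)
qed

subsection \<open>Isometry and surjectivity\<close>

text \<open>As \<open>vb\<close> is a sink of \<open>E1\<close>, its Cuntz-Krieger relation is
  simply absent there; the other vertices emit the same edges in both graphs.\<close>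

lemma rels_E1: "graph_rels E1 \<subseteq> graph_rels E"
proof -
  have "v \<noteq> vb \<and> out_arcs E1 v = out_arcs E v" if "out_arcs E1 v \<noteq> {}" for v
    using that out_E1[of v] by (cases "v = vb") auto
  then have "{(\<Sum>e\<in>out_arcs E1 v. pS e * poly_star (pS e)) - pP v | v. v \<in> verts E1 \<and> out_arcs E1 v \<noteq> {}}
     \<subseteq> {(\<Sum>e\<in>out_arcs E v. pS e * poly_star (pS e)) - pP v | v. v \<in> verts E \<and> out_arcs E v \<noteq> {}}"
    by (smt (verit) Collect_mono E1_simps(1))
  then show ?thesis unfolding graph_rels_def E1_simps by blast
qed

text \<open>The pullback of the norm of C*(E') is compared with the norm of C*(E) on degree 0. For
  the vertex projections: the relations of E' hold in C*(E), so by maximality its norm is bounded by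
  the one of C*(E') on the generators of E'.\<close>

lemma theta_isometric:
  assumes x: "x \<in> A.Fr" and deg: "hom_deg 0 x"
  shows "B.uq (subst (theta 1) x) = A.uq x"
proof -
  let ?q = "\<lambda>x. B.uq (subst (theta 1) x)"
  have 2: "graph_seminorm ?q E"
    by (intro graph_seminorm.intro graph_seminorm_axioms.intro B.cseminorm_subst fin_E th.t_rel)
  have "A.uq x = ?q x"
  proof (rule deg_zero_seminorm_unique[OF A.graph_seminorm_axioms 2 th.subst_le _ x])
    fix v assume v: "v \<in> verts E"
    have "A.uq (pP v) \<le> B.uq (pP v)"
      by (rule B.uq_max[OF A.cseminorm_axioms]) (use rels_E1 v in \<open>auto intro!: A.uq_rel pP_free\<close>)
    then show "A.uq (pP v) \<le> ?q (pP v)" by simp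
  qed (use deg in \<open>auto simp: hom_deg_def\<close>)
  then show ?thesis by simp
qed

lemma theta_id: assumes "x \<in> B.Fr" shows "subst (theta 1) x = x"
proof -
  have "subst (theta 1) x = subst poly_gen x"
  proof (rule subst_cong[OF assms])
    show "theta 1 g = poly_gen g" if "g \<in> graph_gens E1" for g
      using that by (cases g) (auto simp: graph_gens_def)
  qed
  then show ?thesis by simp
qed

text \<open>The lift is asked to have degree 0, which makes it gauge invariant and lets
  \<open>theta_isometric\<close> control its norm.\<close>

definition lifts :: "('v, 'e) graph_gen star_poly \<Rightarrow> bool" where
  "lifts y \<longleftrightarrow> (\<exists>x\<in>A.Fr. hom_deg 0 x \<and> B.eqv y (subst (theta 1) x))"

lemma lifts_add: "lifts x \<Longrightarrow> lifts y \<Longrightarrow> lifts (x + y)"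
  unfolding lifts_def using B.eqv_add by (metis free_add hom_deg_add subst_add)

lemma lifts_scale: assumes "lifts y" shows "lifts (poly_scale c y)"
proof -
  obtain x where x: "x \<in> A.Fr" "hom_deg 0 x" "B.eqv y (subst (theta 1) x)"
    using assms unfolding lifts_def by blast
  show ?thesis unfolding lifts_def
    by (intro bexI[of _ "poly_scale c x"] conjI hom_deg_scale free_scale x)
      (simp add: B.eqv_scale x)
qed

lemma lifts_deg_zero: "x \<in> B.Fr \<Longrightarrow> hom_deg 0 x \<Longrightarrow> lifts x"
  unfolding lifts_def using free_E1[of x] by (intro bexI[of _ x]) (simp_all add: theta_id)

text \<open>A path to \<open>vb\<close> is prolonged by the loop to equalize degrees.\<close>

lemma lifts_path:
  assumes a: "a \<in> B.sink_paths" and b: "b \<in> B.sink_paths"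
  shows "lifts (B.sp b * poly_star (B.sp a))"
proof -
  let ?l = "\<lambda>a n. B.sp a * pS eb ^ n"
  have spF: "B.sp c \<in> A.Fr" if "c \<in> B.sink_paths" for c using free_E1[OF B.sp_free[OF that]] .
  have lF: "?l c n \<in> A.Fr" if "c \<in> B.sink_paths" for c n
  proof (induction n)
    case (Suc n)
    have "B.sp c * pS eb ^ n * pS eb \<in> A.Fr" by (intro free_mult Suc pS_free eb_A)
    then show ?case by (simp only: power_Suc2 mult.assoc)
  qed (simp add: spF that)
  have lth: "B.eqv (subst (theta 1) (?l c n)) (B.sp c)" if c: "c \<in> B.sink_paths" for c n
  proof (induction n)
    case 0
    then show ?case by (simp add: theta_id[OF B.sp_free[OF c]])
  next
    case (Suc n)
    have "B.eqv (subst (theta 1) (?l c n) * pP vb) (B.sp c * pP vb)" by (rule B.eqv_mult_left[OF Suc])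
    then have "B.eqv (subst (theta 1) (?l c n) * pP vb) (B.sp c)" using B.eqv_trans B.sp_P[OF c] by blast
    then show ?case by (simp only: power_Suc2 mult.assoc[symmetric] subst_mult subst_gen theta_sub_simps) simp
  qed
  \<comment> \<open>Each path is prolonged by as many loops as the other one has edges, so both
    reach the sum of the lengths. The loops become copies of \<open>pP vb\<close>, absorbed at the
    end of the path.\<close>
  let ?x = "?l b (length (snd a)) * poly_star (?l a (length (snd b)))"
  have deg: "hom_deg (int (length (snd c)) + int n) (?l c n)" for c n
    by (intro hom_deg_mult hom_deg_path hom_deg_power hom_deg_S)
  have "hom_deg 0 ?x"
    using hom_deg_mult[OF deg[of b "length (snd a)"] hom_deg_star[OF deg[of a "length (snd b)"]]] by simp
  moreover have "?x \<in> A.Fr" by (intro free_mult free_star lF a b)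
  moreover have "B.eqv (subst (theta 1) ?x) (B.sp b * poly_star (B.sp a))"
    unfolding subst_mult[of _ "?l b (length (snd a))"] subst_star by (intro B.eqv_mult B.eqv_star lth a b)
  ultimately show ?thesis unfolding lifts_def using B.eqv_sym by blast
qed

lemma lifts_ideal:
  assumes "x \<in> B.Fr" "finite K" "K \<subseteq> B.sink_paths"
  shows "lifts (x * B.range_proj K)"
  using assms
proof (induction rule: B.ideal_induct)
  case zero
  show ?case by (rule lifts_deg_zero) (simp_all add: hom_deg_zero)
next
  case (path a b)
  then show ?case by (rule lifts_path)
next
  case (add x y)
  then show ?case by (rule lifts_add)
next
  case (scale c x)
  then show ?case by (rule lifts_scale)
next
  case (eqv x y)
  then show ?case unfolding lifts_def using B.eqv_trans by blast
qed

text \<open>Near \<open>b\<close> take a polynomial \<open>p\<close>. Its degree 0 part lifts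
  verbatim, and the rest has small image in C*(E''), since the image of \<open>p\<close> is near a
  gauge-invariant element. So the rest is close to an element of the ideal, which lifts as
  well.\<close>

lemma lift_approx:
  assumes b: "b \<in> car B.UA" and fx: "ka.hom b \<in> car (gauge_fixed E2)" and e: "e > 0"
  shows "\<exists>x\<in>A.Fr. hom_deg 0 x \<and> cnorm B.UA (csub B.UA b (B.cl (\<lambda>_. subst (theta 1) x))) < e"
proof -
  interpret U: cstar_algebra B.UA by (rule B.cstar_algebra_UA)
  obtain y where y: "B.Cau y" "b = B.cl y" using b by (rule B.carE)
  obtain n where n: "cnorm B.UA (csub B.UA b (B.cl (\<lambda>_. y n))) < e / 4"
    using B.dense[OF y(1), of "e / 4"] e y(2) by auto
  define p where "p = y n"
  have pF: "p \<in> B.Fr" unfolding p_def by (rule B.Cau_free[OF y(1)])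
  have pc: "B.cl (\<lambda>_. p) \<in> car B.UA" by (simp add: B.car_cl pF)
  have near: "cnorm C.UA (csub C.UA (ka.hom b) (C.cl (\<lambda>_. subst kappa p))) < e / 4"
    using star_hom_sub[OF ka.star_hom_hom B.cstar_algebra_UA b pc] ka.hom_contractive[OF U.sub_closed[OF b pc]] n[folded p_def]
    by (simp add: ka.hom_cl pF)
  have "C.uq (subst kappa (p - deg_zero_part p)) \<le> 2 * (e / 4)"
  proof (rule deg_zero_part_approx[OF C.cseminorm_subst])
    fix z :: complex assume z: "cmod z = 1"
    show "C.uq (subst kappa (p - subst (gauge_sub z) p)) \<le> 2 * (e / 4)"
      using C.fixed_seminorm_bound[OF fx ka.subst_closed[OF pF] near z] by (simp add: kappa_gauge)
  qed
  \<comment> \<open>The distance \<open>e / 4\<close> is doubled by the displacement;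
    \<open>3 * e / 4\<close> leaves room for strictness and adds up to \<open>e\<close> with the
    first \<open>e / 4\<close>.\<close>
  then have lt: "C.uq (subst kappa (p - deg_zero_part p)) < 3 * e / 4" using e by simp
  have wF: "p - deg_zero_part p \<in> B.Fr" by (intro free_diff pF deg_zero_part_free)
  obtain K where K: "finite K" "K \<subseteq> B.sink_paths"
    "B.uq (p - deg_zero_part p - (p - deg_zero_part p) * B.range_proj K) < 3 * e / 4"
    using B.quotient_approx[OF wF lt] by blast
  have "lifts (deg_zero_part p + (p - deg_zero_part p) * B.range_proj K)"
    by (intro lifts_add lifts_ideal lifts_deg_zero wF K deg_zero_part_free pF)
      (simp add: hom_deg_def deg_zero_part_deg)
  then obtain x where x: "x \<in> A.Fr" "hom_deg 0 x"
    "B.eqv (deg_zero_part p + (p - deg_zero_part p) * B.range_proj K) (subst (theta 1) x)"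
    unfolding lifts_def by blast
  have xF: "subst (theta 1) x \<in> B.Fr" by (rule th.subst_closed[OF x(1)])
  have "B.uq (p - subst (theta 1) x) = B.uq (p - (deg_zero_part p + (p - deg_zero_part p) * B.range_proj K))"
    by (rule B.eqv_q[OF B.eqv_diff[OF B.eqv_refl B.eqv_sym[OF x(3)]]])
  then have "B.uq (p - subst (theta 1) x) < 3 * e / 4" using K(3) by (simp add: diff_diff_eq)
  then have "cnorm B.UA (csub B.UA (B.cl (\<lambda>_. p)) (B.cl (\<lambda>_. subst (theta 1) x))) < 3 * e / 4"
    by (simp add: B.csub_cl pF xF B.cnorm_const free_diff)
  then have "cnorm B.UA (csub B.UA b (B.cl (\<lambda>_. subst (theta 1) x))) < e"
    using U.norm_sub_triangle[OF b pc B.car_cl[OF B.Cau_const[OF xF]]] n[folded p_def] by simp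
  then show ?thesis using x by blast
qed

lemma th_const: "x \<in> A.Fr \<Longrightarrow> th.hom (A.cl (\<lambda>_. x)) = B.cl (\<lambda>_. subst (theta 1) x)"
  by (simp add: th.hom_cl)

text \<open>Isometry on polynomials of degree 0 extends to the fixed-point algebra, in which they
  are dense.\<close>

lemma th_isometric:
  assumes X: "X \<in> car (gauge_fixed E)" shows "cnorm A.UA X \<le> cnorm B.UA (th.hom X)"
proof (rule field_le_epsilon)
  interpret U: cstar_algebra A.UA by (rule A.cstar_algebra_UA)
  interpret V: cstar_algebra B.UA by (rule B.cstar_algebra_UA)
  fix e :: real assume e: "e > 0"
  obtain x where x: "x \<in> A.Fr" "hom_deg 0 x" "cnorm A.UA (csub A.UA X (A.cl (\<lambda>_. x))) < e / 2"
    using A.fixed_approx[OF X, of "e / 2"] e unfolding hom_deg_def by auto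
  let ?x = "A.cl (\<lambda>_. x)"
  have c: "X \<in> car A.UA" "?x \<in> car A.UA" using X x by (simp_all add: A.car_gauge_fixed A.car_cl)
  note gc = star_homD(1)[OF th.star_hom_hom c(1)] star_homD(1)[OF th.star_hom_hom c(2)]
  have "cnorm A.UA X \<le> cnorm A.UA (csub A.UA X ?x) + cnorm A.UA ?x"
    using U.norm_triangle[OF U.sub_closed[OF c] c(2)] U.sub_add_cancel[OF c] by simp
  also have "cnorm A.UA ?x = cnorm B.UA (th.hom ?x)"
    using x by (simp add: th_const A.cnorm_const B.cnorm_const th.subst_closed theta_isometric)
  also have "\<dots> \<le> cnorm B.UA (csub B.UA (th.hom ?x) (th.hom X)) + cnorm B.UA (th.hom X)"
    using V.norm_triangle[OF V.sub_closed[OF gc(2,1)] gc(1)] V.sub_add_cancel[OF gc(2,1)] by simp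
  also have "cnorm B.UA (csub B.UA (th.hom ?x) (th.hom X)) \<le> cnorm A.UA (csub A.UA X ?x)"
    using star_hom_sub[OF th.star_hom_hom A.cstar_algebra_UA c(2,1)] th.hom_contractive[OF U.sub_closed[OF c(2,1)]]
      U.norm_sub_commute[OF c] by simp
  finally show "cnorm A.UA X \<le> cnorm B.UA (th.hom X) + e" using x(3) by simp
qed

lemma th_inj:
  assumes X: "X \<in> car (gauge_fixed E)" and Y: "Y \<in> car (gauge_fixed E)" and eq: "th.hom X = th.hom Y"
  shows "X = Y"
proof -
  interpret U: cstar_algebra A.UA by (rule A.cstar_algebra_UA)
  interpret V: cstar_algebra B.UA by (rule B.cstar_algebra_UA)
  interpret W: cstar_algebra "gauge_fixed E" by (rule A.cstar_algebra_gauge_fixed)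
  have c: "X \<in> car A.UA" "Y \<in> car A.UA" using X Y by (simp_all add: A.car_gauge_fixed)
  have "csub (gauge_fixed E) X Y = csub A.UA X Y"
    by (simp add: csub_def gauge_fixed_def A.graph_cstar_UA)
  then have "csub A.UA X Y \<in> car (gauge_fixed E)" using W.sub_closed[OF X Y] by simp
  from th_isometric[OF this] have "cnorm A.UA (csub A.UA X Y) \<le> cnorm B.UA (csub B.UA (th.hom X) (th.hom Y))"
    using star_hom_sub[OF th.star_hom_hom A.cstar_algebra_UA c] by simp
  also have "\<dots> = 0"
    using V.sub_self[OF star_homD(1)[OF th.star_hom_hom c(2)]] by (simp add: eq V.norm_zero)
  finally have "cnorm A.UA (csub A.UA X Y) = 0" using U.norm_nonneg[OF U.sub_closed[OF c]] by simp
  then show ?thesis by (rule U.eq_if_norm_sub_zero[OF c])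
qed

text \<open>The approximate lifts of \<open>b\<close> have degree 0, and so do their differences. By
  isometry their distances in C*(E) are those of their images, so they form a Cauchy sequence, whose
  class is the lift.\<close>

lemma th_surj:
  assumes b: "b \<in> car B.UA" and fx: "ka.hom b \<in> car (gauge_fixed E2)"
  shows "\<exists>X\<in>car (gauge_fixed E). th.hom X = b"
proof -
  interpret U: cstar_algebra A.UA by (rule A.cstar_algebra_UA)
  interpret V: cstar_algebra B.UA by (rule B.cstar_algebra_UA)
  let ?g = "\<lambda>x. B.cl (\<lambda>_. subst (theta 1) x)"
  have "\<forall>n. \<exists>x. x \<in> A.Fr \<and> hom_deg 0 x \<and> cnorm B.UA (csub B.UA b (?g x)) < inverse (real (Suc n))"
    using lift_approx[OF b fx] by (metis inverse_positive_iff_positive of_nat_0_less_iff zero_less_Suc)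
  then obtain x where "\<forall>n. x n \<in> A.Fr \<and> hom_deg 0 (x n) \<and> cnorm B.UA (csub B.UA b (?g (x n))) < inverse (real (Suc n))"
    by (rule exE[OF choice])
  then have x: "\<And>n. x n \<in> A.Fr" "\<And>n. hom_deg 0 (x n)" "\<And>n. cnorm B.UA (csub B.UA b (?g (x n))) < inverse (real (Suc n))"
    by auto
  have gc: "?g (x n) \<in> car B.UA" for n by (simp add: B.car_cl th.subst_closed x)
  have d: "A.uq (x m - x n) < inverse (real (Suc m)) + inverse (real (Suc n))" for m n
  proof -
    have "x m - x n = x m + poly_scale (-1) (x n)" by (simp add: poly_scale_minus_one)
    then have "hom_deg 0 (x m - x n)" using hom_deg_add[OF x(2) hom_deg_scale[OF x(2)]] by (simp only:)
    then have "A.uq (x m - x n) = B.uq (subst (theta 1) (x m) - subst (theta 1) (x n))"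
      using theta_isometric[of "x m - x n"] x by (simp add: free_diff)
    also have "\<dots> = cnorm B.UA (csub B.UA (?g (x m)) (?g (x n)))"
      by (simp add: B.csub_cl th.subst_closed x B.cnorm_const free_diff)
    also have "\<dots> \<le> cnorm B.UA (csub B.UA (?g (x m)) b) + cnorm B.UA (csub B.UA b (?g (x n)))"
      by (rule V.norm_sub_triangle[OF gc b gc])
    also have "\<dots> < inverse (real (Suc m)) + inverse (real (Suc n))"
      using x(3) V.norm_sub_commute[OF gc b] by (intro add_strict_mono) simp_all
    finally show ?thesis .
  qed
  have Cx: "A.Cau x"
    unfolding A.Cau_iff
  proof (intro conjI allI impI x(1))
    fix e :: real assume e: "e > 0"
    obtain N where N: "\<And>n. n \<ge> N \<Longrightarrow> inverse (real (Suc n)) < e / 2"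
      using LIMSEQ_D[OF LIMSEQ_inverse_real_of_nat, of "e/2"] e by auto
    show "\<exists>N. \<forall>m\<ge>N. \<forall>n\<ge>N. A.uq (x m - x n) < e"
    proof (intro exI[of _ N] allI impI)
      fix m n assume "N \<le> m" "N \<le> n"
      then show "A.uq (x m - x n) < e" using d[of m n] N[of m] N[of n] by linarith
    qed
  qed
  have Xf: "A.cl x \<in> car (gauge_fixed E)"
    using x(2) by (intro A.deg_zero_fixed[OF Cx]) (auto simp: hom_deg_def)
  obtain y where y: "B.Cau y" "b = B.cl y" using b by (rule B.carE)
  have gX: "th.hom (A.cl x) \<in> car B.UA" by (rule star_homD(1)[OF th.star_hom_hom A.car_cl[OF Cx]])
  have "cnorm B.UA (csub B.UA (th.hom (A.cl x)) b) \<le> 0"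
  proof (rule field_le_epsilon)
    fix e :: real assume e: "e > 0"
    obtain N where N: "\<And>n. n \<ge> N \<Longrightarrow> inverse (real (Suc n)) < e / 4"
      using LIMSEQ_D[OF LIMSEQ_inverse_real_of_nat, of "e/4"] e by auto
    have lim: "(\<lambda>j. A.uq (x j - x N)) \<longlonglongrightarrow> cnorm A.UA (csub A.UA (A.cl x) (A.cl (\<lambda>_. x N)))"
      by (simp add: A.csub_cl A.cnorm_cl A.Cau_diff Cx x)
    have "A.uq (x j - x N) \<le> e / 2" if "j \<ge> N" for j
      using d[of j N] N[of j] N[of N] that by linarith
    then have "\<forall>\<^sub>F j in sequentially. A.uq (x j - x N) \<le> e / 2" unfolding eventually_sequentially by blast
    then have 1: "cnorm A.UA (csub A.UA (A.cl x) (A.cl (\<lambda>_. x N))) \<le> e / 2"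
      by (rule tendsto_upperbound[OF lim]) simp
    have xc: "A.cl (\<lambda>_. x N) \<in> car A.UA" by (simp add: A.car_cl x)
    have "cnorm B.UA (csub B.UA (th.hom (A.cl x)) (?g (x N))) \<le> e / 2"
      using star_hom_sub[OF th.star_hom_hom A.cstar_algebra_UA A.car_cl[OF Cx] xc]
        th.hom_contractive[OF U.sub_closed[OF A.car_cl[OF Cx] xc]] 1 by (simp add: th_const x)
    moreover have "cnorm B.UA (csub B.UA (?g (x N)) b) < e / 4"
      using x(3)[of N] N[of N] V.norm_sub_commute[OF gc b] by simp
    ultimately show "cnorm B.UA (csub B.UA (th.hom (A.cl x)) b) \<le> 0 + e"
      using V.norm_sub_triangle[OF gX gc b, of N] e by simp
  qed
  then have "th.hom (A.cl x) = b"
    using V.norm_nonneg[OF V.sub_closed[OF gX b]] by (intro V.eq_if_norm_sub_zero[OF gX b]) simp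
  then show ?thesis using Xf by blast
qed

subsection \<open>The pullback\<close>

lemma gauge_fixed_ops:
  "czero (gauge_fixed E) = czero A.UA" "cadd (gauge_fixed E) = cadd A.UA" "cscale (gauge_fixed E) = cscale A.UA"
  "cmul (gauge_fixed E) = cmul A.UA" "cstar (gauge_fixed E) = cstar A.UA"
  "czero (gauge_fixed E2) = czero C.UA" "cadd (gauge_fixed E2) = cadd C.UA" "cscale (gauge_fixed E2) = cscale C.UA"
  "cmul (gauge_fixed E2) = cmul C.UA" "cstar (gauge_fixed E2) = cstar C.UA"
  by (simp_all add: gauge_fixed_def A.graph_cstar_UA C.graph_cstar_UA)

lemma pullback:
  "cstar_pullback (gauge_fixed E) (gauge_fixed E2) (graph_cstar E1) (graph_cstar E2)
    (pi1_fixed E vb eb) (f_fixed E vb eb) (\<lambda>x. x) (pi2 E vb eb)"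
proof -
  interpret W: cstar_algebra "gauge_fixed E" by (rule A.cstar_algebra_gauge_fixed)
  let ?A = "gauge_fixed E"
  have U: "X \<in> car A.UA" if "X \<in> car ?A" for X using that by (simp add: A.car_gauge_fixed)
  have p: "pi1_fixed E vb eb X = ka.hom (th.hom X)" if "X \<in> car ?A" for X
    using that pi1_eq[OF U[OF that]] by (simp add: pi1_fixed_def)
  have pc: "ka.hom (th.hom X) \<in> car (gauge_fixed E2)" if "X \<in> car ?A" for X
    using pi1_gauge_fixed[OF that] pi1_eq[OF U[OF that]] by simp
  note closed = W.add_closed W.scale_closed W.mul_closed W.star_closed
  note th = star_homD[OF th.star_hom_hom]
  note ka = star_homD[OF ka.star_hom_hom]
  have hp: "star_hom ?A (gauge_fixed E2) (pi1_fixed E vb eb)"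
    unfolding star_hom_def
    using closed by (simp add: p pc gauge_fixed_ops U th ka)
  have hf: "star_hom ?A (graph_cstar E1) (f_fixed E vb eb)"
    unfolding star_hom_def B.graph_cstar_UA
    using closed by (simp add: f_fixed_eq gauge_fixed_ops U th)
  have hi: "star_hom (gauge_fixed E2) (graph_cstar E2) (\<lambda>x. x)"
    by (simp add: star_hom_def gauge_fixed_ops C.graph_cstar_UA C.car_gauge_fixed)
  have hj: "star_hom (graph_cstar E1) (graph_cstar E2) (pi2 E vb eb)"
    unfolding pi2_eq B.graph_cstar_UA C.graph_cstar_UA by (rule ka.star_hom_hom)
  have comm: "pi1_fixed E vb eb X = pi2 E vb eb (f_fixed E vb eb X)" if "X \<in> car ?A" for X
    using that by (simp add: p f_fixed_eq pi2_eq)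
  let ?F = "fibre_product (gauge_fixed E2) (graph_cstar E1) (\<lambda>x. x) (pi2 E vb eb)"
  have "star_hom ?A ?F (\<lambda>x. (pi1_fixed E vb eb x, f_fixed E vb eb x))"
    unfolding star_hom_def
    using star_homD[OF hp] star_homD[OF hf] comm by (simp add: fibre_product_def)
  moreover have "bij_betw (\<lambda>x. (pi1_fixed E vb eb x, f_fixed E vb eb x)) (car ?A) (car ?F)"
    unfolding bij_betw_def
  proof
    show "inj_on (\<lambda>x. (pi1_fixed E vb eb x, f_fixed E vb eb x)) (car ?A)"
      by (rule inj_onI) (simp add: f_fixed_eq th_inj)
    show "(\<lambda>x. (pi1_fixed E vb eb x, f_fixed E vb eb x)) ` car ?A = car ?F"
    proof (rule antisym)
      show "(\<lambda>x. (pi1_fixed E vb eb x, f_fixed E vb eb x)) ` car ?A \<subseteq> car ?F"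
        using star_homD(1)[OF hp] star_homD(1)[OF hf] comm by (auto simp: fibre_product_def)
      show "car ?F \<subseteq> (\<lambda>x. (pi1_fixed E vb eb x, f_fixed E vb eb x)) ` car ?A"
      proof
        fix y assume "y \<in> car ?F"
        then obtain a b where y: "y = (a, b)" "a \<in> car (gauge_fixed E2)" "b \<in> car B.UA" "a = ka.hom b"
          by (auto simp: fibre_product_def pi2_eq B.graph_cstar_UA)
        \<comment> \<open>Compatibility makes \<open>a\<close> the image of \<open>b\<close>, so
          only \<open>b\<close> has to be lifted; that \<open>a\<close> is gauge invariant is the
          condition under which this is possible.\<close>
        obtain X where X: "X \<in> car ?A" "th.hom X = b" using th_surj[OF y(3)] y(2,4) by blast
        then have "y = (pi1_fixed E vb eb X, f_fixed E vb eb X)" using y by (simp add: p f_fixed_eq)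
        then show "y \<in> (\<lambda>x. (pi1_fixed E vb eb x, f_fixed E vb eb x)) ` car ?A" using X(1) by blast
      qed
    qed
  qed
  ultimately show ?thesis
    unfolding cstar_pullback_def star_iso_def
    using hp hf hi hj comm A.cstar_algebra_gauge_fixed C.cstar_algebra_gauge_fixed
      B.cstar_algebra_graph C.cstar_algebra_graph by blast
qed

end

theorem corollary2p5:
  fixes E :: "('v, 'e) pre_digraph" and vb :: 'v and eb :: 'e
  assumes "trimmable E vb eb"
  shows "cstar_pullback
    (gauge_fixed E)
    (gauge_fixed (trim2 E vb eb))
    (graph_cstar (trim1 E eb))
    (graph_cstar (trim2 E vb eb))
    (pi1_fixed E vb eb) (f_fixed E vb eb)
    (\<lambda>x. x) (pi2 E vb eb)"
proof -
  interpret trimmable_graph E vb eb by standard (rule assms)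
  show ?thesis by (rule pullback)
qed

end
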